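(* Let $m$ and $M$ be positive integers, let $w=2m$ and let $p$ be an even positive integer. Put $K=\lfloor w/p\rfloor$, $N=[\tfrac14 p]$ and $p^*=4N+2$. Then, as $a\to 0$ in $|\arg a|<\tfrac12\pi$, $$S_p(a;w)=\frac1p\,\Gamma\Bigl(\frac{1-w}{p}\Bigr)a^{(w-1)/p}+\sum_{k=0}^{K}\frac{(-1)^k}{k!}\,\zeta(w-pk)\,a^k+(-1)^m(2\pi)^w I_L,$$ with $$I_L=\sum_{r=0}^{N-1}E_r(a;w,p)+\delta_{pp^*}\,\hat E_N(a;w,p),$$ where $\delta_{pp^*}$ is the Kronecker symbol. The functions $E_r(a;w,p)$ are given by $$E_r(a;w,p)=\frac{A}{2\pi\kappa}\sum_{\pm}\sum_{j=0}^{M-1}(-1)^j c_j\,(Xe^{\mp\pi i\psi_r})^{\vartheta-j}\,S_q(Xe^{\mp\pi i\psi_r};\lambda_j)+R_{M,r}\qquad(0\le r\le N-1),$$ and $\hat E_N(a;w,p)$ is given by the same formula with $r=N$, $\psi_N=0$ and the summation $\sum_\pm$ omitted, that is, $$\hat E_N(a;w,p)=\frac{A}{2\pi\kappa}\sum_{j=0}^{M-1}(-1)^j c_j\,X^{\vartheta-j}\,S_q(X;\lambda_j)+R_{M,N}.$$ The remainders satisfy $$R_{M,r}=O\Bigl(\max_{\pm}\bigl|X^{\vartheta-M}e^{-Xe^{\pm\pi i\psi_r}}\bigr|\Bigr)\qquad(0\le r\le N).$$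
   Context: For $b$ with $|\arg b|<\tfrac12\pi$, an exponent $p>0$ (not necessarily an integer) and real $w$, $S_p(b;w)=\sum_{n=1}^\infty n^{-w}e^{-bn^p}$. $\zeta$ is the Riemann zeta function. $[x]$ denotes the nearest integer: $[x]=N$ when $x\in(N-\tfrac12,N+\tfrac12]$. The symbol $\sum_\pm$ means that the two series corresponding to the upper and lower signs are added. Powers of $a$ and $X$ are principal values. Parameters: $\kappa=p-1$, $h=p^{-p}$, $\vartheta=\tfrac12-w$, $A=(2\pi)^{1/2}\kappa^{1/2-\vartheta}p^{\vartheta}$, $q=p/\kappa$, $\chi=(2\pi)^p/a$, $X=\kappa(h\chi)^{1/\kappa}=\kappa\,(h(2\pi)^p/a)^{1/\kappa}$, $\psi_r=(\tfrac12p-2r-1)/\kappa$ for $0\le r\le N-1$, $\psi_N=0$, and $\lambda_j=1+(w+p(j-\tfrac12))/\kappa$. The coefficients $c_j=c_j(w,p)$ are the constants (with $c_0=1$) uniquely determined by the inverse factorial expansion: for every positive integer $M$, $$\frac{\Gamma(1-w+ps)}{\Gamma(1+s)}=\frac{A}{2\pi}(h\kappa^\kappa)^{-s}\Bigl\{\sum_{j=0}^{M-1}(-1)^jc_j\,\Gamma(\kappa s+\vartheta-j)+\rho_M(s)\,\Gamma(\kappa s+\vartheta-M)\Bigr\},$$ where $\rho_M(s)=O(1)$ as $|s|\to\infty$ in $|\arg s|<\pi$. The functions $I_L$, $E_r$, $\hat E_N$ are the following. Let $L$ be a path parallel to the imaginary axis (traversed upwards) with $\Re(s)>w/p+\delta$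 for some $\delta>0$. Then $$I_L=\frac{(-1)^m(2\pi)^{-w}}{2\pi i}\int_L\Gamma(-s)\,\zeta(w-ps)\,a^s\,ds,$$ $E_r(a;w,p)=J_r^++J_r^-$ for $0\le r\le N-1$ and $\hat E_N(a;w,p)=J$, where $$J_r^\pm=\frac1{2\pi i}\int_L\zeta(1-w+ps)\frac{\Gamma(1-w+ps)}{\Gamma(1+s)}\,\chi^{-s}e^{\pm\pi i(p/2-2r-1)s}\,ds,$$ $$J=\frac1{2\pi i}\int_L\zeta(1-w+ps)\frac{\Gamma(1-w+ps)}{\Gamma(1+s)}\,\chi^{-s}\,ds.$$ *)

theory Defs
  imports "HOL-Complex_Analysis.Complex_Analysis" "HOL-Library.Landau_Symbols"
begin

text \<open>The Riemann zeta function, as the analytic continuation of its Dirichlet series to the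
  complex plane punctured at 1; its value at 1 is unspecified.\<close>

definition is_zeta :: "(complex \<Rightarrow> complex) \<Rightarrow> bool" where
  "is_zeta f \<longleftrightarrow> f holomorphic_on (- {1}) \<and>
     (\<forall>s. Re s > 1 \<longrightarrow> (\<lambda>n. 1 / of_nat (Suc n) powr s) sums f s)"

definition zeta :: "complex \<Rightarrow> complex" where
  "zeta = (SOME f. is_zeta f)"

lemma zeta_eqI:
  assumes "is_zeta f" "s \<noteq> 1"
  shows "zeta s = f s"
proof (rule analytic_continuation_open[where s = "{s. Re s > 1}" and s' = "- {1 :: complex}"
      and f = zeta and g = f])
  have z: "is_zeta zeta"
    unfolding zeta_def using assms(1) by (metis someI)
  show "open {s :: complex. Re s > 1}" by (rule open_halfspace_Re_gt)
  show "open (- {1 :: complex})" by auto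
  have "(2 :: complex) \<in> {s. Re s > 1}" by simp
  thus "{s :: complex. Re s > 1} \<noteq> {}" by blast
  show "connected (- {1 :: complex})"
    by (rule connected_punctured_universe) auto
  show "{s. Re s > 1} \<subseteq> - {1 :: complex}" by auto
  show "zeta holomorphic_on - {1}" "f holomorphic_on - {1}"
    using z assms(1) by (auto simp: is_zeta_def)
  show "zeta t = f t" if "t \<in> {s. Re s > 1}" for t
    using that z assms(1) by (auto simp: is_zeta_def intro: sums_unique2)
  show "s \<in> - {1}" using assms(2) by auto
qed

definition S_series :: "real \<Rightarrow> complex \<Rightarrow> real \<Rightarrow> complex" where
  "S_series p b w =
     (\<Sum>n. of_real (real (Suc n) powr (- w)) * exp (- b * of_real (real (Suc n) powr p)))"

text \<open>The nearest integer, with half-integers rounded down.\<close>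

definition nearest_int :: "real \<Rightarrow> int" where
  "nearest_int x = \<lceil>x - 1 / 2\<rceil>"

lemma nearest_int_eq_iff:
  "nearest_int x = n \<longleftrightarrow> of_int n - 1 / 2 < x \<and> x \<le> of_int n + 1 / 2"
  unfolding nearest_int_def by (auto simp: ceiling_eq_iff)

definition right_half_sector :: "complex set" where
  "right_half_sector = {a. a \<noteq> 0 \<and> \<bar>Arg a\<bar> < pi / 2}"

definition kappa :: "real \<Rightarrow> real" where
  "kappa p = p - 1"

definition h_par :: "real \<Rightarrow> real" where
  "h_par p = p powr (- p)"

definition vartheta :: "real \<Rightarrow> real" where
  "vartheta w = 1 / 2 - w"

definition A_par :: "real \<Rightarrow> real \<Rightarrow> real" where
  "A_par p w = (2 * pi) powr (1 / 2) * kappa p powr (1 / 2 - vartheta w) * p powr vartheta w"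

definition q_par :: "real \<Rightarrow> real" where
  "q_par p = p / kappa p"

definition chi :: "real \<Rightarrow> complex \<Rightarrow> complex" where
  "chi p a = of_real ((2 * pi) powr p) / a"

definition X_var :: "real \<Rightarrow> complex \<Rightarrow> complex" where
  "X_var p a = of_real (kappa p) * (of_real (h_par p) * chi p a) powr of_real (1 / kappa p)"

definition N_par :: "real \<Rightarrow> nat" where
  "N_par p = nat (nearest_int (p / 4))"

definition psi :: "real \<Rightarrow> nat \<Rightarrow> real" where
  "psi p r = (if r < N_par p then (p / 2 - 2 * real r - 1) / kappa p else 0)"

definition lam :: "real \<Rightarrow> real \<Rightarrow> nat \<Rightarrow> real" where
  "lam p w j = 1 + (w + p * (real j - 1 / 2)) / kappa p"

definition Gamma_ratio :: "real \<Rightarrow> real \<Rightarrow> complex \<Rightarrow> complex" where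
  "Gamma_ratio p w s = Gamma (1 - of_real w + of_real p * s) / Gamma (1 + s)"

text \<open>The order estimate of the remainder \<open>\<rho>\<close> in the inverse factorial expansion is understood in
  closed subsectors of \<open>\<bar>arg s\<bar> < \<pi>\<close>: it cannot be uniform up to the negative real axis, where
  the quotient of gamma functions has infinitely many poles. The identity itself is required for
  large \<open>s\<close> in these subsectors, where none of the gamma functions in it has a pole.\<close>

definition closed_subsector_at_infinity :: "real \<Rightarrow> complex filter" where
  "closed_subsector_at_infinity \<epsilon> = inf at_infinity (principal {s. \<bar>Arg s\<bar> \<le> pi - \<epsilon>})"

definition inverse_factorial_coeffs :: "real \<Rightarrow> real \<Rightarrow> (nat \<Rightarrow> complex) \<Rightarrow> bool" where
  "inverse_factorial_coeffs p w c \<longleftrightarrow> c 0 = 1 \<and>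
     (\<forall>M>0. \<exists>\<rho> :: complex \<Rightarrow> complex. \<forall>\<epsilon>. 0 < \<epsilon> \<and> \<epsilon> < pi \<longrightarrow>
        (\<forall>\<^sub>F s in closed_subsector_at_infinity \<epsilon>.
           Gamma_ratio p w s =
             of_real (A_par p w / (2 * pi)) * of_real (h_par p * kappa p powr kappa p) powr (- s) *
             ((\<Sum>j<M. (-1) ^ j * c j * Gamma (of_real (kappa p) * s + of_real (vartheta w) - of_nat j))
               + \<rho> s * Gamma (of_real (kappa p) * s + of_real (vartheta w) - of_nat M))) \<and>
        \<rho> \<in> O[closed_subsector_at_infinity \<epsilon>](\<lambda>_. 1))"

text \<open>The integral along the line \<open>Re s = \<sigma>\<close>, traversed upwards.\<close>

definition line_integral :: "real \<Rightarrow> (complex \<Rightarrow> complex) \<Rightarrow> complex" where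
  "line_integral \<sigma> f = (LINT t|lborel. f (Complex \<sigma> t) * \<i>)"

definition I_L :: "real \<Rightarrow> nat \<Rightarrow> real \<Rightarrow> real \<Rightarrow> complex \<Rightarrow> complex" where
  "I_L \<sigma> m p w a =
     (-1) ^ m * of_real ((2 * pi) powr (- w)) / (2 * pi * \<i>) *
     line_integral \<sigma> (\<lambda>s. Gamma (- s) * zeta (of_real w - of_real p * s) * a powr s)"

text \<open>The argument \<open>e\<close> is \<open>1\<close> or \<open>-1\<close>, for the upper and the lower sign.\<close>

definition J_pm :: "real \<Rightarrow> real \<Rightarrow> real \<Rightarrow> real \<Rightarrow> nat \<Rightarrow> complex \<Rightarrow> complex" where
  "J_pm \<sigma> e p w r a = 1 / (2 * pi * \<i>) *
     line_integral \<sigma> (\<lambda>s. zeta (1 - of_real w + of_real p * s) * Gamma_ratio p w s *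
       chi p a powr (- s) * exp (of_real e * pi * \<i> * of_real (p / 2 - 2 * real r - 1) * s))"

definition E_fun :: "real \<Rightarrow> real \<Rightarrow> real \<Rightarrow> nat \<Rightarrow> complex \<Rightarrow> complex" where
  "E_fun \<sigma> p w r a = J_pm \<sigma> 1 p w r a + J_pm \<sigma> (-1) p w r a"

definition E_hat :: "real \<Rightarrow> real \<Rightarrow> real \<Rightarrow> complex \<Rightarrow> complex" where
  "E_hat \<sigma> p w a = 1 / (2 * pi * \<i>) *
     line_integral \<sigma> (\<lambda>s. zeta (1 - of_real w + of_real p * s) * Gamma_ratio p w s *
       chi p a powr (- s))"

definition X_rot :: "real \<Rightarrow> real \<Rightarrow> nat \<Rightarrow> complex \<Rightarrow> complex" where
  "X_rot e p r a = X_var p a * exp (of_real e * pi * \<i> * of_real (psi p r))"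

definition exp_sum :: "(nat \<Rightarrow> complex) \<Rightarrow> nat \<Rightarrow> real \<Rightarrow> real \<Rightarrow> complex \<Rightarrow> complex" where
  "exp_sum c M p w Y =
     (\<Sum>j<M. (-1) ^ j * c j * Y powr of_real (vartheta w - real j) * S_series (q_par p) Y (lam p w j))"

end

theory Submission
  imports Defs "HOL-Real_Asymp.Real_Asymp" "HOL-Probability.Sinc_Integral"
begin

text \<open>The Cahen-Mellin integral for \<open>exp (- a n^p)\<close>, summed against \<open>n^(-w)\<close>, represents \<open>S_p(a; w)\<close> as the
integral of \<open>\<Gamma>(z) \<zeta>(w + p z) a^(-z)\<close> over a line in the right half plane (\<open>line_integral_mellin_zeta_right\<close>).
Moving this line to \<open>Re z = - \<sigma> < - w / p\<close> picks up the pole of \<open>\<zeta>\<close> at \<open>z = (1 - w) / p\<close> and poles of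
\<open>\<Gamma>\<close> at \<open>0, -1, \<dots>, -K\<close>; since \<open>p\<close> and \<open>w\<close> are even, these are distinct. Their residues are the
elementary terms of the formula (\<open>mellin_zeta_shift\<close>), and the integral that is left is \<open>I_L\<close>.

To the left of \<open>- w / p\<close> the functional equation turns the integrand into
\<open>\<zeta>(1 - w + p s) \<Gamma>(1 - w + p s) / \<Gamma>(1 + s)\<close> times an exponential and the quotient
\<open>sin (\<pi> l s) / sin (\<pi> s)\<close>, where \<open>p = 2 l\<close>. Because \<open>l\<close> is an integer, this quotient is a Dirichlet kernel,
that is, a finite sum of exponentials symmetric about 0, with a constant middle term exactly if \<open>l\<close> is odd.
Each exponential contributes one of the integrals \<open>J\<close>, and the middle term contributes the function
\<open>E_hat\<close> (\<open>mellin_zeta_reflected\<close>, \<open>I_L_eq_sum_E\<close>).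

In each integral \<open>J\<close> the zeta function is expanded into its Dirichlet series again. The \<open>n\<close>-th term is an
inverse Mellin transform of the gamma quotient at a point \<open>Y\<close> shifted by \<open>q ln n\<close>. Inserting the inverse
factorial expansion, each \<open>\<Gamma>(v - j)\<close> integrates to \<open>exp (- j Y) exp (- exp Y)\<close> by the Cahen-Mellin formula.
What matters is that the remainder is \<open>O(exp (- M Re Y) exp (- Re (exp Y)))\<close> uniformly up to the lines
\<open>\<bar>Im Y\<bar> = \<pi> / 2\<close>, as \<open>a\<close> may approach 0 tangentially to the imaginary axis
(\<open>inverse_Mellin_factorial_expansion\<close>); given this uniformity, the estimates can be summed over \<open>n\<close>
(\<open>line_integral_zeta_ratio_exp_asymptotic\<close>), which reassembles the series \<open>S_q\<close>.

The continuation and functional equation of \<open>\<zeta>\<close> that this uses are derived from the Abel-Plana summation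
formula (\<open>Abel_Plana_finite\<close>, \<open>zeta_cont_integral\<close>, \<open>zeta_functional_equation\<close>).\<close>


section \<open>Growth of the gamma function in vertical strips\<close>

lemma norm_Gamma_le_Gamma_Re:
  assumes "Re z > 0"
  shows "norm (Gamma z) \<le> Gamma (Re z)"
proof -
  have 1: "((\<lambda>t. of_real t powr (z - 1) / of_real (exp t)) has_integral Gamma z) {0<..}"
    by (rule Gamma_integral_complex'[OF assms])
  have 2: "((\<lambda>t. t powr (Re z - 1) / exp t) has_integral Gamma (Re z)) {0<..}"
  proof -
    have "((\<lambda>t. if t \<in> {0<..} then t powr (Re z - 1) / exp t else 0) has_integral Gamma (Re z)) {0..}"
      using Gamma_integral_real[OF assms] by (rule has_integral_spike [of "{0}", rotated 2]) auto
    thus ?thesis by (subst (asm) has_integral_restrict) auto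
  qed
  have "norm (integral {0<..} (\<lambda>t. of_real t powr (z - 1) / of_real (exp t) :: complex))
        \<le> integral {0<..} (\<lambda>t. t powr (Re z - 1) / exp t)"
    using 1 2 by (intro integral_norm_bound_integral)
      (auto simp: norm_divide norm_powr_real_powr integrable_on_def)
  thus ?thesis using 1 2 by (simp add: integral_unique)
qed

lemma norm_Gamma_le_binomial:
  assumes v: "Re v > 0" and b: "norm (1 - b) < 1"
  shows "norm (Gamma v * b powr (-v)) \<le> Gamma (Re v) * (1 - norm (1 - b)) powr (- Re v)"
proof -
  have nz: "v \<notin> \<int>\<^sub>\<le>\<^sub>0" using v by (auto elim!: nonpos_Ints_cases)
  have nzr: "Re v \<notin> \<int>\<^sub>\<le>\<^sub>0" using v by (auto elim!: nonpos_Ints_cases)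
  have "(\<lambda>n. ((-v) gchoose n) * (b - 1) ^ n) sums (1 + (b - 1)) powr (-v)"
    using b by (intro gen_binomial_complex) (simp add: norm_minus_commute)
  hence "(\<lambda>n. Gamma v * (((-v) gchoose n) * (b - 1) ^ n)) sums (Gamma v * b powr (-v))"
    by (intro sums_mult) simp
  also have "(\<lambda>n. Gamma v * (((-v) gchoose n) * (b - 1) ^ n)) =
             (\<lambda>n. Gamma (v + of_nat n) * (1 - b) ^ n / fact n)"
  proof
    fix n
    have "(-v) gchoose n = (-1) ^ n * pochhammer v n / fact n"
      by (simp add: gbinomial_pochhammer)
    also have "pochhammer v n = Gamma (v + of_nat n) / Gamma v"
      using nz by (rule pochhammer_Gamma)
    finally have "Gamma v * ((-v) gchoose n) = (-1) ^ n * Gamma (v + of_nat n) / fact n"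
      using nz by (simp add: Gamma_eq_zero_iff)
    moreover have "(b - 1) ^ n = (-1) ^ n * (1 - b) ^ n"
      by (simp flip: power_mult_distrib)
    ultimately have "(Gamma v * ((-v) gchoose n)) * (b - 1) ^ n =
                 ((-1) ^ n * (-1) ^ n) * (Gamma (v + of_nat n) * (1 - b) ^ n / fact n)"
      by (simp only: mult_ac times_divide_eq_left times_divide_eq_right)
    also have "(-1 :: complex) ^ n * (-1) ^ n = 1" by (simp flip: power_mult_distrib)
    finally show "Gamma v * (((-v) gchoose n) * (b - 1) ^ n) = 
                  Gamma (v + of_nat n) * (1 - b) ^ n / fact n" by (simp add: mult.assoc)
  qed
  finally have S: "(\<lambda>n. Gamma (v + of_nat n) * (1 - b) ^ n / fact n) sums (Gamma v * b powr (-v))" .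
  have "(\<lambda>n. ((-Re v) gchoose n) * (- norm (1 - b)) ^ n) sums (1 + - norm (1 - b)) powr (-Re v)"
    using b by (intro gen_binomial_real) auto
  hence "(\<lambda>n. Gamma (Re v) * (((-Re v) gchoose n) * (- norm (1 - b)) ^ n)) sums 
          (Gamma (Re v) * (1 - norm (1 - b)) powr (-Re v))"
    by (intro sums_mult) simp
  also have "(\<lambda>n. Gamma (Re v) * (((-Re v) gchoose n) * (- norm (1 - b)) ^ n)) =
             (\<lambda>n. Gamma (Re v + of_nat n) * norm (1 - b) ^ n / fact n)"
  proof
    fix n
    have "(-Re v) gchoose n = (-1) ^ n * pochhammer (Re v) n / fact n"
      by (simp add: gbinomial_pochhammer)
    also have "pochhammer (Re v) n = Gamma (Re v + of_nat n) / Gamma (Re v)"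
      using nzr by (rule pochhammer_Gamma)
    finally have "Gamma (Re v) * ((-Re v) gchoose n) = (-1) ^ n * Gamma (Re v + of_nat n) / fact n"
      using nzr by (simp add: Gamma_eq_zero_iff)
    moreover have "(- norm (1 - b)) ^ n = (-1) ^ n * norm (1 - b) ^ n"
      by (simp flip: power_mult_distrib)
    ultimately have "(Gamma (Re v) * ((-Re v) gchoose n)) * (- norm (1 - b)) ^ n =
                 ((-1) ^ n * (-1) ^ n) * (Gamma (Re v + of_nat n) * norm (1 - b) ^ n / fact n)"
      by (simp only: mult_ac times_divide_eq_left times_divide_eq_right)
    also have "(-1 :: real) ^ n * (-1) ^ n = 1" by (simp flip: power_mult_distrib)
    finally show "Gamma (Re v) * (((-Re v) gchoose n) * (- norm (1 - b)) ^ n) = 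
                  Gamma (Re v + of_nat n) * norm (1 - b) ^ n / fact n" by (simp add: mult.assoc)
  qed
  finally have R: "(\<lambda>n. Gamma (Re v + of_nat n) * norm (1 - b) ^ n / fact n) sums 
          (Gamma (Re v) * (1 - norm (1 - b)) powr (-Re v))" .
  have le: "norm (Gamma (v + of_nat n) * (1 - b) ^ n / fact n) \<le> Gamma (Re v + of_nat n) * norm (1 - b) ^ n / fact n" for n
    using norm_Gamma_le_Gamma_Re[of "v + of_nat n"] v
    by (auto simp: norm_mult norm_divide norm_power intro!: divide_right_mono mult_right_mono)
  have "norm (\<Sum>n. Gamma (v + of_nat n) * (1 - b) ^ n / fact n) \<le> 
        (\<Sum>n. Gamma (Re v + of_nat n) * norm (1 - b) ^ n / fact n)"
    using le sums_summable[OF R] by (intro norm_suminf_le)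
  thus ?thesis using S R by (simp add: sums_iff)
qed

text \<open>Turning the path in Euler's integral by an angle below \<open>\<pi> / 2\<close> leaves the value unchanged and trades the
factor \<open>cos \<theta>\<close> for exponential decay on vertical lines. The binomial estimate above gives this rotation
without contour integration. It is the substitute for Stirling's formula in all that follows.\<close>

lemma norm_Gamma_le_rotated:
  assumes u: "Re v > 0" and \<theta>: "\<bar>\<theta>\<bar> < pi / 2"
  shows "norm (Gamma v) * exp (\<theta> * Im v) \<le> Gamma (Re v) / cos \<theta> powr Re v"
proof -
  define c where "c = cos \<theta>"
  have c: "c > 0" "c \<le> 1" using \<theta> by (auto simp: c_def intro!: cos_gt_zero_pi)
  have *: "norm (Gamma v) * exp (\<theta> * Im v) * (c - R / 2) powr Re v \<le> Gamma (Re v)" if R: "0 < R" "R < c" for R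
  proof -
    define b where "b = of_real R * cis \<theta>"
    define d where "d = norm (1 - b)"
    have b0: "b \<noteq> 0" using R by (simp add: b_def)
    have "d ^ 2 = (1 - R * c)^2 + (R * sin \<theta>)^2"
      by (simp add: d_def cmod_def b_def c_def)
    also have "\<dots> = 1 - 2 * R * c + R\<^sup>2 * (c^2 + (sin \<theta>)^2)" by (simp add: power2_eq_square algebra_simps)
    also have "c^2 + (sin \<theta>)^2 = 1" by (simp add: c_def)
    finally have d2: "d ^ 2 = 1 - 2 * R * c + R\<^sup>2" by simp
    have d0: "d \<ge> 0" by (simp add: d_def)
    have "R * R < 2 * R * c" using R c by (simp add: mult_strict_left_mono)
    hence "d ^ 2 < 1 ^ 2" using d2 by (simp add: power2_eq_square)
    hence d1: "d < 1" by (rule power_less_imp_less_base) simp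
    have "1 - d ^ 2 = (1 - d) * (1 + d)" by (simp add: power2_eq_square algebra_simps)
    also have "\<dots> \<le> (1 - d) * 2" using d0 d1 by (intro mult_left_mono) auto
    finally have "R * (c - R / 2) \<le> 1 - d" using d2 by (simp add: power2_eq_square algebra_simps)
    hence 1: "c - R / 2 \<le> (1 - d) / R" using R by (simp add: field_simps)
    have Lnb: "Ln b = Complex (ln R) \<theta>"
    proof -
      have "b = exp (Complex (ln R) \<theta>)" using R by (simp add: b_def exp_eq_polar)
      thus ?thesis using \<theta> by (simp add: Ln_exp)
    qed
    have "norm (b powr (-v)) = exp (- Re v * ln R + \<theta> * Im v)"
      using b0 by (simp add: powr_def Lnb)
    also have "\<dots> = R powr (- Re v) * exp (\<theta> * Im v)" using R by (simp add: powr_def flip: exp_add)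
    finally have nb: "norm (b powr (-v)) = R powr (- Re v) * exp (\<theta> * Im v)" .
    have "norm (Gamma v) * exp (\<theta> * Im v) * R powr (- Re v) \<le> Gamma (Re v) * (1 - d) powr (- Re v)"
      using norm_Gamma_le_binomial[OF u, of b] d1 nb by (simp add: d_def norm_mult mult_ac)
    hence 2: "norm (Gamma v) * exp (\<theta> * Im v) * ((1 - d) / R) powr Re v \<le> Gamma (Re v)"
      using d1 R by (simp add: powr_minus powr_divide field_simps)
    have "(c - R / 2) powr Re v \<le> ((1 - d) / R) powr Re v"
      using 1 R u by (intro powr_mono2) auto
    from mult_left_mono[OF this, of "norm (Gamma v) * exp (\<theta> * Im v)"] 2 show ?thesis by simp
  qed
  have "((\<lambda>R. norm (Gamma v) * exp (\<theta> * Im v) * (c - R / 2) powr Re v) \<longlongrightarrow>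
          norm (Gamma v) * exp (\<theta> * Im v) * (c - 0 / 2) powr Re v) (at_right 0)"
    using c by (intro tendsto_intros) auto
  moreover have "eventually (\<lambda>R. norm (Gamma v) * exp (\<theta> * Im v) * (c - R / 2) powr Re v \<le> Gamma (Re v)) (at_right 0)"
    using eventually_at_right_less[of 0] order_tendstoD(2)[OF tendsto_ident_at c(1)]
    by eventually_elim (use * in auto)
  ultimately have "norm (Gamma v) * exp (\<theta> * Im v) * (c - 0 / 2) powr Re v \<le> Gamma (Re v)"
    by (rule tendsto_upperbound) simp
  thus ?thesis using c by (simp add: c_def field_simps)
qed

text \<open>Exponential growth of rate at most \<open>\<mu>\<close> far out in a vertical strip. Nothing is required for small
imaginary parts, so that functions with poles in the strip qualify, and the rates add under products.\<close>

definition strip_bound :: "real \<Rightarrow> real \<Rightarrow> real \<Rightarrow> (complex \<Rightarrow> complex) \<Rightarrow> bool" where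
  "strip_bound a b \<mu> f \<longleftrightarrow>
     (\<exists>C T. \<forall>x y. a \<le> x \<and> x \<le> b \<and> T \<le> \<bar>y\<bar> \<longrightarrow> norm (f (Complex x y)) \<le> C * exp (\<mu> * \<bar>y\<bar>))"

lemma strip_boundI:
  assumes "\<And>x y. a \<le> x \<Longrightarrow> x \<le> b \<Longrightarrow> T \<le> \<bar>y\<bar> \<Longrightarrow> norm (f (Complex x y)) \<le> C * exp (\<mu> * \<bar>y\<bar>)"
  shows "strip_bound a b \<mu> f"
  using assms unfolding strip_bound_def by blast

lemma strip_boundD:
  assumes "strip_bound a b \<mu> f"
  shows "\<exists>C T. C > 0 \<and> T > 0 \<and>
    (\<forall>x y. a \<le> x \<longrightarrow> x \<le> b \<longrightarrow> T \<le> \<bar>y\<bar> \<longrightarrow> norm (f (Complex x y)) \<le> C * exp (\<mu> * \<bar>y\<bar>))"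
proof -
  from assms obtain C T where CT:
    "\<And>x y. a \<le> x \<Longrightarrow> x \<le> b \<Longrightarrow> T \<le> \<bar>y\<bar> \<Longrightarrow> norm (f (Complex x y)) \<le> C * exp (\<mu> * \<bar>y\<bar>)"
    unfolding strip_bound_def by blast
  have norm_le: "norm (f (Complex x y)) \<le> max C 1 * exp (\<mu> * \<bar>y\<bar>)"
    if xy: "a \<le> x" "x \<le> b" "max T 1 \<le> \<bar>y\<bar>" for x y
  proof -
    have "norm (f (Complex x y)) \<le> C * exp (\<mu> * \<bar>y\<bar>)" using xy by (intro CT) auto
    also have "\<dots> \<le> max C 1 * exp (\<mu> * \<bar>y\<bar>)" by (intro mult_right_mono) auto
    finally show "norm (f (Complex x y)) \<le> max C 1 * exp (\<mu> * \<bar>y\<bar>)" .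
  qed
  show ?thesis
    by (rule exI[of _ "max C 1"], rule exI[of _ "max T 1"]) (use norm_le in auto)
qed

lemma strip_bound_mono:
  assumes "strip_bound a b \<mu> f" "a \<le> a'" "b' \<le> b" "\<mu> \<le> \<mu>'"
  shows "strip_bound a' b' \<mu>' f"
proof -
  obtain C T where CT: "C > 0" "T > 0"
    "\<And>x y. a \<le> x \<Longrightarrow> x \<le> b \<Longrightarrow> T \<le> \<bar>y\<bar> \<Longrightarrow> norm (f (Complex x y)) \<le> C * exp (\<mu> * \<bar>y\<bar>)"
    using strip_boundD[OF assms(1)] by blast
  show ?thesis
  proof (rule strip_boundI)
    fix x y assume "a' \<le> x" "x \<le> b'" "T \<le> \<bar>y\<bar>"
    hence "norm (f (Complex x y)) \<le> C * exp (\<mu> * \<bar>y\<bar>)" using assms by (intro CT) auto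
    also have "\<dots> \<le> C * exp (\<mu>' * \<bar>y\<bar>)" using CT assms by (intro mult_left_mono) (auto intro: mult_right_mono)
    finally show "norm (f (Complex x y)) \<le> C * exp (\<mu>' * \<bar>y\<bar>)" .
  qed
qed

lemma strip_bound_cong:
  assumes "strip_bound a b \<mu> f" "\<And>x y. a \<le> x \<Longrightarrow> x \<le> b \<Longrightarrow> y \<noteq> 0 \<Longrightarrow> g (Complex x y) = f (Complex x y)"
  shows "strip_bound a b \<mu> g"
proof -
  obtain C T where CT: "C > 0" "T > 0"
    "\<And>x y. a \<le> x \<Longrightarrow> x \<le> b \<Longrightarrow> T \<le> \<bar>y\<bar> \<Longrightarrow> norm (f (Complex x y)) \<le> C * exp (\<mu> * \<bar>y\<bar>)"
    using strip_boundD[OF assms(1)] by blast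
  show ?thesis
    using CT assms(2) by (intro strip_boundI[where T = T and C = C]) (metis abs_0 not_le)
qed

lemma strip_bound_union:
  assumes "strip_bound a b \<mu> f" "strip_bound b c \<mu> f"
  shows "strip_bound a c \<mu> f"
proof -
  obtain C T where CT: "C > 0" "T > 0"
    "\<And>x y. a \<le> x \<Longrightarrow> x \<le> b \<Longrightarrow> T \<le> \<bar>y\<bar> \<Longrightarrow> norm (f (Complex x y)) \<le> C * exp (\<mu> * \<bar>y\<bar>)"
    using strip_boundD[OF assms(1)] by blast
  obtain C' T' where CT': "C' > 0" "T' > 0"
    "\<And>x y. b \<le> x \<Longrightarrow> x \<le> c \<Longrightarrow> T' \<le> \<bar>y\<bar> \<Longrightarrow> norm (f (Complex x y)) \<le> C' * exp (\<mu> * \<bar>y\<bar>)"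
    using strip_boundD[OF assms(2)] by blast
  show ?thesis
  proof (rule strip_boundI)
    fix x y assume xy: "a \<le> x" "x \<le> c" "max T T' \<le> \<bar>y\<bar>"
    have le: "C * exp (\<mu> * \<bar>y\<bar>) \<le> max C C' * exp (\<mu> * \<bar>y\<bar>)" "C' * exp (\<mu> * \<bar>y\<bar>) \<le> max C C' * exp (\<mu> * \<bar>y\<bar>)"
      by (auto intro!: mult_right_mono)
    show "norm (f (Complex x y)) \<le> max C C' * exp (\<mu> * \<bar>y\<bar>)"
      using order_trans[OF CT(3) le(1)] order_trans[OF CT'(3) le(2)] xy by (cases "x \<le> b") auto
  qed
qed

lemma strip_bound_mult:
  assumes "strip_bound a b \<mu> f" "strip_bound a b \<nu> g"
  shows "strip_bound a b (\<mu> + \<nu>) (\<lambda>s. f s * g s)"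
proof -
  obtain C T where CT: "C > 0" "T > 0"
    "\<And>x y. a \<le> x \<Longrightarrow> x \<le> b \<Longrightarrow> T \<le> \<bar>y\<bar> \<Longrightarrow> norm (f (Complex x y)) \<le> C * exp (\<mu> * \<bar>y\<bar>)"
    using strip_boundD[OF assms(1)] by blast
  obtain C' T' where CT': "C' > 0" "T' > 0"
    "\<And>x y. a \<le> x \<Longrightarrow> x \<le> b \<Longrightarrow> T' \<le> \<bar>y\<bar> \<Longrightarrow> norm (g (Complex x y)) \<le> C' * exp (\<nu> * \<bar>y\<bar>)"
    using strip_boundD[OF assms(2)] by blast
  show ?thesis
  proof (rule strip_boundI)
    fix x y assume xy: "a \<le> x" "x \<le> b" "max T T' \<le> \<bar>y\<bar>"
    have "norm (f (Complex x y)) * norm (g (Complex x y)) \<le> (C * exp (\<mu> * \<bar>y\<bar>)) * (C' * exp (\<nu> * \<bar>y\<bar>))"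
      using CT(1,2) CT'(1,2) CT(3)[of x y] CT'(3)[of x y] xy by (intro mult_mono) auto
    also have "\<dots> = C * C' * exp ((\<mu> + \<nu>) * \<bar>y\<bar>)" by (simp add: exp_add algebra_simps)
    finally show "norm (f (Complex x y) * g (Complex x y)) \<le> C * C' * exp ((\<mu> + \<nu>) * \<bar>y\<bar>)"
      by (simp add: norm_mult)
  qed
qed

lemma strip_bound_add:
  assumes "strip_bound a b \<mu> f" "strip_bound a b \<mu> g"
  shows "strip_bound a b \<mu> (\<lambda>s. f s + g s)"
proof -
  obtain C T where CT: "C > 0" "T > 0"
    "\<And>x y. a \<le> x \<Longrightarrow> x \<le> b \<Longrightarrow> T \<le> \<bar>y\<bar> \<Longrightarrow> norm (f (Complex x y)) \<le> C * exp (\<mu> * \<bar>y\<bar>)"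
    using strip_boundD[OF assms(1)] by blast
  obtain C' T' where CT': "C' > 0" "T' > 0"
    "\<And>x y. a \<le> x \<Longrightarrow> x \<le> b \<Longrightarrow> T' \<le> \<bar>y\<bar> \<Longrightarrow> norm (g (Complex x y)) \<le> C' * exp (\<mu> * \<bar>y\<bar>)"
    using strip_boundD[OF assms(2)] by blast
  show ?thesis
  proof (rule strip_boundI)
    fix x y assume xy: "a \<le> x" "x \<le> b" "max T T' \<le> \<bar>y\<bar>"
    show "norm (f (Complex x y) + g (Complex x y)) \<le> (C + C') * exp (\<mu> * \<bar>y\<bar>)"
      using CT(3)[of x y] CT'(3)[of x y] xy norm_triangle_ineq[of "f (Complex x y)" "g (Complex x y)"]
      by (auto simp: algebra_simps)
  qed
qed

lemma strip_bound_const: "strip_bound a b 0 (\<lambda>_. c)"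
  by (rule strip_boundI[where C = "norm c"]) auto

lemma strip_bound_cmult:
  assumes "strip_bound a b \<mu> f"
  shows "strip_bound a b \<mu> (\<lambda>s. c * f s)"
  using strip_bound_mult[OF strip_bound_const[of a b c] assms] by simp

lemma strip_bound_diff:
  assumes "strip_bound a b \<mu> f" "strip_bound a b \<mu> g"
  shows "strip_bound a b \<mu> (\<lambda>s. f s - g s)"
  using strip_bound_add[OF assms(1) strip_bound_cmult[OF assms(2), of "-1"]] by simp

lemma strip_bound_affine:
  assumes "strip_bound a' b' \<mu> f" "\<beta> \<noteq> 0"
    and "\<And>x. a \<le> x \<Longrightarrow> x \<le> b \<Longrightarrow> a' \<le> \<alpha> + \<beta> * x \<and> \<alpha> + \<beta> * x \<le> b'"
  shows "strip_bound a b (\<mu> * \<bar>\<beta>\<bar>) (\<lambda>s. f (of_real \<alpha> + of_real \<beta> * s))"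
proof -
  obtain C T where CT: "C > 0" "T > 0"
    "\<And>x y. a' \<le> x \<Longrightarrow> x \<le> b' \<Longrightarrow> T \<le> \<bar>y\<bar> \<Longrightarrow> norm (f (Complex x y)) \<le> C * exp (\<mu> * \<bar>y\<bar>)"
    using strip_boundD[OF assms(1)] by blast
  show ?thesis
  proof (rule strip_boundI)
    fix x y assume xy: "a \<le> x" "x \<le> b" "T / \<bar>\<beta>\<bar> \<le> \<bar>y\<bar>"
    have eq: "of_real \<alpha> + of_real \<beta> * Complex x y = Complex (\<alpha> + \<beta> * x) (\<beta> * y)" by (simp add: complex_eq_iff)
    have "T \<le> \<bar>\<beta> * y\<bar>" using xy assms(2) by (simp add: abs_mult field_simps)
    hence "norm (f (Complex (\<alpha> + \<beta> * x) (\<beta> * y))) \<le> C * exp (\<mu> * \<bar>\<beta> * y\<bar>)"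
      using assms(3)[of x] xy by (intro CT) auto
    thus "norm (f (of_real \<alpha> + of_real \<beta> * Complex x y)) \<le> C * exp (\<mu> * \<bar>\<beta>\<bar> * \<bar>y\<bar>)"
      by (simp only: eq) (simp add: abs_mult mult_ac)
  qed
qed

lemma strip_bound_exp: "strip_bound a b \<bar>Im z\<bar> (\<lambda>s. exp (z * s))"
proof (rule strip_boundI[where T = 0])
  fix x y :: real assume xy: "a \<le> x" "x \<le> b"
  have "Re z * x \<le> \<bar>Re z\<bar> * (\<bar>a\<bar> + \<bar>b\<bar>)"
  proof -
    have "Re z * x \<le> \<bar>Re z\<bar> * \<bar>x\<bar>" by (simp flip: abs_mult)
    also have "\<dots> \<le> \<bar>Re z\<bar> * (\<bar>a\<bar> + \<bar>b\<bar>)" using xy by (intro mult_left_mono) auto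
    finally show ?thesis .
  qed
  moreover have "- (Im z * y) \<le> \<bar>Im z\<bar> * \<bar>y\<bar>" by (metis abs_ge_minus_self abs_mult)
  ultimately have "Re z * x - Im z * y \<le> \<bar>Re z\<bar> * (\<bar>a\<bar> + \<bar>b\<bar>) + \<bar>Im z\<bar> * \<bar>y\<bar>" by linarith
  thus "norm (exp (z * Complex x y)) \<le> exp (\<bar>Re z\<bar> * (\<bar>a\<bar> + \<bar>b\<bar>)) * exp (\<bar>Im z\<bar> * \<bar>y\<bar>)"
    by (simp add: norm_exp_eq_Re flip: exp_add)
qed

lemma strip_bound_sin: "strip_bound a b \<bar>c\<bar> (\<lambda>s. sin (of_real c * s))"
proof -
  have 1: "strip_bound a b \<bar>c\<bar> (\<lambda>s. exp (\<i> * of_real c * s))" 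
    using strip_bound_exp[of a b "\<i> * of_real c"] by simp
  have 2: "strip_bound a b \<bar>c\<bar> (\<lambda>s. exp (- (\<i> * of_real c) * s))" 
    using strip_bound_exp[of a b "- (\<i> * of_real c)"] by simp
  have "strip_bound a b \<bar>c\<bar> (\<lambda>s. (1 / (2 * \<i>)) * (exp (\<i> * of_real c * s) - exp (- (\<i> * of_real c) * s)))"
    by (intro strip_bound_cmult strip_bound_diff 1 2)
  thus ?thesis by (rule strip_bound_cong) (simp add: sin_exp_eq mult_ac)
qed

lemma strip_bound_power_growth:
  assumes "\<And>x y. a \<le> x \<Longrightarrow> x \<le> b \<Longrightarrow> T \<le> \<bar>y\<bar> \<Longrightarrow> norm (f (Complex x y)) \<le> C * (1 + \<bar>y\<bar>) ^ k" 
  and \<epsilon>: "\<epsilon> > 0"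
  shows "strip_bound a b \<epsilon> f"
proof -
  have "((\<lambda>y::real. (1 + y) ^ k * exp (- \<epsilon> * y)) \<longlongrightarrow> 0) at_top" using \<epsilon> by real_asymp
  hence "eventually (\<lambda>y::real. (1 + y) ^ k * exp (- \<epsilon> * y) < 1) at_top" by (rule order_tendstoD) simp
  then obtain T' where T': "\<And>y. y \<ge> T' \<Longrightarrow> (1 + y) ^ k * exp (- \<epsilon> * y) < 1"
    by (auto simp: eventually_at_top_linorder)
  show ?thesis
  proof (rule strip_boundI)
    fix x y assume xy: "a \<le> x" "x \<le> b" "max T T' \<le> \<bar>y\<bar>"
    have "norm (f (Complex x y)) \<le> C * (1 + \<bar>y\<bar>) ^ k" using xy by (intro assms) auto
    also have "\<dots> \<le> \<bar>C\<bar> * (1 + \<bar>y\<bar>) ^ k" by (intro mult_right_mono) auto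
    also have "(1 + \<bar>y\<bar>) ^ k \<le> exp (\<epsilon> * \<bar>y\<bar>)"
      using T'[of "\<bar>y\<bar>"] xy by (simp add: exp_minus field_simps)
    finally show "norm (f (Complex x y)) \<le> \<bar>C\<bar> * exp (\<epsilon> * \<bar>y\<bar>)" by (simp add: mult_left_mono)
  qed
qed

lemma norm_Gamma_shift_le:
  assumes "Im s \<noteq> 0"
  shows "norm (Gamma s) * \<bar>Im s\<bar> ^ k \<le> norm (Gamma (s + of_nat k))"
proof -
  have s: "s \<notin> \<int>\<^sub>\<le>\<^sub>0" using assms by (auto elim!: nonpos_Ints_cases)
  have "Gamma (s + of_nat k) = Gamma s * pochhammer s k"
    using pochhammer_Gamma[OF s, of k] s by (simp add: Gamma_eq_zero_iff field_simps)
  moreover have "\<bar>Im s\<bar> ^ k \<le> norm (pochhammer s k)"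
  proof -
    have "(\<Prod>i<k. \<bar>Im s\<bar>) \<le> (\<Prod>i<k. norm (s + of_nat i))"
      using abs_Im_le_cmod[of "s + of_nat i" for i] by (intro prod_mono) auto
    thus ?thesis by (simp add: pochhammer_prod prod_norm atLeast0LessThan)
  qed
  ultimately show ?thesis by (simp add: norm_mult mult_left_mono)
qed

text \<open>The true rate \<open>- \<pi> / 2\<close> is approached but not reached, which spares the algebraic factor of Stirling's
formula. Poles do no harm as they are real.\<close>

lemma strip_bound_Gamma:
  assumes "\<eta> < pi / 2"
  shows "strip_bound a b (- \<eta>) Gamma"
proof -
  define \<theta> where "\<theta> = max 0 \<eta>"
  have \<theta>: "0 \<le> \<theta>" "\<theta> < pi / 2" using assms by (auto simp: \<theta>_def max_def)
  have c: "cos \<theta> > 0" "cos \<theta> \<le> 1" using \<theta> by (auto intro!: cos_gt_zero_pi)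
  obtain k :: nat where k: "a + k \<ge> 1" by (metis real_arch_simple add.commute diff_le_eq)
  have "compact (Gamma ` {a+k..b+k})"
    using k by (intro compact_continuous_image continuous_intros) (auto elim!: nonpos_Ints_cases)
  then obtain B where B: "\<And>x. x \<in> {a+k..b+k} \<Longrightarrow> \<bar>Gamma x\<bar> \<le> B"
    by (fastforce dest!: compact_imp_bounded simp: bounded_iff)
  have "strip_bound a b (- \<theta>) Gamma"
  proof (rule strip_boundI)
    fix x y :: real assume xy: "a \<le> x" "x \<le> b" "1 \<le> \<bar>y\<bar>"
    define v where "v = Complex x y + of_nat k"
    define t where "t = (if y \<ge> 0 then \<theta> else - \<theta>)"
    have v: "Re v = x + k" "Im v = y" by (auto simp: v_def)
    have "norm (Gamma (Complex x y)) * 1 \<le> norm (Gamma (Complex x y)) * \<bar>Im (Complex x y)\<bar> ^ k"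
      using xy by (intro mult_left_mono one_le_power) auto
    also have "\<dots> \<le> norm (Gamma v)"
      unfolding v_def using xy by (intro norm_Gamma_shift_le) auto
    finally have 1: "norm (Gamma (Complex x y)) \<le> norm (Gamma v)" by simp
    have "norm (Gamma v) * exp (t * Im v) \<le> Gamma (Re v) / cos t powr Re v"
      using k xy \<theta> by (intro norm_Gamma_le_rotated) (auto simp: v t_def)
    also have "Gamma (Re v) / cos t powr Re v \<le> B / cos \<theta> powr (b + k)"
    proof (intro frac_le)
      show "cos t powr Re v \<ge> cos \<theta> powr (b + k)"
        using c xy by (auto simp: t_def v intro!: powr_mono')
      show "Gamma (Re v) \<le> B" using B[of "Re v"] xy by (auto simp: v)
      show "0 \<le> B" using B[of "Re v"] xy by (auto simp: v)
    qed (use c in auto)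
    also have "t * Im v = \<theta> * \<bar>y\<bar>" by (auto simp: t_def v)
    finally have "norm (Gamma v) * exp (\<theta> * \<bar>y\<bar>) * exp (- \<theta> * \<bar>y\<bar>) \<le> B / cos \<theta> powr (b + k) * exp (- \<theta> * \<bar>y\<bar>)"
      by (intro mult_right_mono) auto
    hence "norm (Gamma v) \<le> B / cos \<theta> powr (b + k) * exp (- \<theta> * \<bar>y\<bar>)"
      by (simp add: mult.assoc flip: exp_add)
    with 1 show "norm (Gamma (Complex x y)) \<le> B / cos \<theta> powr (b + k) * exp (- \<theta> * \<bar>y\<bar>)" by simp
  qed
  thus ?thesis by (rule strip_bound_mono) (auto simp: \<theta>_def)
qed

lemma strip_bound_rGamma:
  assumes "\<eta> > pi / 2"
  shows "strip_bound a b \<eta> rGamma"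
proof -
  have 1: "strip_bound a b (- (pi - \<eta>) * \<bar>-1\<bar>) (\<lambda>s. Gamma (of_real 1 + of_real (-1) * s))"
    using assms by (intro strip_bound_affine[OF strip_bound_Gamma[where a = "1 - b" and b = "1 - a"]]) auto
  have 2: "strip_bound a b \<bar>pi\<bar> (\<lambda>s. sin (of_real pi * s))" by (rule strip_bound_sin)
  have "strip_bound a b \<eta> (\<lambda>s. (1 / of_real pi) * (sin (of_real pi * s) * Gamma (of_real 1 + of_real (-1) * s)))"
    using strip_bound_mult[OF 2 1] by (intro strip_bound_cmult) simp
  thus ?thesis
  proof (rule strip_bound_cong)
    fix x y :: real assume y: "y \<noteq> 0"
    define s where "s = Complex x y"
    have nz: "1 - s \<notin> \<int>\<^sub>\<le>\<^sub>0" using y by (auto elim!: nonpos_Ints_cases simp: s_def complex_eq_iff)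
    have "rGamma s * rGamma (1 - s) = sin (of_real pi * s) / of_real pi"
      by (rule rGamma_reflection_complex)
    thus "rGamma (Complex x y) = 1 / of_real pi * (sin (of_real pi * Complex x y) * 
             Gamma (of_real 1 + of_real (-1) * Complex x y))"
      using nz unfolding s_def[symmetric]
      by (simp add: rGamma_inverse_Gamma[of "1 - s"] Gamma_eq_zero_iff divide_simps)
  qed
qed

section \<open>Shifting vertical lines of integration\<close>

lemma integrable_inverse_1_plus_square_UNIV: "integrable lborel (\<lambda>x::real. 1 / (1 + x\<^sup>2))"
  using integrable_inverse_1_plus_square
  by (simp add: set_integrable_def einterval_def inverse_eq_divide)

lemma exp_decay_le_inverse_square:
  fixes \<eta> :: real
  assumes "\<eta> > 0"
  shows "\<exists>C>0. \<forall>y. exp (- \<eta> * \<bar>y\<bar>) \<le> C / (1 + y\<^sup>2)"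
proof -
  have *: "exp (- \<eta> * \<bar>y\<bar>) \<le> (1 + 2 / \<eta>\<^sup>2) / (1 + y\<^sup>2)" for y
  proof -
    have "1 + \<eta> * \<bar>y\<bar> + (\<eta> * \<bar>y\<bar>)\<^sup>2 / 2 \<le> exp (\<eta> * \<bar>y\<bar>)"
      by (rule exp_lower_Taylor_quadratic) (use assms in auto)
    moreover have "\<eta> * \<bar>y\<bar> \<ge> 0" using assms by simp
    ultimately have le: "1 + \<eta>\<^sup>2 * y\<^sup>2 / 2 \<le> exp (\<eta> * \<bar>y\<bar>)" by (simp add: power_mult_distrib)
    have "1 + y\<^sup>2 \<le> (1 + 2 / \<eta>\<^sup>2) * (1 + \<eta>\<^sup>2 * y\<^sup>2 / 2)"
      using assms by (simp add: field_simps)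
    also have "\<dots> \<le> (1 + 2 / \<eta>\<^sup>2) * exp (\<eta> * \<bar>y\<bar>)"
      using le by (intro mult_left_mono) auto
    finally have "(1 + y\<^sup>2) * exp (- \<eta> * \<bar>y\<bar>) \<le> (1 + 2 / \<eta>\<^sup>2) * exp (\<eta> * \<bar>y\<bar>) * exp (- \<eta> * \<bar>y\<bar>)"
      by (intro mult_right_mono) auto
    hence "(1 + y\<^sup>2) * exp (- \<eta> * \<bar>y\<bar>) \<le> 1 + 2 / \<eta>\<^sup>2"
      by (simp add: mult.assoc flip: exp_add)
    moreover have "1 + y\<^sup>2 > 0" by (simp add: add_pos_nonneg)
    ultimately show ?thesis by (simp add: field_simps)
  qed
  show ?thesis by (rule exI[of _ "1 + 2 / \<eta>\<^sup>2"]) (use * in \<open>auto simp: add_pos_nonneg\<close>)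
qed

lemma line_bound_inverse_square:
  assumes cont: "continuous_on UNIV (\<lambda>t. f (Complex \<sigma> t))"
    and "strip_bound \<sigma> \<sigma> \<mu> f" "\<mu> < 0"
  shows "\<exists>C>0. \<forall>t. norm (f (Complex \<sigma> t)) \<le> C / (1 + t\<^sup>2)"
proof -
  obtain C T where CT: "C > 0" "T > 0"
    "\<And>x y. \<sigma> \<le> x \<Longrightarrow> x \<le> \<sigma> \<Longrightarrow> T \<le> \<bar>y\<bar> \<Longrightarrow> norm (f (Complex x y)) \<le> C * exp (\<mu> * \<bar>y\<bar>)"
    using strip_boundD[OF assms(2)] by blast
  obtain D where D: "D > 0" "\<And>y. exp (- (- \<mu>) * \<bar>y\<bar>) \<le> D / (1 + y\<^sup>2)"
    using exp_decay_le_inverse_square[of "- \<mu>"] assms(3) by auto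
  have "compact ((\<lambda>t. f (Complex \<sigma> t)) ` {-T..T})"
    by (intro compact_continuous_image continuous_on_subset[OF cont]) auto
  then obtain B where B: "\<And>t. t \<in> {-T..T} \<Longrightarrow> norm (f (Complex \<sigma> t)) \<le> B"
    by (fastforce dest!: compact_imp_bounded simp: bounded_iff)
  have "B \<ge> 0" using order_trans[OF norm_ge_zero B[of 0]] CT by auto
  have pos: "1 + t\<^sup>2 > 0" for t :: real by (simp add: add_pos_nonneg)
  show ?thesis
  proof (intro exI[of _ "B * (1 + T\<^sup>2) + C * D"] conjI allI)
    show "0 < B * (1 + T\<^sup>2) + C * D" using \<open>B \<ge> 0\<close> CT D pos by (intro add_nonneg_pos) auto
    fix t
    show "norm (f (Complex \<sigma> t)) \<le> (B * (1 + T\<^sup>2) + C * D) / (1 + t\<^sup>2)"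
    proof (cases "\<bar>t\<bar> \<le> T")
      case True
      have "norm (f (Complex \<sigma> t)) \<le> B" using True by (intro B) auto
      also have "B * (1 + t\<^sup>2) \<le> B * (1 + T\<^sup>2)"
        using True \<open>B \<ge> 0\<close> CT by (intro mult_left_mono add_left_mono) (auto simp: abs_le_square_iff[symmetric])
      hence "B \<le> B * (1 + T\<^sup>2) / (1 + t\<^sup>2)" using pos[of t] by (simp add: field_simps)
      also have "\<dots> \<le> (B * (1 + T\<^sup>2) + C * D) / (1 + t\<^sup>2)" using pos[of t] CT D by (intro divide_right_mono) auto
      finally show ?thesis .
    next
      case False
      hence "norm (f (Complex \<sigma> t)) \<le> C * exp (\<mu> * \<bar>t\<bar>)" by (intro CT) auto
      also have "\<dots> \<le> C * (D / (1 + t\<^sup>2))" using D(2)[of t] CT by (intro mult_left_mono) auto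
      also have "\<dots> \<le> (B * (1 + T\<^sup>2) + C * D) / (1 + t\<^sup>2)" using pos[of t] pos[of T] \<open>B \<ge> 0\<close>
        by (simp add: add_divide_distrib)
      finally show ?thesis .
    qed
  qed
qed

lemma integrable_on_line:
  assumes cont: "continuous_on UNIV (\<lambda>t. f (Complex \<sigma> t))"
    and "strip_bound \<sigma> \<sigma> \<mu> f" "\<mu> < 0"
  shows "integrable lborel (\<lambda>t. f (Complex \<sigma> t))"
proof -
  obtain C where C: "C > 0" "\<And>t. norm (f (Complex \<sigma> t)) \<le> C / (1 + t\<^sup>2)"
    using line_bound_inverse_square[OF assms] by blast
  show ?thesis
  proof (rule Bochner_Integration.integrable_bound)
    show "integrable lborel (\<lambda>t::real. C * (1 / (1 + t\<^sup>2)))"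
      by (intro integrable_mult_right integrable_inverse_1_plus_square_UNIV)
    show "(\<lambda>t. f (Complex \<sigma> t)) \<in> borel_measurable lborel"
      using borel_measurable_continuous_onI[OF cont] by simp
    show "AE t in lborel. norm (f (Complex \<sigma> t)) \<le> norm (C * (1 / (1 + t\<^sup>2)))"
      using C by (auto simp: abs_mult)
  qed
qed

lemma continuous_on_line_holomorphic:
  assumes "f holomorphic_on A" "\<And>t. Complex \<sigma> t \<in> A"
  shows "continuous_on UNIV (\<lambda>t. f (Complex \<sigma> t))"
proof -
  have "continuous_on UNIV (\<lambda>t. Complex \<sigma> t)"
    by (simp add: Complex_eq continuous_intros)
  thus ?thesis
    using assms by (intro continuous_on_compose2[OF holomorphic_on_imp_continuous_on[OF assms(1)]]) auto
qed

lemma integral_symmetric_interval_tendsto: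
  fixes g :: "real \<Rightarrow> complex"
  assumes "integrable lborel g"
  shows "((\<lambda>T. integral {-T..T} g) \<longlongrightarrow> (LINT t|lborel. g t)) at_top"
proof -
  have "((\<lambda>T. LINT t|lborel. indicator {-T..T} t *\<^sub>R g t) \<longlongrightarrow> (LINT t|lborel. g t)) at_top"
  proof (rule integral_dominated_convergence_at_top)
    show "integrable lborel (\<lambda>t. norm (g t))" using assms by simp
    show "AE t in lborel. ((\<lambda>T. indicator {-T..T} t *\<^sub>R g t) \<longlongrightarrow> g t) at_top"
    proof (intro AE_I2)
      fix t :: real
      have "eventually (\<lambda>T. indicator {-T..T} t *\<^sub>R g t = g t) at_top"
        using eventually_ge_at_top[of "\<bar>t\<bar>"] by eventually_elim (auto simp: indicator_def)
      thus "((\<lambda>T. indicator {-T..T} t *\<^sub>R g t) \<longlongrightarrow> g t) at_top" by (rule tendsto_eventually)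
    qed
  qed (use assms in \<open>auto split: split_indicator\<close>)
  moreover have "(LINT t|lborel. indicator {-T..T} t *\<^sub>R g t) = integral {-T..T} g" for T
  proof -
    have "set_integrable lborel {-T..T} g"
      unfolding set_integrable_def using assms by (intro integrable_mult_indicator) auto
    from set_borel_integral_eq_integral(2)[OF this] show ?thesis by (simp add: set_lebesgue_integral_def)
  qed
  ultimately show ?thesis by simp
qed

lemma contour_integral_vertical_linepath:
  assumes "continuous_on {Complex x y |y. c \<le> y \<and> y \<le> d} f" "c < d"
  shows "contour_integral (linepath (Complex x c) (Complex x d)) f = \<i> * integral {c..d} (\<lambda>t. f (Complex x t))"
proof -
  have "continuous_on {c..d} (\<lambda>t. Complex x t)" by (simp add: Complex_eq continuous_intros)
  hence "continuous_on {c..d} (\<lambda>t. f (Complex x t))"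
    by (intro continuous_on_compose2[OF assms(1)]) auto
  hence "((\<lambda>t. f (Complex x t)) has_integral integral {c..d} (\<lambda>t. f (Complex x t))) {c..d}"
    by (intro integrable_integral integrable_continuous_real)
  hence "(f has_contour_integral \<i> * integral {c..d} (\<lambda>t. f (Complex x t))) (linepath (Complex x c) (Complex x d))"
    using assms(2) by (subst has_contour_integral_linepath_same_Re_iff[where a = c and b = d]) auto
  thus ?thesis by (rule contour_integral_unique)
qed

lemma contour_integral_rectpath:
  assumes "a < b" "c < d" and cont: "continuous_on (path_image (rectpath (Complex a c) (Complex b d))) f"
  shows "contour_integral (rectpath (Complex a c) (Complex b d)) f =
     \<i> * integral {c..d} (\<lambda>t. f (Complex b t)) - \<i> * integral {c..d} (\<lambda>t. f (Complex a t))
     + contour_integral (linepath (Complex a c) (Complex b c)) f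
     - contour_integral (linepath (Complex a d) (Complex b d)) f"
proof -
  define l1 l2 l3 l4 where l_defs: "l1 = linepath (Complex a c) (Complex b c)" "l2 = linepath (Complex b c) (Complex b d)"
    "l3 = linepath (Complex b d) (Complex a d)" "l4 = linepath (Complex a d) (Complex a c)"
  have sub: "path_image (rectpath (Complex a c) (Complex b d)) =
     path_image l1 \<union> path_image l2 \<union> path_image l3 \<union> path_image l4"
    by (simp add: rectpath_def Let_def path_image_join Un_assoc l_defs)
  have c: "continuous_on (path_image l1) f" "continuous_on (path_image l2) f" 
      "continuous_on (path_image l3) f" "continuous_on (path_image l4) f"
    by (rule continuous_on_subset[OF cont]; use sub in blast)+
  have i: "f contour_integrable_on l1" "f contour_integrable_on l2" "f contour_integrable_on l3" "f contour_integrable_on l4"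
    using c unfolding l_defs by (auto intro: contour_integrable_continuous_linepath)
  have "contour_integral (rectpath (Complex a c) (Complex b d)) f = contour_integral l1 f + contour_integral l2 f 
     + contour_integral l3 f + contour_integral l4 f"
    using i unfolding rectpath_def Let_def by (simp add: l_defs)
  also have "contour_integral l3 f = - contour_integral (linepath (Complex a d) (Complex b d)) f"
    using contour_integral_reversepath[of "linepath (Complex a d) (Complex b d)" f] by (simp add: l_defs)
  also have "contour_integral l4 f = - contour_integral (linepath (Complex a c) (Complex a d)) f"
    using contour_integral_reversepath[of "linepath (Complex a c) (Complex a d)" f] by (simp add: l_defs)
  also have "contour_integral (linepath (Complex a c) (Complex a d)) f = \<i> * integral {c..d} (\<lambda>t. f (Complex a t))"
  proof (rule contour_integral_vertical_linepath)
    have "{Complex a y |y. c \<le> y \<and> y \<le> d} \<subseteq> path_image l4"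
      using assms by (auto simp: l_defs closed_segment_same_Re closed_segment_eq_real_ivl)
    with c(4) show "continuous_on {Complex a y |y. c \<le> y \<and> y \<le> d} f" by (rule continuous_on_subset)
  qed fact
  also have "contour_integral l2 f = \<i> * integral {c..d} (\<lambda>t. f (Complex b t))" unfolding l_defs
  proof (rule contour_integral_vertical_linepath)
    have "{Complex b y |y. c \<le> y \<and> y \<le> d} \<subseteq> path_image l2"
      using assms by (auto simp: l_defs closed_segment_same_Re closed_segment_eq_real_ivl)
    with c(2) show "continuous_on {Complex b y |y. c \<le> y \<and> y \<le> d} f" by (rule continuous_on_subset)
  qed fact
  finally show ?thesis by (simp add: l_defs)
qed

lemma horizontal_integral_tendsto_0:
  assumes bd: "\<And>x y. a \<le> x \<Longrightarrow> x \<le> b \<Longrightarrow> T1 \<le> y \<Longrightarrow> norm (f (Complex x (e * y))) \<le> C * exp (\<mu> * y)"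
    and "C \<ge> 0" "\<mu> < 0" "a < b"
    and cont: "\<And>T. T \<ge> T0 \<Longrightarrow> continuous_on {Complex x (e * T) |x. a \<le> x \<and> x \<le> b} f"
  shows "((\<lambda>T. contour_integral (linepath (Complex a (e * T)) (Complex b (e * T))) f) \<longlongrightarrow> 0) at_top"
proof -
  have ev: "eventually (\<lambda>T. norm (contour_integral (linepath (Complex a (e * T)) (Complex b (e * T))) f) 
         \<le> C * exp (\<mu> * T) * (b - a)) at_top"
    using eventually_ge_at_top[of "max T0 T1"]
  proof eventually_elim
    case (elim T)
    have seg: "closed_segment (Complex a (e * T)) (Complex b (e * T)) = {Complex x (e * T) |x. a \<le> x \<and> x \<le> b}"
      using assms by (auto simp: closed_segment_same_Im closed_segment_eq_real_ivl complex_eq_iff intro!: exI[of _ "Re _"])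
    have "norm (contour_integral (linepath (Complex a (e * T)) (Complex b (e * T))) f) 
         \<le> C * exp (\<mu> * T) * norm (Complex b (e * T) - Complex a (e * T))"
    proof (rule contour_integral_bound_linepath)
      show "f contour_integrable_on linepath (Complex a (e * T)) (Complex b (e * T))"
        using cont[of T] elim seg by (intro contour_integrable_continuous_linepath) simp
      show "norm (f x) \<le> C * exp (\<mu> * T)" if x: "x \<in> closed_segment (Complex a (e * T)) (Complex b (e * T))" for x
      proof -
        from x obtain r where r: "x = Complex r (e * T)" "a \<le> r" "r \<le> b" unfolding seg by auto
        show ?thesis using bd[of r T] r elim by simp
      qed
    qed (use assms in auto)
    also have "norm (Complex b (e * T) - Complex a (e * T)) = b - a"
      using assms by (simp add: cmod_def)
    finally show ?case .
  qed
  moreover have "((\<lambda>T. C * exp (\<mu> * T) * (b - a)) \<longlongrightarrow> 0) at_top"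
    using \<open>\<mu> < 0\<close> by real_asymp
  ultimately show ?thesis by (rule Lim_null_comparison)
qed

text \<open>The residue theorem on rectangles of growing height; the exponential decay \<open>\<mu> < 0\<close> makes the horizontal
sides negligible.\<close>

theorem line_integral_shift_residues:
  assumes ab: "a' < a" "a < b" "b < b'" and S: "finite S" "\<And>z. z \<in> S \<Longrightarrow> a < Re z \<and> Re z < b"
    and hol: "f holomorphic_on ({s. a' < Re s \<and> Re s < b'} - S)"
    and bd: "strip_bound a b \<mu> f" "\<mu> < 0"
  shows "line_integral b f - line_integral a f = 2 * pi * \<i> * (\<Sum>z\<in>S. residue f z)"
proof -
  define U where "U = {s. a' < Re s \<and> Re s < b'}"
  have U: "open U" "convex U"
    unfolding U_def using open_halfspace_Re_gt[of a'] open_halfspace_Re_lt[of b']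
      convex_halfspace_Re_gt[of a'] convex_halfspace_Re_lt[of b']
    by (auto simp: Collect_conj_eq intro: convex_Int)
  have contf: "continuous_on (U - S) f" using hol unfolding U_def by (rule holomorphic_on_imp_continuous_on)
  obtain B where B: "B > 0" "\<And>z. z \<in> S \<Longrightarrow> \<bar>Im z\<bar> < B"
  proof -
    obtain B where B: "\<And>z. z \<in> S \<Longrightarrow> \<bar>Im z\<bar> \<le> B" "B > 0"
      using finite_imp_bounded[OF S(1)] abs_Im_le_cmod unfolding bounded_pos by (meson order_trans)
    show ?thesis by (rule that[of "B + 1"]) (use B in force)+
  qed
  have ev: "eventually (\<lambda>T. \<i> * integral {-T..T} (\<lambda>t. f (Complex b t)) - \<i> * integral {-T..T} (\<lambda>t. f (Complex a t))
     + contour_integral (linepath (Complex a (-1 * T)) (Complex b (-1 * T))) f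
     - contour_integral (linepath (Complex a (1 * T)) (Complex b (1 * T))) f = 2 * pi * \<i> * (\<Sum>z\<in>S. residue f z)) at_top"
    using eventually_ge_at_top[of B]
  proof eventually_elim
    case (elim T)
    define R where "R = rectpath (Complex a (-T)) (Complex b T)"
    have T: "T > 0" using elim B by simp
    have img: "path_image R \<subseteq> U - S"
    proof
      fix z assume "z \<in> path_image R"
      hence "z \<in> cbox (Complex a (-T)) (Complex b T) - box (Complex a (-T)) (Complex b T)"
        unfolding R_def using T ab by (subst (asm) path_image_rectpath_cbox_minus_box) auto
      thus "z \<in> U - S" using S(2)[of z] B(2)[of z] ab elim
        by (auto simp: U_def in_cbox_complex_iff in_box_complex_iff)
    qed
    have "contour_integral R f = 2 * pi * \<i> * (\<Sum>z\<in>S. winding_number R z * residue f z)"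
    proof (rule Residue_theorem[where S = U])
      show "connected U" using U by (simp add: convex_connected)
      show "\<forall>z. z \<notin> U \<longrightarrow> winding_number R z = 0"
      proof (intro allI impI)
        fix z assume "z \<notin> U"
        thus "winding_number R z = 0" unfolding R_def using T ab
          by (intro winding_number_rectpath_outside) (auto simp: U_def in_cbox_complex_iff)
      qed
    qed (use U S img hol in \<open>auto simp: R_def U_def\<close>)
    also have "(\<Sum>z\<in>S. winding_number R z * residue f z) = (\<Sum>z\<in>S. residue f z)"
    proof (rule sum.cong)
      fix z assume "z \<in> S"
      hence "winding_number R z = 1" unfolding R_def using S(2)[of z] B(2)[of z] elim
        by (intro winding_number_rectpath) (auto simp: in_box_complex_iff)
      thus "winding_number R z * residue f z = residue f z" by simp
    qed simp
    also have "contour_integral R f = \<i> * integral {-T..T} (\<lambda>t. f (Complex b t)) - \<i> * integral {-T..T} (\<lambda>t. f (Complex a t))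
     + contour_integral (linepath (Complex a (-T)) (Complex b (-T))) f
     - contour_integral (linepath (Complex a T) (Complex b T)) f"
      unfolding R_def using ab T img R_def by (intro contour_integral_rectpath continuous_on_subset[OF contf]) auto
    finally show ?case by simp
  qed
  have line: "continuous_on UNIV (\<lambda>t. f (Complex x t))" if "x = a \<or> x = b" for x
    using hol S(2) that ab by (intro continuous_on_line_holomorphic[OF hol]) force+
  have int: "integrable lborel (\<lambda>t. f (Complex x t))" if "x = a \<or> x = b" for x
    using bd(1) that ab by (intro integrable_on_line[OF line[OF that] _ bd(2)] strip_bound_mono[OF bd(1)]) auto
  have hor: "((\<lambda>T. contour_integral (linepath (Complex a (e * T)) (Complex b (e * T))) f) \<longlongrightarrow> 0) at_top" if "\<bar>e\<bar> = 1" for e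
  proof -
    obtain C T1 where CT: "C > 0" "T1 > 0"
      "\<And>x y. a \<le> x \<Longrightarrow> x \<le> b \<Longrightarrow> T1 \<le> \<bar>y\<bar> \<Longrightarrow> norm (f (Complex x y)) \<le> C * exp (\<mu> * \<bar>y\<bar>)"
      using strip_boundD[OF bd(1)] by blast
    show ?thesis
  proof (rule horizontal_integral_tendsto_0[OF _ _ bd(2) ab(2)])
    show "norm (f (Complex x (e * y))) \<le> C * exp (\<mu> * y)" if "a \<le> x" "x \<le> b" "T1 \<le> y" for x y
      using CT(3)[of x "e * y"] that CT(2) \<open>\<bar>e\<bar> = 1\<close> by (simp add: abs_mult)
    show "C \<ge> 0" using CT by simp
    fix T assume T: "T \<ge> B"
    show "continuous_on {Complex x (e * T) |x. a \<le> x \<and> x \<le> b} f"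
      by (rule continuous_on_subset[OF contf])
         (use ab T B that in \<open>force simp: U_def abs_mult\<close>)
  qed
  qed
  have "((\<lambda>T. \<i> * integral {-T..T} (\<lambda>t. f (Complex b t)) - \<i> * integral {-T..T} (\<lambda>t. f (Complex a t))
     + contour_integral (linepath (Complex a (-1 * T)) (Complex b (-1 * T))) f
     - contour_integral (linepath (Complex a (1 * T)) (Complex b (1 * T))) f) \<longlongrightarrow> 
     \<i> * (LINT t|lborel. f (Complex b t)) - \<i> * (LINT t|lborel. f (Complex a t)) + 0 - 0) at_top"
    by (intro tendsto_intros integral_symmetric_interval_tendsto int hor) auto
  moreover have "((\<lambda>T. \<i> * integral {-T..T} (\<lambda>t. f (Complex b t)) - \<i> * integral {-T..T} (\<lambda>t. f (Complex a t))
     + contour_integral (linepath (Complex a (-1 * T)) (Complex b (-1 * T))) f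
     - contour_integral (linepath (Complex a (1 * T)) (Complex b (1 * T))) f) \<longlongrightarrow> 2 * pi * \<i> * (\<Sum>z\<in>S. residue f z)) at_top"
    using ev by (rule tendsto_eventually)
  ultimately have "\<i> * (LINT t|lborel. f (Complex b t)) - \<i> * (LINT t|lborel. f (Complex a t)) + 0 - 0
       = 2 * pi * \<i> * (\<Sum>z\<in>S. residue f z)"
    by (rule tendsto_unique[rotated]) simp
  thus ?thesis by (simp add: line_integral_def mult.commute)
qed

corollary line_integral_shift_holomorphic:
  assumes ab: "a' < a" "a \<le> b" "b < b'" 
    and hol: "f holomorphic_on {s. a' < Re s \<and> Re s < b'}"
    and bd: "strip_bound a b \<mu> f" "\<mu> < 0"
  shows "line_integral a f = line_integral b f"
proof (cases "a = b")
  case False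
  thus ?thesis
    using line_integral_shift_residues[of a' a b b' "{}" f \<mu>] assms by simp
qed simp

section \<open>The Cahen-Mellin integral\<close>

lemma line_integral_suminf:
  assumes cont: "continuous_on UNIV (\<lambda>t. g (Complex \<sigma> t))"
    and bd: "strip_bound \<sigma> \<sigma> \<mu> g" "\<mu> < 0"
    and contu: "\<And>n. continuous_on UNIV (\<lambda>t. u n (Complex \<sigma> t))"
    and a: "\<And>n t. norm (u n (Complex \<sigma> t)) \<le> a n" "summable a"
  shows "(\<lambda>n. line_integral \<sigma> (\<lambda>s. g s * u n s)) sums line_integral \<sigma> (\<lambda>s. g s * (\<Sum>n. u n s))"
proof -
  have intg: "integrable lborel (\<lambda>t. g (Complex \<sigma> t))" by (rule integrable_on_line[OF cont bd])
  have le: "norm (g (Complex \<sigma> t) * u n (Complex \<sigma> t) * \<i>) \<le> a n * norm (g (Complex \<sigma> t))" for n t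
    using mult_left_mono[OF a(1)[of n t], of "norm (g (Complex \<sigma> t))"] by (simp add: norm_mult mult_ac)
  have int: "integrable lborel (\<lambda>t. g (Complex \<sigma> t) * u n (Complex \<sigma> t) * \<i>)" for n
  proof (rule Bochner_Integration.integrable_bound)
    show "integrable lborel (\<lambda>t. a n * norm (g (Complex \<sigma> t)))"
      using intg by (intro integrable_mult_right integrable_norm)
    show "(\<lambda>t. g (Complex \<sigma> t) * u n (Complex \<sigma> t) * \<i>) \<in> borel_measurable lborel"
      using borel_measurable_continuous_onI[OF continuous_on_mult[OF continuous_on_mult[OF cont contu[of n]] continuous_on_const[of _ \<i>]]]
      by simp
    show "AE t in lborel. norm (g (Complex \<sigma> t) * u n (Complex \<sigma> t) * \<i>) \<le> norm (a n * norm (g (Complex \<sigma> t)))"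
      using le by (intro AE_I2) (smt (verit) norm_ge_zero real_norm_def)
  qed
  have sm: "summable (\<lambda>n. norm (g (Complex \<sigma> t) * u n (Complex \<sigma> t) * \<i>))" for t
    by (rule summable_comparison_test'[where N = 0 and g = "\<lambda>n. a n * norm (g (Complex \<sigma> t))"])
       (use le summable_mult2[OF a(2)] in auto)
  have sm2: "summable (\<lambda>n. LINT t|lborel. norm (g (Complex \<sigma> t) * u n (Complex \<sigma> t) * \<i>))"
  proof (rule summable_comparison_test'[where N = 0 and g = "\<lambda>n. a n * (LINT t|lborel. norm (g (Complex \<sigma> t)))"])
    show "summable (\<lambda>n. a n * (LINT t|lborel. norm (g (Complex \<sigma> t))))" by (intro summable_mult2 a)
    fix n
    have "norm (LINT t|lborel. norm (g (Complex \<sigma> t) * u n (Complex \<sigma> t) * \<i>)) = 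
          (LINT t|lborel. norm (g (Complex \<sigma> t) * u n (Complex \<sigma> t) * \<i>))"
      by (simp add: abs_of_nonneg)
    also have "\<dots> \<le> (LINT t|lborel. a n * norm (g (Complex \<sigma> t)))"
      using int[of n] intg le by (intro integral_mono) auto
    finally show "norm (LINT t|lborel. norm (g (Complex \<sigma> t) * u n (Complex \<sigma> t) * \<i>)) \<le> 
        a n * (LINT t|lborel. norm (g (Complex \<sigma> t)))" by simp
  qed
  have "(\<lambda>n. LINT t|lborel. g (Complex \<sigma> t) * u n (Complex \<sigma> t) * \<i>) sums
        (LINT t|lborel. (\<Sum>n. g (Complex \<sigma> t) * u n (Complex \<sigma> t) * \<i>))"
    by (rule sums_integral) (use int sm sm2 in auto)
  moreover have "(\<Sum>n. g (Complex \<sigma> t) * u n (Complex \<sigma> t) * \<i>) = g (Complex \<sigma> t) * (\<Sum>n. u n (Complex \<sigma> t)) * \<i>" for t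
  proof -
    have "summable (\<lambda>n. u n (Complex \<sigma> t))"
      by (rule summable_comparison_test'[OF a(2), of 0]) (use a in auto)
    thus ?thesis by (simp add: suminf_mult summable_mult suminf_mult2 [symmetric])
  qed
  ultimately show ?thesis unfolding line_integral_def by (simp only:)
qed

text \<open>The kernel is parametrised by the logarithm \<open>Y\<close> of the variable, so that no branch of a power has to be
chosen when \<open>Y\<close> is rotated.\<close>

definition Mellin_Gamma :: "complex \<Rightarrow> complex \<Rightarrow> complex" where
  "Mellin_Gamma Y v = Gamma v * exp (- Y * v)"

lemma strip_bound_Mellin_Gamma:
  assumes "\<bar>Im Y\<bar> < pi / 2"
  shows "strip_bound a b ((\<bar>Im Y\<bar> - pi / 2) / 2) (Mellin_Gamma Y)"
proof -
  have "strip_bound a b (- ((pi / 2 + \<bar>Im Y\<bar>) / 2)) Gamma"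
    using assms by (intro strip_bound_Gamma) auto
  moreover have "strip_bound a b \<bar>Im Y\<bar> (\<lambda>v. exp (- Y * v))"
    using strip_bound_exp[of a b "- Y"] by simp
  ultimately have "strip_bound a b (- ((pi / 2 + \<bar>Im Y\<bar>) / 2) + \<bar>Im Y\<bar>) (Mellin_Gamma Y)"
    unfolding Mellin_Gamma_def by (rule strip_bound_mult)
  thus ?thesis by (simp add: field_simps)
qed

lemma Mellin_Gamma_shift:
  assumes Y: "\<bar>Im Y\<bar> < pi / 2" and a: "- real k < a" "a < 1 - real k" and b: "b > 0"
  shows "line_integral b (Mellin_Gamma Y) - line_integral a (Mellin_Gamma Y) = 
           2 * pi * \<i> * (\<Sum>i<k. (- exp Y) ^ i / fact i)"
proof (cases "k = 0")
  case True
  hence a0: "a > 0" using a by simp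
  have hol: "Mellin_Gamma Y holomorphic_on {s. 0 < Re s \<and> Re s < B}" for B
    unfolding Mellin_Gamma_def by (intro holomorphic_intros) (auto elim!: nonpos_Ints_cases)
  have "line_integral (min a b) (Mellin_Gamma Y) = line_integral (max a b) (Mellin_Gamma Y)"
    using a0 b Y by (intro line_integral_shift_holomorphic[where a' = 0 and b' = "max a b + 1", OF _ _ _ hol strip_bound_Mellin_Gamma[OF Y]]) auto
  thus ?thesis using True by (auto simp: min_def max_def split: if_splits)
next
  case False
  define S :: "complex set" where "S = (\<lambda>i. - of_nat i) ` {..<k}"
  have neg: "s \<in> S" if s: "s \<in> \<int>\<^sub>\<le>\<^sub>0" "(a - k) / 2 < Re s" for s
  proof -
    obtain n where n: "s = - of_nat n" using s(1) by (auto elim!: nonpos_Ints_cases')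
    hence "Re s = - real n" by simp
    hence "(a - real k) / 2 < - real n" using s(2) by simp
    hence "2 * real n < 2 * real k" using a by (simp add: field_simps)
    hence "n < k" by simp
    thus ?thesis using n by (auto simp: S_def)
  qed
  have hol: "Mellin_Gamma Y holomorphic_on ({s. (a - k) / 2 < Re s \<and> Re s < b + 1} - S)"
    unfolding Mellin_Gamma_def
    by (intro holomorphic_intros) (use neg in blast)
  have "line_integral b (Mellin_Gamma Y) - line_integral a (Mellin_Gamma Y) = 2 * pi * \<i> * (\<Sum>z\<in>S. residue (Mellin_Gamma Y) z)"
  proof (rule line_integral_shift_residues[OF _ _ _ _ _ hol strip_bound_Mellin_Gamma[OF Y]])
    show "(a - k) / 2 < a" using a(1) by (simp add: field_simps)
    have k1: "1 - real k \<le> 0" using False by simp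
    show "a < b" using a(2) b k1 by linarith
    show "a < Re z \<and> Re z < b" if "z \<in> S" for z
    proof -
      from that obtain i where i: "i < k" "z = - of_nat i" by (auto simp: S_def)
      have "a < - real i" using a(2) i(1) by linarith
      moreover have "- real i < b" using b by linarith
      ultimately show ?thesis using i(2) by simp
    qed
    show "b < b + 1" by simp
    show "finite S" by (simp add: S_def)
    show "(\<bar>Im Y\<bar> - pi / 2) / 2 < 0" using Y by simp
  qed
  also have "(\<Sum>z\<in>S. residue (Mellin_Gamma Y) z) = (\<Sum>i<k. residue (Mellin_Gamma Y) (- of_nat i))"
    unfolding S_def by (subst sum.reindex) (auto simp: inj_on_def)
  also have "\<dots> = (\<Sum>i<k. (- exp Y) ^ i / fact i)"
  proof (rule sum.cong)
    fix i
    define z :: complex where "z = - of_nat i"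
    have lim: "(\<lambda>w. Gamma w * (w - z)) \<midarrow>z\<rightarrow> (-1) ^ i / fact i"
      using Gamma_residues[of i] unfolding z_def by simp
    have "(\<lambda>w. Gamma w * (w - z) * exp (- Y * w)) \<midarrow>z\<rightarrow> (-1) ^ i / fact i * exp (- Y * z)"
      by (rule tendsto_mult[OF lim]) (intro tendsto_intros)
    hence lim2: "((\<lambda>w. Mellin_Gamma Y w * (w - z)) \<longlongrightarrow> (-1) ^ i / fact i * exp (- Y * z)) (at z)"
      by (simp add: Mellin_Gamma_def mult_ac)
    have "residue (Mellin_Gamma Y) z = (-1) ^ i / fact i * exp (- Y * z)"
    proof (rule residue_simple'[OF _ _ _ lim2])
      show "open (ball z 1)" "z \<in> ball z 1" by auto
      show "Mellin_Gamma Y holomorphic_on ball z 1 - {z}" unfolding Mellin_Gamma_def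
      proof (intro holomorphic_intros equals0I)
        fix w assume "w \<in> (ball z 1 - {z}) \<inter> \<int>\<^sub>\<le>\<^sub>0"
        hence w: "w \<in> ball z 1 - {z}" "w \<in> \<int>\<^sub>\<le>\<^sub>0" by blast+
          from w(2) obtain n where n: "w = - of_nat n" by (auto elim!: nonpos_Ints_cases')
          have "z - w = of_real (real n - real i)" by (simp add: n z_def)
          hence "dist z w = \<bar>real n - real i\<bar>" unfolding dist_norm by (simp only: norm_of_real)
          moreover have "n \<noteq> i" using w n by (auto simp: z_def)
          ultimately show False using w by auto
      qed
    qed
    also have "exp (- Y * z) = exp (of_nat i * Y)" by (simp add: z_def mult.commute)
    also have "\<dots> = exp Y ^ i" by (rule exp_of_nat_mult)
    also have "(-1) ^ i / fact i * exp Y ^ i = (- exp Y) ^ i / fact i"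
      unfolding power_minus[of "exp Y"] by simp
    finally show "residue (Mellin_Gamma Y) (- of_nat i) = (- exp Y) ^ i / fact i"
      by (simp only: z_def)
  qed simp
  finally show ?thesis .
qed

lemma norm_Gamma_neg_half_le:
  "norm (Gamma (Complex (- real n - 1/2) t)) \<le> 2 * norm (Gamma (Complex (1/2) t)) / fact n"
proof -
  define s where "s = Complex (- real n - 1/2) t"
  have s: "s \<notin> \<int>\<^sub>\<le>\<^sub>0"
  proof
    assume "s \<in> \<int>\<^sub>\<le>\<^sub>0"
    then obtain m where "s = - of_nat m" by (auto elim!: nonpos_Ints_cases')
    hence "real n + 1 / 2 = real m" by (simp add: s_def complex_eq_iff)
    hence "2 * n + 1 = 2 * m" by linarith
    thus False by presburger
  qed
  have "Gamma (s + of_nat (Suc n)) = Gamma s * pochhammer s (Suc n)"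
    using pochhammer_Gamma[OF s, of "Suc n"] s by (simp add: Gamma_eq_zero_iff field_simps)
  also have "s + of_nat (Suc n) = Complex (1/2) t" by (simp add: s_def complex_eq_iff)
  finally have eq: "Gamma (Complex (1/2) t) = Gamma s * pochhammer s (Suc n)" .
  have "fact n / 2 \<le> (\<Prod>i\<le>n. real i + 1 / 2)"
  proof (induction n)
    case (Suc n)
    have "fact (Suc n) / 2 = (fact n / 2) * (real (Suc n))" by simp
    also have "\<dots> \<le> (\<Prod>i\<le>n. real i + 1 / 2) * (real (Suc n) + 1 / 2)"
      by (rule mult_mono[OF Suc]) (auto intro!: prod_nonneg)
    finally show ?case by simp
  qed auto
  also have "(\<Prod>i\<le>n. real i + 1 / 2) = (\<Prod>i\<le>n. real (n - i) + 1 / 2)"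
    using prod.nat_diff_reindex[of "\<lambda>i. real i + 1/2" "Suc n"] by (simp add: lessThan_Suc_atMost)
  also have "\<dots> \<le> (\<Prod>i\<le>n. norm (s + of_nat i))"
  proof (intro prod_mono conjI)
    fix i assume i: "i \<in> {..n}"
    have "real (n - i) + 1 / 2 = \<bar>Re (s + of_nat i)\<bar>" using i by (simp add: s_def of_nat_diff)
    also have "\<dots> \<le> norm (s + of_nat i)" by (rule abs_Re_le_cmod)
    finally show "real (n - i) + 1 / 2 \<le> norm (s + of_nat i)" .
  qed auto
  also have "\<dots> = norm (pochhammer s (Suc n))"
    by (simp add: pochhammer_prod prod_norm atLeast0LessThan lessThan_Suc_atMost)
  finally have "norm (Gamma s) * (fact n / 2) \<le> norm (Gamma s) * norm (pochhammer s (Suc n))"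
    by (intro mult_left_mono) auto
  thus ?thesis by (simp add: eq norm_mult s_def field_simps)
qed

text \<open>Moving the line far to the left collects the partial sums of the exponential series as residues at the poles of
\<open>\<Gamma>\<close>. On the abscissa \<open>- n - 1/2\<close> the integrand is of order \<open>1 / n!\<close>, so the integral there tends to 0.\<close>

theorem Cahen_Mellin:
  assumes Y: "\<bar>Im Y\<bar> < pi / 2" and c: "c > 0"
  shows "line_integral c (Mellin_Gamma Y) = 2 * pi * \<i> * exp (- exp Y)"
proof -
  define K where "K = (LINT t|lborel. 2 * norm (Mellin_Gamma Y (Complex (1/2) t)) * exp (Re Y))"
  have int: "integrable lborel (\<lambda>t. Mellin_Gamma Y (Complex x t))" if x: "x > 0 \<or> (\<exists>n. x = - real n - 1/2)" for x
  proof (rule integrable_on_line[OF _ strip_bound_Mellin_Gamma[OF Y]])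
    have "Mellin_Gamma Y holomorphic_on (- \<int>\<^sub>\<le>\<^sub>0)"
      unfolding Mellin_Gamma_def by (intro holomorphic_intros) auto
    thus "continuous_on UNIV (\<lambda>t. Mellin_Gamma Y (Complex x t))"
    proof (rule continuous_on_line_holomorphic)
      fix t
      show "Complex x t \<in> - \<int>\<^sub>\<le>\<^sub>0"
      proof
        assume "Complex x t \<in> \<int>\<^sub>\<le>\<^sub>0"
        then obtain m where "Complex x t = - of_nat m" by (auto elim!: nonpos_Ints_cases')
        hence m: "x = - real m" by (simp add: complex_eq_iff)
        with x obtain n where "x = - real n - 1/2" by auto
        hence "real n + 1 / 2 = real m" using m by simp
        hence "2 * n + 1 = 2 * m" by linarith
        thus False by presburger
      qed
    qed
  qed (use Y in auto)
  have bound: "norm (line_integral (- real n - 1/2) (Mellin_Gamma Y)) \<le> K * (exp (Re Y) ^ n / fact n)" for n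
  proof -
    have "norm (line_integral (- real n - 1/2) (Mellin_Gamma Y)) \<le> 
        (LINT t|lborel. norm (Mellin_Gamma Y (Complex (- real n - 1/2) t) * \<i>))"
      unfolding line_integral_def by (rule integral_norm_bound)
    also have "\<dots> \<le> (LINT t|lborel. 2 * norm (Mellin_Gamma Y (Complex (1/2) t)) * exp (Re Y) * (exp (Re Y) ^ n / fact n))"
    proof (intro integral_mono)
      show "integrable lborel (\<lambda>t. norm (Mellin_Gamma Y (Complex (- real n - 1/2) t) * \<i>))"
        using int[of "- real n - 1/2"] by (intro integrable_norm integrable_mult_left) auto
      show "integrable lborel (\<lambda>t. 2 * norm (Mellin_Gamma Y (Complex (1/2) t)) * exp (Re Y) * (exp (Re Y) ^ n / fact n))"
        using int[of "1/2"] by (intro integrable_mult_left integrable_mult_right integrable_norm) auto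
      fix t
      have "norm (Mellin_Gamma Y (Complex (- real n - 1/2) t) * \<i>) = 
         norm (Gamma (Complex (- real n - 1/2) t)) * exp (Re Y * (n + 1/2) + Im Y * t)"
        by (simp add: Mellin_Gamma_def norm_mult algebra_simps)
      also have "\<dots> \<le> (2 * norm (Gamma (Complex (1/2) t)) / fact n) * exp (Re Y * (n + 1/2) + Im Y * t)"
        by (intro mult_right_mono norm_Gamma_neg_half_le) auto
      also have "exp (Re Y * (n + 1/2) + Im Y * t) = exp (- Re Y / 2 + Im Y * t) * exp (Re Y) * exp (Re Y) ^ n" 
      proof -
        have "exp (Re Y) ^ n = exp (real n * Re Y)" by (simp add: exp_of_nat_mult)
        moreover have "Re Y * (n + 1/2) + Im Y * t = (- Re Y / 2 + Im Y * t) + Re Y + real n * Re Y"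
          by (simp add: field_simps)
        ultimately show ?thesis by (simp only: exp_add)
      qed
      also have "(2 * norm (Gamma (Complex (1/2) t)) / fact n) * \<dots> = 
         2 * norm (Mellin_Gamma Y (Complex (1/2) t)) * exp (Re Y) * (exp (Re Y) ^ n / fact n)"
        by (simp add: Mellin_Gamma_def norm_mult)
      finally show "norm (Mellin_Gamma Y (Complex (- real n - 1/2) t) * \<i>) \<le> 
         2 * norm (Mellin_Gamma Y (Complex (1/2) t)) * exp (Re Y) * (exp (Re Y) ^ n / fact n)" .
    qed
    also have "\<dots> = K * (exp (Re Y) ^ n / fact n)" by (simp add: K_def)
    finally show ?thesis .
  qed
  have "(\<lambda>n. exp (Re Y) ^ n / fact n) \<longlonglongrightarrow> 0"
    using summable_LIMSEQ_zero[OF summable_exp[of "exp (Re Y)"]] by (simp add: divide_inverse mult.commute)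
  from tendsto_mult_left[OF this, of K]
  have "(\<lambda>n. K * (exp (Re Y) ^ n / fact n)) \<longlonglongrightarrow> K * 0" .
  hence "(\<lambda>n. K * (exp (Re Y) ^ n / fact n)) \<longlonglongrightarrow> 0" by simp
  hence "(\<lambda>n. line_integral (- real n - 1/2) (Mellin_Gamma Y)) \<longlonglongrightarrow> 0"
    by (rule Lim_null_comparison[OF always_eventually[OF allI[OF bound]]])
  moreover have "line_integral (- real n - 1/2) (Mellin_Gamma Y) = 
      line_integral c (Mellin_Gamma Y) - 2 * pi * \<i> * (\<Sum>i<Suc n. (- exp Y) ^ i / fact i)" for n
    using Mellin_Gamma_shift[OF Y, of "Suc n" "- real n - 1/2" c] c by (simp add: algebra_simps)
  ultimately have "(\<lambda>n. line_integral c (Mellin_Gamma Y) - 2 * pi * \<i> * (\<Sum>i<Suc n. (- exp Y) ^ i / fact i)) \<longlonglongrightarrow> 0"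
    by simp
  moreover have "(\<lambda>n. line_integral c (Mellin_Gamma Y) - 2 * pi * \<i> * (\<Sum>i<Suc n. (- exp Y) ^ i / fact i)) \<longlonglongrightarrow>
      line_integral c (Mellin_Gamma Y) - 2 * pi * \<i> * exp (- exp Y)"
  proof (intro tendsto_intros)
    have "(\<lambda>i. (- exp Y) ^ i / fact i) sums exp (- exp Y)"
      using exp_converges[of "- exp Y"] by (simp add: scaleR_conv_of_real divide_inverse mult.commute)
    thus "(\<lambda>n. \<Sum>i<Suc n. (- exp Y) ^ i / fact i) \<longlonglongrightarrow> exp (- exp Y)"
      unfolding sums_def by (rule LIMSEQ_Suc)
  qed
  ultimately have "line_integral c (Mellin_Gamma Y) - 2 * pi * \<i> * exp (- exp Y) = 0"
    by (rule LIMSEQ_unique[rotated])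
  thus ?thesis by simp
qed

text \<open>Left of some poles the integral misses their residues, an initial segment of the exponential series.\<close>

corollary Cahen_Mellin_left:
  assumes Y: "\<bar>Im Y\<bar> < pi / 2" and c: "- real k < c" "c < 1 - real k"
  shows "line_integral c (Mellin_Gamma Y) = 
           2 * pi * \<i> * (exp (- exp Y) - (\<Sum>i<k. (- exp Y) ^ i / fact i))"
  using Mellin_Gamma_shift[OF Y c, of 1] Cahen_Mellin[OF Y, of 1] by (simp add: algebra_simps)

section \<open>The zeta function to the left of its pole\<close>

text \<open>The error of the trapezoidal rule for the integral of \<open>x^(-s)\<close> from \<open>n + 1\<close> to \<open>n + 2\<close>. It is of second order,
which is why the sum over \<open>n\<close> converges as far as \<open>Re s > -1\<close>.\<close>

definition trapezoid_error :: "nat \<Rightarrow> complex \<Rightarrow> complex" where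
  "trapezoid_error n s = (of_nat (Suc n) powr (-s) + of_nat (Suc (Suc n)) powr (-s)) / 2 -
     (of_nat (Suc (Suc n)) powr (1 - s) - of_nat (Suc n) powr (1 - s)) / (1 - s)"

lemma norm_trapezoid_error_le:
  assumes s: "s \<noteq> 1" "Re s \<ge> -2"
  shows "norm (trapezoid_error n s) \<le> norm s * norm (s + 1) * real (Suc n) powr (- Re s - 2)"
proof -
  define a :: complex where "a = of_nat (Suc n)"
  define S :: "complex set" where "S = closed_segment 0 1"
  define f where "f = (\<lambda>i h. if i = 0 then h / 2 * (a powr (-s) + (a + h) powr (-s)) - ((a + h) powr (1 - s) - a powr (1 - s)) / (1 - s)
     else if i = Suc 0 then (a powr (-s) - (a + h) powr (-s)) / 2 + h / 2 * (-s * (a + h) powr (-s - 1))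
     else h / 2 * (s * (s + 1) * (a + h) powr (-s - 2)))"
  define B where "B = norm s * norm (s + 1) * real (Suc n) powr (- Re s - 2)"
  have S: "h = of_real (Re h) \<and> 0 \<le> Re h \<and> Re h \<le> 1" if "h \<in> S" for h
    using that by (auto simp: S_def closed_segment_def complex_eq_iff scaleR_conv_of_real)
  have pos: "a + h = of_real (real (Suc n) + Re h)" "real (Suc n) + Re h \<ge> real (Suc n)" "a + h \<notin> \<real>\<^sub>\<le>\<^sub>0" if "h \<in> S" for h
  proof -
    show 1: "a + h = of_real (real (Suc n) + Re h)" using S[OF that] by (simp add: a_def complex_eq_iff)
    show 2: "real (Suc n) + Re h \<ge> real (Suc n)" using S[OF that] by simp
    have "complex_of_real (real (Suc n) + Re h) \<notin> \<real>\<^sub>\<le>\<^sub>0" using 2 by (subst nonpos_Reals_of_real_iff) auto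
    thus "a + h \<notin> \<real>\<^sub>\<le>\<^sub>0" by (subst 1)
  qed
  have "norm (f 0 1 - (\<Sum>i\<le>1. f i 0 * (1 - 0) ^ i / fact i)) \<le> B * norm (1 - 0 :: complex) ^ Suc 1 / fact 1"
  proof (rule field_Taylor[where S = S])
    show "convex S" by (simp add: S_def)
    show "1 \<in> S" "0 \<in> S" by (auto simp: S_def)
    show "norm (f (Suc 1) h) \<le> B" if h: "h \<in> S" for h
    proof -
      have "norm ((a + h) powr (-s - 2)) = (real (Suc n) + Re h) powr (- Re s - 2)"
      proof -
        define r where "r = real (Suc n) + Re h"
        have "a + h = of_real r" "r > 0" using pos(1,2)[OF h] by (simp_all add: r_def)
        hence "norm ((a + h) powr (-s - 2)) = r powr (- Re s - 2)" by (simp add: norm_powr_real_powr)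
        thus ?thesis by (simp only: r_def)
      qed
      also have "\<dots> \<le> real (Suc n) powr (- Re s - 2)"
        using s S[OF h] by (intro powr_mono2') auto
      finally have 1: "norm ((a + h) powr (-s - 2)) \<le> real (Suc n) powr (- Re s - 2)" .
      have 2: "norm h \<le> 1" using S[OF h] by (metis abs_of_nonneg norm_of_real)
      have "norm (f (Suc 1) h) = norm h / 2 * (norm s * norm (s + 1) * norm ((a + h) powr (-s - 2)))"
        by (simp add: f_def norm_mult)
      also have "\<dots> \<le> 1 * B" unfolding B_def
        using 1 2 by (intro mult_mono) auto
      finally show ?thesis by simp
    qed
    show "(f i has_field_derivative f (Suc i) h) (at h within S)" if h: "h \<in> S" and i: "i \<le> 1" for i h
    proof -
      have P: "((\<lambda>h. (a + h) powr e) has_field_derivative e * (a + h) powr (e - 1)) (at h within S)" for e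
        using pos(3)[OF h] by (auto intro!: derivative_eq_intros)
      have D1: "((\<lambda>h. h / 2 * (A + u h) - (v h - B) / c) has_field_derivative ((A + u h) / 2 + h / 2 * u' - v' / c)) (at h within S)"
        if "(u has_field_derivative u') (at h within S)" "(v has_field_derivative v') (at h within S)" "c \<noteq> 0" for u v :: "complex \<Rightarrow> complex" and u' v' A B c
        using that by (auto intro!: derivative_eq_intros)
      have D2: "((\<lambda>h. (A - u h) / 2 + h / 2 * (c * v h)) has_field_derivative (c * v h / 2 - u' / 2 + h / 2 * (c * v'))) (at h within S)"
        if "(u has_field_derivative u') (at h within S)" "(v has_field_derivative v') (at h within S)" for u v :: "complex \<Rightarrow> complex" and u' v' A c
        using that by (auto intro!: derivative_eq_intros)
      consider "i = 0" | "i = 1" using i by linarith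
      thus ?thesis
      proof cases
        case 1
        have "((\<lambda>h. h / 2 * (a powr (-s) + (a + h) powr (-s)) - ((a + h) powr (1 - s) - a powr (1 - s)) / (1 - s)) has_field_derivative
          ((a powr (-s) + (a + h) powr (-s)) / 2 + h / 2 * (-s * (a + h) powr (-s - 1)) - (1 - s) * (a + h) powr (1 - s - 1) / (1 - s))) (at h within S)"
          by (rule D1[OF P P]) (use s in auto)
        also have "(1 - s) * (a + h) powr (1 - s - 1) / (1 - s) = (a + h) powr (-s)" using s by simp
        also have "(a powr (-s) + (a + h) powr (-s)) / 2 + h / 2 * (-s * (a + h) powr (-s - 1)) - (a + h) powr (-s) =
            (a powr (-s) - (a + h) powr (-s)) / 2 + h / 2 * (-s * (a + h) powr (-s - 1))"
          by (simp add: add_divide_distrib diff_divide_distrib)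
        finally show ?thesis using 1 by (simp add: f_def[abs_def])
      next
        case 2
        have "((\<lambda>h. (a powr (-s) - (a + h) powr (-s)) / 2 + h / 2 * (-s * (a + h) powr (-s - 1))) has_field_derivative
          (-s * (a + h) powr (-s - 1) / 2 - (-s * (a + h) powr (-s - 1)) / 2 + h / 2 * (-s * ((-s - 1) * (a + h) powr (-s - 1 - 1))))) (at h within S)"
          by (rule D2[OF P P])
        also have "-s * (a + h) powr (-s - 1) / 2 - (-s * (a + h) powr (-s - 1)) / 2 + h / 2 * (-s * ((-s - 1) * (a + h) powr (-s - 1 - 1))) =
            h / 2 * (s * (s + 1) * (a + h) powr (-s - 2))"
          by (simp add: algebra_simps)
        finally show ?thesis using 2 by (simp add: f_def[abs_def])
      qed
    qed
  qed
  also have "f 0 1 - (\<Sum>i\<le>1. f i 0 * (1 - 0) ^ i / fact i) = trapezoid_error n s"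
    by (simp add: f_def trapezoid_error_def a_def add_ac)
  finally show ?thesis by (simp add: B_def)
qed

text \<open>Summing the trapezoidal rule over all unit intervals expresses the Dirichlet series by the trapezoid errors; the
resulting expression makes sense to the left of the line \<open>Re s = 1\<close>.\<close>

definition zeta_cont :: "complex \<Rightarrow> complex" where
  "zeta_cont s = 1 / (s - 1) + 1 / 2 + (\<Sum>n. trapezoid_error n s)"

lemma sum_trapezoid_error:
  assumes "s \<noteq> 1"
  shows "(\<Sum>n<N. trapezoid_error n s) = (\<Sum>n<N. of_nat (Suc n) powr (-s)) + (of_nat (Suc N) powr (-s) - 1) / 2
           - (of_nat (Suc N) powr (1 - s) - 1) / (1 - s)"
proof (induction N)
  case (Suc N)
  thus ?case using assms by (simp add: trapezoid_error_def diff_divide_distrib add_divide_distrib)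
qed auto

lemma summable_powr_neg: "r > 1 \<Longrightarrow> summable (\<lambda>n. real (Suc n) powr (- r))"
  using summable_real_powr_iff[of "-r"] summable_Suc_iff[of "\<lambda>n. real n powr (-r)"] by simp

lemma summable_trapezoid_error:
  assumes s: "s \<noteq> 1" "Re s > -1"
  shows "summable (\<lambda>n. trapezoid_error n s)"
proof (rule summable_comparison_test'[where N = 0 and g = "\<lambda>n. norm s * norm (s + 1) * real (Suc n) powr (- Re s - 2)"])
  show "summable (\<lambda>n. norm s * norm (s + 1) * real (Suc n) powr (- Re s - 2))"
    using summable_powr_neg[of "Re s + 2"] assms by (intro summable_mult) simp
  show "norm (trapezoid_error n s) \<le> norm s * norm (s + 1) * real (Suc n) powr (- Re s - 2)" for n
    using norm_trapezoid_error_le[of s n] assms by simp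
qed

lemma tendsto_Suc_powr_0:
  assumes "Re s < 0"
  shows "(\<lambda>N. of_nat (Suc N) powr s :: complex) \<longlonglongrightarrow> 0"
proof (rule tendsto_norm_zero_cancel)
  have "(\<lambda>N. real (Suc N) powr Re s) \<longlonglongrightarrow> 0" using assms by real_asymp
  moreover have "norm (of_nat (Suc N) powr s :: complex) = real (Suc N) powr Re s" for N
    using norm_powr_real_powr[of "of_nat (Suc N)" s] by simp
  ultimately show "(\<lambda>N. norm (of_nat (Suc N) powr s :: complex)) \<longlonglongrightarrow> 0" by simp
qed

lemma zeta_cont_lim:
  assumes s: "s \<noteq> 1" "Re s > -1"
  shows "(\<lambda>N. (\<Sum>n<N. of_nat (Suc n) powr (-s)) + of_nat (Suc N) powr (-s) / 2
           - of_nat (Suc N) powr (1 - s) / (1 - s)) \<longlonglongrightarrow> zeta_cont s"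
proof -
  have "(\<lambda>N. 1 / (s - 1) + 1 / 2 + (\<Sum>n<N. trapezoid_error n s)) \<longlonglongrightarrow> zeta_cont s"
    unfolding zeta_cont_def using summable_LIMSEQ[OF summable_trapezoid_error[OF s]] by (intro tendsto_intros)
  moreover have "1 / (s - 1) + 1 / 2 + (\<Sum>n<N. trapezoid_error n s) = (\<Sum>n<N. of_nat (Suc n) powr (-s)) + of_nat (Suc N) powr (-s) / 2
           - of_nat (Suc N) powr (1 - s) / (1 - s)" for N
  proof -
    have "1 / (s - 1) = - (1 / (1 - s))" by (metis minus_diff_eq minus_divide_right)
    thus ?thesis unfolding sum_trapezoid_error[OF s(1)] by (simp add: diff_divide_distrib)
  qed
  ultimately show ?thesis by simp
qed

lemma zeta_cont_sums:
  assumes "Re s > 1"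
  shows "(\<lambda>n. 1 / of_nat (Suc n) powr s) sums zeta_cont s"
proof -
  have s1: "s \<noteq> 1" using assms by auto
  have "(\<lambda>N. ((\<Sum>n<N. of_nat (Suc n) powr (-s)) + of_nat (Suc N) powr (-s) / 2 - of_nat (Suc N) powr (1 - s) / (1 - s))
        - of_nat (Suc N) powr (-s) / 2 + of_nat (Suc N) powr (1 - s) / (1 - s)) \<longlonglongrightarrow> zeta_cont s - 0 / 2 + 0 / (1 - s)"
    using assms s1 by (intro tendsto_intros zeta_cont_lim tendsto_Suc_powr_0) auto
  thus ?thesis unfolding sums_def by (simp add: powr_minus inverse_eq_divide)
qed

lemma zeta_cont_holomorphic: "zeta_cont holomorphic_on {s. Re s > -1} - {1}"
proof -
  define S where "S = {s. Re s > -1} - {1::complex}"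
  have "(\<lambda>s. \<Sum>n. trapezoid_error n s) holomorphic_on S"
  proof (rule holomorphic_uniform_sequence)
    show openS: "open S" unfolding S_def by (intro open_Diff open_halfspace_Re_gt) auto
    show "(\<lambda>s. \<Sum>n<N. trapezoid_error n s) holomorphic_on S" for N
      unfolding trapezoid_error_def S_def by (intro holomorphic_intros) auto
    fix x assume x: "x \<in> S"
    obtain d0 where d0: "d0 > 0" "cball x d0 \<subseteq> S" using openS x by (meson open_contains_cball)
    define d where "d = min d0 ((Re x + 1) / 2)"
    have d: "d > 0" "cball x d \<subseteq> S" using d0 x by (auto simp: d_def S_def)
    have d3: "d \<le> (Re x + 1) / 2" unfolding d_def by (rule min.cobounded2)
    have "uniform_limit (cball x d) (\<lambda>N s. \<Sum>n<N. trapezoid_error n s) (\<lambda>s. \<Sum>n. trapezoid_error n s) sequentially"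
    proof (rule Weierstrass_m_test)
      show "summable (\<lambda>n. (norm x + d) * (norm x + d + 1) * real (Suc n) powr (- ((Re x + 1) / 2 + 1)))"
        using x by (intro summable_mult summable_powr_neg) (auto simp: S_def)
      fix n s assume s: "s \<in> cball x d"
      have "norm (s - x) \<le> d" using s by (simp add: dist_norm norm_minus_commute)
      hence ns: "norm s \<le> norm x + d" using norm_triangle_ineq[of x "s - x"] by simp
      have ns1: "norm (s + 1) \<le> norm x + d + 1" using ns norm_triangle_ineq[of s 1] by simp
      have "Re x - Re s \<le> d" using \<open>norm (s - x) \<le> d\<close> abs_Re_le_cmod[of "s - x"] by simp
      hence Re: "Re s \<ge> (Re x + 1) / 2 - 1" using d3 by (simp add: field_simps)
      have sS: "s \<noteq> 1" "Re s > -1" using s d by (auto simp: S_def)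
      have "norm (trapezoid_error n s) \<le> norm s * norm (s + 1) * real (Suc n) powr (- Re s - 2)"
        using sS by (intro norm_trapezoid_error_le) auto
      also have "\<dots> \<le> (norm x + d) * (norm x + d + 1) * real (Suc n) powr (- ((Re x + 1) / 2 + 1))"
        using ns ns1 Re d(1) by (intro mult_mono powr_mono) (auto simp: field_simps)
      finally show "norm (trapezoid_error n s) \<le> (norm x + d) * (norm x + d + 1) * real (Suc n) powr (- ((Re x + 1) / 2 + 1))" .
    qed
    thus "\<exists>d>0. cball x d \<subseteq> S \<and> uniform_limit (cball x d) (\<lambda>N s. \<Sum>n<N. trapezoid_error n s) (\<lambda>s. \<Sum>n. trapezoid_error n s) sequentially"
      using d by blast
  qed
  hence "zeta_cont holomorphic_on S"
    unfolding zeta_cont_def[abs_def] by (intro holomorphic_intros) (auto simp: S_def)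
  thus ?thesis by (simp add: S_def)
qed

lemma zeta_cont_near_le:
  assumes "s \<noteq> 1" "Re s \<ge> -1/2"
  shows "norm (zeta_cont s - 1 / (s - 1)) \<le> 1 / 2 + norm s * norm (s + 1) * (\<Sum>n. real (Suc n) powr (-3/2))"
proof -
  have sm: "summable (\<lambda>n. norm s * norm (s + 1) * real (Suc n) powr (-3/2))"
    using summable_powr_neg[of "3/2"] by (intro summable_mult) simp
  have "norm (\<Sum>n. trapezoid_error n s) \<le> (\<Sum>n. norm s * norm (s + 1) * real (Suc n) powr (-3/2))"
  proof (rule norm_suminf_le[OF _ sm])
    fix n
    have "norm (trapezoid_error n s) \<le> norm s * norm (s + 1) * real (Suc n) powr (- Re s - 2)"
      using assms by (intro norm_trapezoid_error_le) auto
    also have "\<dots> \<le> norm s * norm (s + 1) * real (Suc n) powr (-3/2)"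
      using assms by (intro mult_left_mono powr_mono) (auto simp: field_simps)
    finally show "norm (trapezoid_error n s) \<le> norm s * norm (s + 1) * real (Suc n) powr (-3/2)" .
  qed
  also have "\<dots> = norm s * norm (s + 1) * (\<Sum>n. real (Suc n) powr (-3/2))"
    using summable_powr_neg[of "3/2"] by (intro suminf_mult) simp
  finally have "norm (1 / 2 + (\<Sum>n. trapezoid_error n s)) \<le> 1 / 2 + norm s * norm (s + 1) * (\<Sum>n. real (Suc n) powr (-3/2))"
    using norm_triangle_ineq[of "1/2 :: complex" "\<Sum>n. trapezoid_error n s"] by simp
  thus ?thesis by (simp add: zeta_cont_def)
qed

lemma zeta_cont_residue_lim: "((\<lambda>s. (s - 1) * zeta_cont s) \<longlongrightarrow> 1) (at 1)"
proof -
  define K where "K = (\<Sum>n. real (Suc n) powr (-3/2))"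
  have "eventually (\<lambda>s. norm ((s - 1) * zeta_cont s - 1) \<le> norm (s - 1) * (1 / 2 + norm s * norm (s + 1) * K)) (at (1::complex))"
  proof -
    have "eventually (\<lambda>s. s \<in> ball 1 1 - {1}) (at (1::complex))"
      by (rule eventually_at_in_open) auto
    thus ?thesis
    proof eventually_elim
      case (elim s)
      have "\<bar>Re (1 - s)\<bar> < 1" using elim abs_Re_le_cmod[of "1 - s"] by (simp add: dist_norm)
      hence "Re s \<ge> -1/2" by simp
      have "(s - 1) * zeta_cont s - 1 = (s - 1) * (zeta_cont s - 1 / (s - 1))"
        using elim by (simp add: field_simps)
      hence "norm ((s - 1) * zeta_cont s - 1) = norm (s - 1) * norm (zeta_cont s - 1 / (s - 1))"
        by (simp add: norm_mult)
      also have "\<dots> \<le> norm (s - 1) * (1 / 2 + norm s * norm (s + 1) * K)"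
        unfolding K_def using elim \<open>Re s \<ge> -1/2\<close> by (intro mult_left_mono zeta_cont_near_le) auto
      finally show ?case .
    qed
  qed
  moreover have "((\<lambda>s::complex. norm (s - 1) * (1 / 2 + norm s * norm (s + 1) * K)) \<longlongrightarrow> 0) (at 1)"
  proof -
  have "((\<lambda>s::complex. norm (s - 1) * (1 / 2 + norm s * norm (s + 1) * K)) \<longlongrightarrow> norm (1 - 1 :: complex) * (1 / 2 + norm (1::complex) * norm (1 + 1 :: complex) * K)) (at 1)"
    by (intro tendsto_intros)
  thus ?thesis by simp
  qed
  ultimately have "((\<lambda>s. (s - 1) * zeta_cont s - 1) \<longlongrightarrow> 0) (at 1)"
    by (rule Lim_null_comparison)
  thus ?thesis by (subst (asm) LIM_zero_iff)
qed

lemma strip_bound_zeta_cont: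
  assumes "\<epsilon> > 0"
  shows "strip_bound (-1/2) b \<epsilon> zeta_cont"
proof (rule strip_bound_power_growth[OF _ assms])
  define K where "K = (\<Sum>n. real (Suc n) powr (-3/2))"
  have K: "K \<ge> 0" unfolding K_def using summable_powr_neg[of "3/2"] by (intro suminf_nonneg) auto
  fix x y :: real assume xy: "-1/2 \<le> x" "x \<le> b" "1 \<le> \<bar>y\<bar>"
  define s where "s = Complex x y"
  have s1: "s \<noteq> 1" using xy by (auto simp: s_def complex_eq_iff)
  have n1: "norm s \<le> (2 + \<bar>b\<bar>) * (1 + \<bar>y\<bar>)"
  proof -
    have "norm s \<le> \<bar>x\<bar> + \<bar>y\<bar>" using cmod_le[of s] by (simp add: s_def)
    also have "\<dots> \<le> (1 + \<bar>b\<bar>) + \<bar>y\<bar>" using xy by auto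
    also have "\<dots> \<le> (2 + \<bar>b\<bar>) * (1 + \<bar>y\<bar>)" by (simp add: algebra_simps)
    finally show ?thesis .
  qed
  have n2: "norm (s + 1) \<le> (2 + \<bar>b\<bar>) * (1 + \<bar>y\<bar>)"
  proof -
    have "norm (s + 1) \<le> \<bar>x + 1\<bar> + \<bar>y\<bar>" using cmod_le[of "s + 1"] by (simp add: s_def)
    also have "\<dots> \<le> (2 + \<bar>b\<bar>) + \<bar>y\<bar>" using xy by auto
    also have "\<dots> \<le> (2 + \<bar>b\<bar>) * (1 + \<bar>y\<bar>)" by (simp add: algebra_simps)
    finally show ?thesis .
  qed
  have "\<bar>Im (s - 1)\<bar> \<le> norm (s - 1)" by (rule abs_Im_le_cmod)
  hence "1 \<le> norm (s - 1)" using xy by (simp add: s_def)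
  hence "norm (1 / (s - 1)) \<le> 1" by (simp add: norm_divide divide_le_eq_1)
  hence "norm (zeta_cont s) \<le> 1 + (1 / 2 + norm s * norm (s + 1) * K)"
    using zeta_cont_near_le[OF s1] xy norm_triangle_ineq2[of "zeta_cont s" "1 / (s - 1)"]
    by (simp add: K_def s_def)
  also have "\<dots> \<le> 2 * (1 + \<bar>y\<bar>)\<^sup>2 + ((2 + \<bar>b\<bar>) * (1 + \<bar>y\<bar>)) * ((2 + \<bar>b\<bar>) * (1 + \<bar>y\<bar>)) * K"
  proof -
    have "1 \<le> (1 + \<bar>y\<bar>)\<^sup>2" by (intro one_le_power) auto
    moreover have "norm s * norm (s + 1) * K \<le> ((2 + \<bar>b\<bar>) * (1 + \<bar>y\<bar>)) * ((2 + \<bar>b\<bar>) * (1 + \<bar>y\<bar>)) * K"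
      using n1 n2 K by (intro mult_right_mono mult_mono) auto
    ultimately show ?thesis by linarith
  qed
  also have "\<dots> = (2 + (2 + \<bar>b\<bar>)\<^sup>2 * K) * (1 + \<bar>y\<bar>) ^ 2" by (simp add: power2_eq_square algebra_simps)
  finally show "norm (zeta_cont (Complex x y)) \<le> (2 + (2 + \<bar>b\<bar>)\<^sup>2 * (\<Sum>n. real (Suc n) powr (-3/2))) * (1 + \<bar>y\<bar>) ^ 2"
    by (simp add: s_def K_def)
qed

section \<open>The Abel-Plana formula\<close>

lemma set_integrable_half_line_bound:
  assumes "continuous_on {0..} k" "\<And>y. y \<ge> T \<Longrightarrow> norm (k y) \<le> C * exp (- \<eta> * y)" "\<eta> > 0"
  shows "set_integrable lborel {0<..} (k :: real \<Rightarrow> complex)"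
proof -
  define f where "f = (\<lambda>s. k \<bar>Im s\<bar>)"
  have "integrable lborel (\<lambda>t. f (Complex 0 t))"
  proof (rule integrable_on_line)
    show "continuous_on UNIV (\<lambda>t. f (Complex 0 t))"
      unfolding f_def by (auto intro!: continuous_on_compose2[OF assms(1)] continuous_intros)
    show "strip_bound 0 0 (- \<eta>) f"
      by (rule strip_boundI[where T = T and C = C]) (use assms(2) in \<open>auto simp: f_def\<close>)
  qed (use assms in auto)
  hence "integrable lborel (\<lambda>t. indicator {0<..} t *\<^sub>R f (Complex 0 t))"
    by (intro integrable_mult_indicator) auto
  also have "(\<lambda>t. indicator {0<..} t *\<^sub>R f (Complex 0 t)) = (\<lambda>t. indicator {0<..} t *\<^sub>R k t)"
    by (auto simp: f_def indicator_def fun_eq_iff)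
  finally show ?thesis by (simp add: set_integrable_def)
qed

lemma integral_half_line_tendsto:
  fixes g :: "real \<Rightarrow> complex"
  assumes "set_integrable lborel {0<..} g"
  shows "((\<lambda>T. integral {0..T} g) \<longlongrightarrow> (LBINT t:{0<..}. g t)) at_top"
proof -
  define h where "h = (\<lambda>t. indicator {0<..} t *\<^sub>R g t)"
  have "integrable lborel h" using assms by (simp add: h_def set_integrable_def)
  hence "((\<lambda>T. integral {-T..T} h) \<longlongrightarrow> (LINT t|lborel. h t)) at_top"
    by (rule integral_symmetric_interval_tendsto)
  moreover have "eventually (\<lambda>T. integral {-T..T} h = integral {0..T} g) at_top"
    using eventually_ge_at_top[of 0]
  proof eventually_elim
    case (elim T)
    have "integral {-T..T} h = integral {-T..T} (\<lambda>t. if t \<in> {0<..T} then g t else 0)"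
      by (intro integral_cong) (auto simp: h_def)
    also have "\<dots> = integral ({0<..T} \<inter> {-T..T}) g"
      by (subst integral_restrict_Int) auto
    also have "{0<..T} \<inter> {-T..T} = {0<..T}" using elim by auto
    also have "integral {0<..T} g = integral {0..T} g"
      by (rule integral_spike_set; rule negligible_subset[of "{0}"]) auto
    finally show ?case .
  qed
  ultimately show ?thesis
    by (simp add: tendsto_cong h_def set_lebesgue_integral_def)
qed

text \<open>This kernel has simple poles exactly at the integers, decays in the upper half plane like \<open>exp (- 2 \<pi> Im z)\<close>, and
on the vertical line through an integer becomes the real weight \<open>1 / (exp (2 \<pi> y) - 1)\<close>.\<close>

definition Plana_kernel :: "complex \<Rightarrow> complex" where
  "Plana_kernel z = 1 / (exp (- (2 * pi * \<i>) * z) - 1)"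

lemma exp_2pi_of_int: "exp (2 * of_int j * of_real pi * \<i>) = 1"
  by (auto simp: exp_eq_1 intro!: exI[of _ j])

lemma Plana_kernel_zero_iff: "exp (- (2 * pi * \<i>) * z) - 1 = 0 \<longleftrightarrow> z \<in> \<int>"
proof
  assume "exp (- (2 * pi * \<i>) * z) - 1 = 0"
  hence "exp (- (2 * pi * \<i>) * z) = 1" by simp
  then obtain n :: int where n: "Re (- (2 * pi * \<i>) * z) = 0" "Im (- (2 * pi * \<i>) * z) = of_int (2 * n) * pi"
    unfolding exp_eq_1 by blast
  have "pi * Re z = pi * of_int (- n)" using n(2) by simp
  hence "Re z = of_int (- n)" by (metis mult_cancel_left pi_neq_zero)
  hence "z = of_int (- n)" using n(1) by (simp add: complex_eq_iff)
  thus "z \<in> \<int>" by (metis Ints_of_int)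
next
  assume "z \<in> \<int>"
  then obtain n :: int where n: "z = of_int n" by (auto elim: Ints_cases)
  have "exp (- (2 * pi * \<i>) * z) = exp (2 * of_int (- n) * of_real pi * \<i>)"
    by (simp add: n mult_ac)
  thus "exp (- (2 * pi * \<i>) * z) - 1 = 0" by (simp only: exp_2pi_of_int) simp
qed

lemma Plana_kernel_removable:
  assumes k: "k \<in> \<int>" and g: "isCont g k" "g k = 0"
  shows "((\<lambda>z. (z - k) * (g z * Plana_kernel z)) \<longlongrightarrow> 0) (at k)"
proof -
  have e1: "exp (- (2 * pi * \<i>) * k) = 1" using Plana_kernel_zero_iff[of k] k by simp
  have "((\<lambda>z. exp (- (2 * pi * \<i>) * z)) has_field_derivative (exp (- (2 * pi * \<i>) * k) * (- (2 * pi * \<i>)))) (at k)"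
    by (auto intro!: derivative_eq_intros)
  hence "((\<lambda>z. (exp (- (2 * pi * \<i>) * z) - exp (- (2 * pi * \<i>) * k)) / (z - k)) \<longlongrightarrow> exp (- (2 * pi * \<i>) * k) * (- (2 * pi * \<i>))) (at k)"
    by (simp add: has_field_derivative_iff)
  hence "((\<lambda>z. (exp (- (2 * pi * \<i>) * z) - 1) / (z - k)) \<longlongrightarrow> - (2 * pi * \<i>)) (at k)"
    by (simp only: e1 mult_1_left)
  moreover have "(g \<longlongrightarrow> 0) (at k)" using g by (simp add: isCont_def)
  ultimately have "((\<lambda>z. g z / ((exp (- (2 * pi * \<i>) * z) - 1) / (z - k))) \<longlongrightarrow> 0 / (- (2 * pi * \<i>))) (at k)"
    by (intro tendsto_divide) auto
  thus ?thesis by (simp add: Plana_kernel_def mult_ac)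
qed

lemma Plana_kernel_extend:
  fixes n :: nat
  assumes ab: "real n - 1 < a'" "a' < n" "real n + 1 < b'" "b' < n + 2"
    and hol: "g holomorphic_on {z. a' < Re z \<and> Re z < b'}" and g0: "g (of_nat n) = 0" "g (of_nat (Suc n)) = 0"
  shows "\<exists>G. G holomorphic_on {z. a' < Re z \<and> Re z < b'} \<and>
            (\<forall>z\<in>{z. a' < Re z \<and> Re z < b'} - {of_nat n, of_nat (Suc n)}. G z = g z * Plana_kernel z)"
proof -
  define U where "U = {z. a' < Re z \<and> Re z < b'}"
  define x y :: complex where "x = of_nat n" and "y = of_nat (Suc n)"
  have xy: "x \<in> U" "y \<in> U" "x \<noteq> y" "x \<in> \<int>" "y \<in> \<int>"
    using ab by (auto simp: U_def x_def y_def)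
  have U: "open U" unfolding U_def
    using open_halfspace_Re_gt[of a'] open_halfspace_Re_lt[of b'] by (auto simp: Collect_conj_eq)
  have ints: "z \<notin> \<int>" if "z \<in> U - {x, y}" for z
  proof
    assume "z \<in> \<int>"
    then obtain j :: int where j: "z = of_int j" by (auto elim: Ints_cases)
    hence "real_of_int j > real n - 1" "real_of_int j < n + 2" using that ab by (auto simp: U_def)
    hence "j = int n \<or> j = int (Suc n)" by linarith
    thus False using that j by (auto simp: x_def y_def)
  qed
  have cont: "isCont g z" if "z \<in> U" for z
    using hol that U holomorphic_on_imp_continuous_on[of g U] by (auto simp: U_def[symmetric] continuous_on_eq_continuous_at)
  have h0: "(\<lambda>z. g z * Plana_kernel z) holomorphic_on (U - {y}) - {x}"
    unfolding Plana_kernel_def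
    by (intro holomorphic_intros holomorphic_on_subset[OF hol])
       (use ints Plana_kernel_zero_iff in \<open>auto simp: U_def[symmetric]\<close>)
  have "\<exists>G. G holomorphic_on U - {y} \<and> (\<forall>z\<in>(U - {y}) - {x}. G z = g z * Plana_kernel z)"
    by (subst holomorphic_on_extend_lim[OF h0])
       (use U xy in \<open>auto intro!: Plana_kernel_removable cont interiorI[of "U - {y}"] simp: g0 x_def\<close>)
  then obtain G1 where G1: "G1 holomorphic_on U - {y}" "\<And>z. z \<in> U - {x, y} \<Longrightarrow> G1 z = g z * Plana_kernel z" by blast
  have lim: "((\<lambda>z. (z - y) * G1 z) \<longlongrightarrow> 0) (at y)"
  proof -
    have "eventually (\<lambda>z. z \<in> (U - {x}) - {y}) (at y)"
      using U xy by (intro eventually_at_in_open) auto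
    hence "eventually (\<lambda>z. (z - y) * (g z * Plana_kernel z) = (z - y) * G1 z) (at y)"
      by eventually_elim (simp add: G1)
    moreover have "((\<lambda>z. (z - y) * (g z * Plana_kernel z)) \<longlongrightarrow> 0) (at y)"
      using xy g0 by (intro Plana_kernel_removable cont) (auto simp: y_def)
    ultimately show ?thesis by (rule Lim_transform_eventually[rotated])
  qed
  have "\<exists>G. G holomorphic_on U \<and> (\<forall>z\<in>U - {y}. G z = G1 z)"
    by (subst holomorphic_on_extend_lim[OF G1(1)]) (use U xy lim in \<open>auto intro!: interiorI[of U]\<close>)
  then obtain G where "G holomorphic_on U" "\<And>z. z \<in> U - {y} \<Longrightarrow> G z = G1 z" by blast
  hence "G holomorphic_on U \<and> (\<forall>z\<in>U - {x, y}. G z = g z * Plana_kernel z)" using G1 by auto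
  thus ?thesis unfolding U_def x_def y_def by blast
qed

lemma Plana_kernel_nat_line:
  "Plana_kernel (Complex (real n) y) = of_real (1 / (exp (2 * pi * y) - 1))"
proof -
  have "- (2 * pi * \<i>) * Complex (real n) y = of_real (2 * pi * y) + 2 * of_int (- int n) * of_real pi * \<i>"
    by (simp add: complex_eq_iff)
  hence "exp (- (2 * pi * \<i>) * Complex (real n) y) = exp (of_real (2 * pi * y)) * exp (2 * of_int (- int n) * of_real pi * \<i>)"
    by (simp only: exp_add)
  also have "exp (2 * of_int (- int n) * of_real pi * \<i>) = 1" by (rule exp_2pi_of_int)
  finally have "exp (- (2 * pi * \<i>) * Complex (real n) y) = of_real (exp (2 * pi * y))" by (simp only: exp_of_real mult_1_right)
  thus ?thesis by (simp add: Plana_kernel_def)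
qed

lemma norm_Plana_kernel_le:
  assumes "Im z \<ge> 1"
  shows "norm (Plana_kernel z) \<le> 2 * exp (- (2 * pi) * Im z)"
proof -
  have n: "norm (exp (- (2 * pi * \<i>) * z)) = exp (2 * pi * Im z)" by simp
  have "1 * 1 \<le> pi * Im z" using assms pi_gt3 by (intro mult_mono) auto
  hence "2 \<le> 2 * pi * Im z" by simp
  moreover have "1 + 2 * pi * Im z \<le> exp (2 * pi * Im z)" by (rule exp_ge_add_one_self)
  ultimately have ge2: "exp (2 * pi * Im z) \<ge> 2" by linarith
  have "norm (exp (- (2 * pi * \<i>) * z) - 1) \<ge> exp (2 * pi * Im z) - 1"
    using norm_triangle_ineq2[of "exp (- (2 * pi * \<i>) * z)" 1] by (simp add: n)
  hence "norm (exp (- (2 * pi * \<i>) * z) - 1) \<ge> exp (2 * pi * Im z) / 2" using ge2 by linarith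
  hence "1 / norm (exp (- (2 * pi * \<i>) * z) - 1) \<le> 1 / (exp (2 * pi * Im z) / 2)"
    by (intro divide_left_mono mult_pos_pos) (auto intro: less_le_trans[of _ "exp (2 * pi * Im z) / 2"])
  thus ?thesis by (simp add: Plana_kernel_def norm_divide exp_minus field_simps)
qed

text \<open>Cauchy's theorem for the product of \<open>g\<close> with the kernel in the half strip above a unit interval. The zeros of
\<open>g\<close> at the two corners cancel the poles of the kernel, so that no indentation is needed.\<close>

lemma Abel_Plana_half_strip:
  fixes n :: nat
  assumes ab: "real n - 1 < a'" "a' < n" "real n + 1 < b'" "b' < n + 2"
    and hol: "g holomorphic_on {z. a' < Re z \<and> Re z < b'}" and g0: "g (of_nat n) = 0" "g (of_nat (Suc n)) = 0"
    and bd: "\<And>x y. real n \<le> x \<Longrightarrow> x \<le> real n + 1 \<Longrightarrow> T1 \<le> y \<Longrightarrow> norm (g (Complex x y)) \<le> C * exp y"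
  shows "set_integrable lborel {0<..} (\<lambda>y. g (Complex (real n) y) / of_real (exp (2 * pi * y) - 1))" (is ?A)
    and "set_integrable lborel {0<..} (\<lambda>y. g (Complex (real (Suc n)) y) / of_real (exp (2 * pi * y) - 1))" (is ?B)
    and "((\<lambda>x. g (of_real x) * Plana_kernel (of_real x)) has_integral 
           \<i> * ((LBINT y:{0<..}. g (Complex (real n) y) / of_real (exp (2 * pi * y) - 1)) -
                (LBINT y:{0<..}. g (Complex (real (Suc n)) y) / of_real (exp (2 * pi * y) - 1)))) {real n..real n + 1}" (is ?C)
proof -
  define U where "U = {z. a' < Re z \<and> Re z < b'}"
  obtain G where G: "G holomorphic_on U" "\<And>z. z \<in> U - {of_nat n, of_nat (Suc n)} \<Longrightarrow> G z = g z * Plana_kernel z"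
    using Plana_kernel_extend[OF ab hol g0] unfolding U_def by blast
  have contG: "continuous_on U G" using G(1) by (rule holomorphic_on_imp_continuous_on)
  have convU: "convex U" unfolding U_def
    using convex_halfspace_Re_gt[of a'] convex_halfspace_Re_lt[of b'] by (auto simp: Collect_conj_eq intro: convex_Int)
  have inU: "Complex x y \<in> U" if "real n \<le> x" "x \<le> real n + 1" for x y using that ab by (auto simp: U_def)
  have inU2: "z \<in> U" if "real n \<le> Re z" "Re z \<le> real n + 1" for z
    using inU[OF that, of "Im z"] by simp
  have C: "C \<ge> 0" using bd[of "real n" T1] norm_ge_zero[of "g (Complex (real n) T1)"]
    by (simp add: order.trans[OF norm_ge_zero] zero_le_mult_iff) (smt (verit) exp_gt_zero mult_neg_pos norm_ge_zero)
  have bdG: "norm (G (Complex x y)) \<le> (2 * C) * exp (- 1 * y)" if "real n \<le> x" "x \<le> real n + 1" "max 1 T1 \<le> y" for x y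
  proof -
    have "Complex x y \<in> U - {of_nat n, of_nat (Suc n)}" using inU[OF that(1,2)] that by (auto simp: complex_eq_iff)
    hence "norm (G (Complex x y)) = norm (g (Complex x y)) * norm (Plana_kernel (Complex x y))" by (simp add: G norm_mult)
    also have "\<dots> \<le> (C * exp y) * (2 * exp (- (2 * pi) * y))"
      using bd[of x y] norm_Plana_kernel_le[of "Complex x y"] that C by (intro mult_mono) auto
    also have "\<dots> = 2 * C * exp (y - 2 * pi * y)" by (simp add: exp_diff exp_minus field_simps)
    also have "\<dots> \<le> 2 * C * exp (- 1 * y)"
    proof -
      have "2 * y \<le> 2 * pi * y" using that pi_gt3 by (intro mult_right_mono) auto
      thus ?thesis using C by (intro mult_left_mono) auto
    qed
    finally show ?thesis .
  qed
  define k where "k = (\<lambda>x y. G (Complex x y))"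
  have contk: "continuous_on A (k x)" if "real n \<le> x" "x \<le> real n + 1" for x A
  proof -
    have "continuous_on A (\<lambda>y. Complex x y)" by (simp add: Complex_eq continuous_intros)
    thus ?thesis unfolding k_def using inU[OF that] by (intro continuous_on_compose2[OF contG]) auto
  qed
  have intk: "set_integrable lborel {0<..} (k x)" if "real n \<le> x" "x \<le> real n + 1" for x
    using bdG[OF that] contk[OF that] unfolding k_def by (intro set_integrable_half_line_bound[where T = "max 1 T1" and C = "2 * C" and \<eta> = 1]) auto
  have keq: "k (real j) y = g (Complex (real j) y) / of_real (exp (2 * pi * y) - 1)" if "y > 0" "j = n \<or> j = Suc n" for j y
  proof -
    have "Complex (real j) y \<in> U - {of_nat n, of_nat (Suc n)}" using inU[of "real j" y] that by (auto simp: complex_eq_iff)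
    thus ?thesis by (simp add: k_def G Plana_kernel_nat_line)
  qed
  have A: "set_integrable lborel {0<..} (\<lambda>y. g (Complex (real j) y) / of_real (exp (2 * pi * y) - 1))" if "j = n \<or> j = Suc n" for j
  proof -
    have "set_integrable lborel {0<..} (k (real j)) \<longleftrightarrow> 
          set_integrable lborel {0<..} (\<lambda>y. g (Complex (real j) y) / of_real (exp (2 * pi * y) - 1))"
      using keq[OF _ that] by (intro set_integrable_cong) auto
    thus ?thesis using intk[of "real j"] that by auto
  qed
  show ?A ?B using A[of n] A[of "Suc n"] by auto
  have LI: "(LBINT y:{0<..}. k (real j) y) = (LBINT y:{0<..}. g (Complex (real j) y) / of_real (exp (2 * pi * y) - 1))" if "j = n \<or> j = Suc n" for j
    by (intro set_lebesgue_integral_cong) (use keq that in auto)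
  define I where "I = contour_integral (linepath (Complex (real n) 0) (Complex (real n + 1) 0)) G"
  have ev: "eventually (\<lambda>T. \<i> * integral {0..T} (k (real n + 1)) - \<i> * integral {0..T} (k (real n)) + I -
     contour_integral (linepath (Complex (real n) (1 * T)) (Complex (real n + 1) (1 * T))) G = 0) at_top"
    using eventually_gt_at_top[of 0]
  proof eventually_elim
    case (elim T)
    define R where "R = rectpath (Complex (real n) 0) (Complex (real n + 1) T)"
    have img: "path_image R \<subseteq> U"
    proof
      fix z assume "z \<in> path_image R"
      hence "z \<in> cbox (Complex (real n) 0) (Complex (real n + 1) T)"
        unfolding R_def using elim path_image_rectpath_subset_cbox[of "Complex (real n) 0" "Complex (real n + 1) T"] by auto
      thus "z \<in> U" using inU[of "Re z" "Im z"] by (auto simp: in_cbox_complex_iff)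
    qed
    have "(G has_contour_integral 0) R"
      using G(1) convU img by (intro Cauchy_theorem_convex_simple[of _ U]) (auto simp: R_def)
    hence "contour_integral R G = 0" by (rule contour_integral_unique)
    also have "contour_integral R G = \<i> * integral {0..T} (k (real n + 1)) - \<i> * integral {0..T} (k (real n)) + I -
     contour_integral (linepath (Complex (real n) T) (Complex (real n + 1) T)) G"
      unfolding R_def I_def k_def using elim img R_def
      by (intro contour_integral_rectpath continuous_on_subset[OF contG]) auto
    finally show ?case by simp
  qed
  have hor: "((\<lambda>T. contour_integral (linepath (Complex (real n) (1 * T)) (Complex (real n + 1) (1 * T))) G) \<longlongrightarrow> 0) at_top"
  proof -
    have b1: "norm (G (Complex x (1 * y))) \<le> (2 * C) * exp (- 1 * y)" if "real n \<le> x" "x \<le> real n + 1" "max 1 T1 \<le> y" for x y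
      using bdG[OF that] by simp
    have b2: "continuous_on {Complex x (1 * T) |x. real n \<le> x \<and> x \<le> real n + 1} G" if "T \<ge> 0" for T
      using inU by (intro continuous_on_subset[OF contG]) auto
    show ?thesis
      by (rule horizontal_integral_tendsto_0[where ?T1.0 = "max 1 T1", OF b1 _ _ _ b2]) (use C in auto)
  qed
  have "((\<lambda>T. \<i> * integral {0..T} (k (real n + 1)) - \<i> * integral {0..T} (k (real n)) + I -
     contour_integral (linepath (Complex (real n) (1 * T)) (Complex (real n + 1) (1 * T))) G) \<longlongrightarrow>
     \<i> * (LBINT y:{0<..}. k (real n + 1) y) - \<i> * (LBINT y:{0<..}. k (real n) y) + I - 0) at_top"
    by (intro tendsto_intros integral_half_line_tendsto intk hor) auto
  moreover have "((\<lambda>T. \<i> * integral {0..T} (k (real n + 1)) - \<i> * integral {0..T} (k (real n)) + I -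
     contour_integral (linepath (Complex (real n) (1 * T)) (Complex (real n + 1) (1 * T))) G) \<longlongrightarrow> 0) at_top"
    using ev by (rule tendsto_eventually)
  ultimately have "\<i> * (LBINT y:{0<..}. k (real n + 1) y) - \<i> * (LBINT y:{0<..}. k (real n) y) + I - 0 = 0"
    by (rule tendsto_unique[rotated]) simp
  hence I: "I = \<i> * ((LBINT y:{0<..}. k (real n) y) - (LBINT y:{0<..}. k (real (Suc n)) y))"
    by (simp add: algebra_simps)
  have "(G has_contour_integral I) (linepath (Complex (real n) 0) (Complex (real n + 1) 0))"
    unfolding I_def using inU2
    by (intro has_contour_integral_integral contour_integrable_continuous_linepath continuous_on_subset[OF contG])
       (auto simp: closed_segment_same_Im closed_segment_eq_real_ivl)
  hence "((\<lambda>x. G (of_real x)) has_integral I) {real n..real n + 1}"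
    by (subst (asm) has_contour_integral_linepath_Reals_iff) (auto simp: complex_is_Real_iff)
  hence "((\<lambda>x. g (of_real x) * Plana_kernel (of_real x)) has_integral I) {real n..real n + 1}"
  proof (rule has_integral_spike_finite[of "{real n, real n + 1}", rotated 2])
    fix x assume x: "x \<in> {real n..real n + 1} - {real n, real n + 1}"
    have "complex_of_real x \<in> U - {of_nat n, of_nat (Suc n)}" using inU2[of "of_real x"] x by (auto simp: complex_eq_iff)
    thus "g (of_real x) * Plana_kernel (of_real x) = G (of_real x)" by (simp add: G)
  qed auto
  thus ?C unfolding I using LI[of n] LI[of "Suc n"] by simp
qed

definition vertical_diff :: "(complex \<Rightarrow> complex) \<Rightarrow> real \<Rightarrow> real \<Rightarrow> complex" where
  "vertical_diff f x y = f (Complex x y) - f (Complex x (- y))"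

lemma Plana_kernel_reflect:
  assumes "z \<notin> \<int>"
  shows "Plana_kernel z + Plana_kernel (of_int j - z) = -1"
proof -
  define E where "E = exp (- (2 * pi * \<i>) * z)"
  have E: "E \<noteq> 1" "E \<noteq> 0" using Plana_kernel_zero_iff[of z] assms by (auto simp: E_def)
  have "exp (- (2 * pi * \<i>) * (of_int j - z)) = exp (2 * of_int (- j) * of_real pi * \<i>) / E"
    by (simp add: E_def algebra_simps flip: exp_diff)
  hence "exp (- (2 * pi * \<i>) * (of_int j - z)) = 1 / E" by (simp only: exp_2pi_of_int)
  hence "Plana_kernel (of_int j - z) = 1 / (1 / E - 1)" by (simp only: Plana_kernel_def)
  moreover have "Plana_kernel z = 1 / (E - 1)" by (simp only: Plana_kernel_def E_def)
  ultimately have "Plana_kernel z + Plana_kernel (of_int j - z) = 1 / (E - 1) + 1 / (1 / E - 1)" by (simp only:)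
  also have "1 / E - 1 = - ((E - 1) / E)" using E by (simp add: field_simps)
  also have "1 / (E - 1) + 1 / (- ((E - 1) / E)) = 1 / (E - 1) - E / (E - 1)" by simp
  also have "\<dots> = (1 - E) / (E - 1)" by (rule diff_divide_distrib[symmetric])
  also have "\<dots> = -1" using E by (simp add: divide_eq_minus_1_iff)
  finally show ?thesis .
qed

text \<open>Subtracting the linear interpolant of \<open>f\<close> at the two integers creates the zeros needed in the upper half strip, and
the reflected argument covers the lower one. The interpolant itself contributes the trapezoidal value.\<close>

theorem Abel_Plana_strip:
  fixes n :: nat
  assumes e: "0 < e" "e < 1" and hol: "f holomorphic_on {z. real n - e < Re z \<and> Re z < real n + 1 + e}"
    and bd: "strip_bound n (real n + 1) (1/2) f"
  shows "set_integrable lborel {0<..} (\<lambda>y. (vertical_diff f n y - vertical_diff f (Suc n) y) / of_real (exp (2 * pi * y) - 1))"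
    and "((\<lambda>x. f (of_real x)) has_integral ((f (of_nat n) + f (of_nat (Suc n))) / 2 - 
           \<i> * (LBINT y:{0<..}. (vertical_diff f n y - vertical_diff f (Suc n) y) / of_real (exp (2 * pi * y) - 1)))) {real n..real (Suc n)}"
proof -
  define d where "d = f (of_nat (Suc n)) - f (of_nat n)"
  define l where "l = (\<lambda>z::complex. f (of_nat n) + (z - of_nat n) * d)"
  define g where "g = (\<lambda>z. f z - l z)"
  define g2 where "g2 = (\<lambda>z. g (of_nat (2 * n + 1) - z))"
  have holg: "g holomorphic_on {z. real n - e < Re z \<and> Re z < real n + 1 + e}"
    unfolding g_def l_def by (intro holomorphic_intros hol)
  have holg2: "g2 holomorphic_on {z. real n - e < Re z \<and> Re z < real n + 1 + e}"
    unfolding g2_def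
    by (intro holomorphic_on_compose_gen[OF _ holg, unfolded o_def] holomorphic_intros) auto
  have "strip_bound n (real n + 1) (1/2) l"
  proof (rule strip_bound_power_growth)
    fix x y :: real assume xy: "real n \<le> x" "x \<le> real n + 1" "0 \<le> \<bar>y\<bar>"
    have "norm (Complex x y - of_nat n) \<le> \<bar>x - n\<bar> + \<bar>y\<bar>" using cmod_le[of "Complex x y - of_nat n"] by simp
    also have "\<dots> \<le> 1 + \<bar>y\<bar>" using xy by simp
    finally have "norm (Complex x y - of_nat n) * norm d \<le> norm d * (1 + \<bar>y\<bar>)" by (subst mult.commute[of "norm d"], intro mult_right_mono) auto
    moreover have "norm (f (of_nat n)) * 1 \<le> norm (f (of_nat n)) * (1 + \<bar>y\<bar>)" by (intro mult_left_mono) auto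
    moreover have "norm (l (Complex x y)) \<le> norm (f (of_nat n)) + norm (Complex x y - of_nat n) * norm d"
      unfolding l_def by (metis norm_mult norm_triangle_ineq)
    ultimately show "norm (l (Complex x y)) \<le> (norm (f (of_nat n)) + norm d) * (1 + \<bar>y\<bar>) ^ 1"
      by (simp only: power_one_right distrib_right mult_1_right)
  qed auto
  hence "strip_bound n (real n + 1) (1/2) g" unfolding g_def using bd by (intro strip_bound_diff)
  then obtain C T where CT: "C > 0" "T > 0"
    "\<And>x y. real n \<le> x \<Longrightarrow> x \<le> real n + 1 \<Longrightarrow> T \<le> \<bar>y\<bar> \<Longrightarrow> norm (g (Complex x y)) \<le> C * exp (1 / 2 * \<bar>y\<bar>)"
    using strip_boundD by blast
  have bdg: "norm (g (Complex x y)) \<le> C * exp \<bar>y\<bar>" if "real n \<le> x" "x \<le> real n + 1" "T \<le> \<bar>y\<bar>" for x y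
  proof -
    have "norm (g (Complex x y)) \<le> C * exp (1 / 2 * \<bar>y\<bar>)" by (rule CT(3)[OF that])
    also have "\<dots> \<le> C * exp \<bar>y\<bar>" using CT by (intro mult_left_mono) auto
    finally show ?thesis .
  qed
  have g2eq: "g2 (Complex x y) = g (Complex (real (2 * n + 1) - x) (- y))" for x y
    unfolding g2_def by (intro arg_cong[where f = g]) (simp add: complex_eq_iff)
  have g0: "g (of_nat n) = 0" "g (of_nat (Suc n)) = 0" by (auto simp: g_def l_def d_def)
  have g20: "g2 (of_nat n) = 0" "g2 (of_nat (Suc n)) = 0"
  proof -
    have "of_nat (2 * n + 1) - of_nat n = (of_nat (Suc n) :: complex)" "of_nat (2 * n + 1) - of_nat (Suc n) = (of_nat n :: complex)"
      by simp_all
    thus "g2 (of_nat n) = 0" "g2 (of_nat (Suc n)) = 0" unfolding g2_def by (simp_all only: g0)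
  qed
  have ar: "real n - 1 < real n - e" "real n - e < n" "real n + 1 < real n + 1 + e" "real n + 1 + e < n + 2"
    using e by auto
  have b1: "norm (g (Complex x y)) \<le> C * exp y" if "real n \<le> x" "x \<le> real n + 1" "T \<le> y" for x y
    using bdg[of x y] that CT by auto
  have H1: "set_integrable lborel {0<..} (\<lambda>y. g (Complex (real n) y) / of_real (exp (2 * pi * y) - 1))"
    "set_integrable lborel {0<..} (\<lambda>y. g (Complex (real (Suc n)) y) / of_real (exp (2 * pi * y) - 1))"
    "((\<lambda>x. g (of_real x) * Plana_kernel (of_real x)) has_integral 
           \<i> * ((LBINT y:{0<..}. g (Complex (real n) y) / of_real (exp (2 * pi * y) - 1)) -
                (LBINT y:{0<..}. g (Complex (real (Suc n)) y) / of_real (exp (2 * pi * y) - 1)))) {real n..real n + 1}"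
    using Abel_Plana_half_strip[OF ar holg g0 b1] by blast+
  have b2: "norm (g2 (Complex x y)) \<le> C * exp y" if "real n \<le> x" "x \<le> real n + 1" "T \<le> y" for x y
    unfolding g2eq using bdg[of "real (2 * n + 1) - x" "- y"] that CT by auto
  have H2: "set_integrable lborel {0<..} (\<lambda>y. g2 (Complex (real n) y) / of_real (exp (2 * pi * y) - 1))"
    "set_integrable lborel {0<..} (\<lambda>y. g2 (Complex (real (Suc n)) y) / of_real (exp (2 * pi * y) - 1))"
    "((\<lambda>x. g2 (of_real x) * Plana_kernel (of_real x)) has_integral 
           \<i> * ((LBINT y:{0<..}. g2 (Complex (real n) y) / of_real (exp (2 * pi * y) - 1)) -
                (LBINT y:{0<..}. g2 (Complex (real (Suc n)) y) / of_real (exp (2 * pi * y) - 1)))) {real n..real n + 1}"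
    by (rule Abel_Plana_half_strip[OF _ _ _ _ holg2 g20, of T C]; use e b2 in auto)+
  define I1 where "I1 = \<i> * ((LBINT y:{0<..}. g (Complex (real n) y) / of_real (exp (2 * pi * y) - 1)) -
                (LBINT y:{0<..}. g (Complex (real (Suc n)) y) / of_real (exp (2 * pi * y) - 1)))"
  define I2 where "I2 = \<i> * ((LBINT y:{0<..}. g2 (Complex (real n) y) / of_real (exp (2 * pi * y) - 1)) -
                (LBINT y:{0<..}. g2 (Complex (real (Suc n)) y) / of_real (exp (2 * pi * y) - 1)))"
  note i1 = H1(3)[folded I1_def] and i2 = H2(3)[folded I2_def]
  have D: "(vertical_diff f n y - vertical_diff f (Suc n) y) / of_real (exp (2 * pi * y) - 1) =
       (g (Complex (real n) y) / of_real (exp (2 * pi * y) - 1) - g (Complex (real (Suc n)) y) / of_real (exp (2 * pi * y) - 1)) +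
       (g2 (Complex (real n) y) / of_real (exp (2 * pi * y) - 1) - g2 (Complex (real (Suc n)) y) / of_real (exp (2 * pi * y) - 1))" for y
  proof -
    have "real (2 * n + 1) - real n = real (Suc n)" "real (2 * n + 1) - real (Suc n) = real n" by simp_all
    hence "g2 (Complex (real n) y) = g (Complex (real (Suc n)) (- y))" "g2 (Complex (real (Suc n)) y) = g (Complex (real n) (- y))"
      unfolding g2eq by (simp_all only:)
    moreover have "l (Complex (real n) y) = l (Complex (real (Suc n)) y) - l (Complex (real (Suc n)) (- y)) + l (Complex (real n) (- y))"
      by (simp add: l_def Complex_eq algebra_simps)
    moreover have "f z = g z + l z" for z by (simp add: g_def)
    ultimately have "vertical_diff f n y - vertical_diff f (Suc n) y = (g (Complex (real n) y) - g (Complex (real (Suc n)) y)) +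
        (g2 (Complex (real n) y) - g2 (Complex (real (Suc n)) y))"
      unfolding vertical_diff_def by (simp only:) simp
    thus ?thesis by (simp add: add_divide_distrib diff_divide_distrib)
  qed
  show "set_integrable lborel {0<..} (\<lambda>y. (vertical_diff f n y - vertical_diff f (Suc n) y) / of_real (exp (2 * pi * y) - 1))"
    unfolding D by (intro set_integral_add set_integral_diff H1 H2)
  have L: "\<i> * (LBINT y:{0<..}. (vertical_diff f n y - vertical_diff f (Suc n) y) / of_real (exp (2 * pi * y) - 1)) = I1 + I2"
    unfolding D I1_def I2_def
    by (subst set_integral_add(2) set_integral_diff(2); (intro set_integral_diff H1 H2)?)+ (simp add: algebra_simps)
  have "((\<lambda>x. g2 (of_real ((-1) *\<^sub>R x + (2 * real n + 1))) * Plana_kernel (of_real ((-1) *\<^sub>R x + (2 * real n + 1)))) has_integral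
     (1 / (\<bar>-1\<bar> ^ DIM(real))) *\<^sub>R I2) ((\<lambda>x. (1 / (-1)) *\<^sub>R x + -((1 / (-1)) *\<^sub>R (2 * real n + 1))) ` cbox (real n) (real n + 1))"
    using i2 by (intro has_integral_affinity) auto
  also have "(\<lambda>x. (1 / (-1)) *\<^sub>R x + -((1 / (-1)) *\<^sub>R (2 * real n + 1))) ` cbox (real n) (real n + 1) = {real n..real n + 1}"
  proof -
    have "x \<in> (\<lambda>x. - x + (2 * real n + 1)) ` {real n..real n + 1}" if "real n \<le> x" "x \<le> real n + 1" for x
      by (rule image_eqI[of _ _ "2 * real n + 1 - x"]) (use that in auto)
    thus ?thesis by auto
  qed
  also have "(\<lambda>x. g2 (of_real ((-1) *\<^sub>R x + (2 * real n + 1))) * Plana_kernel (of_real ((-1) *\<^sub>R x + (2 * real n + 1)))) =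
     (\<lambda>x. g (of_real x) * Plana_kernel (of_int (2 * int n + 1) - of_real x))"
    by (auto simp: g2_def algebra_simps)
  finally have i2': "((\<lambda>x. g (of_real x) * Plana_kernel (of_int (2 * int n + 1) - of_real x)) has_integral I2) {real n..real n + 1}"
    by simp
  have "((\<lambda>x. - (g (of_real x) * Plana_kernel (of_real x) + g (of_real x) * Plana_kernel (of_int (2 * int n + 1) - of_real x))) has_integral - (I1 + I2)) {real n..real n + 1}"
    by (intro has_integral_neg has_integral_add i1 i2')
  hence ig: "((\<lambda>x. g (of_real x)) has_integral - (I1 + I2)) {real n..real n + 1}"
  proof (rule has_integral_eq[rotated])
    fix x assume x: "x \<in> {real n..real n + 1}"
    show "- (g (of_real x) * Plana_kernel (of_real x) + g (of_real x) * Plana_kernel (of_int (2 * int n + 1) - of_real x)) = g (of_real x)"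
    proof (cases "complex_of_real x \<in> \<int>")
      case True
      then obtain j :: int where "complex_of_real x = of_int j" by (auto elim: Ints_cases)
      hence j: "x = of_int j" by (simp add: complex_eq_iff)
      hence "j = int n \<or> j = int (Suc n)" using x by auto
      hence "g (of_real x) = 0" using g0 j by auto
      thus ?thesis by simp
    next
      case False
      have "g (of_real x) * Plana_kernel (of_real x) + g (of_real x) * Plana_kernel (of_int (2 * int n + 1) - of_real x) =
        g (of_real x) * (Plana_kernel (of_real x) + Plana_kernel (of_int (2 * int n + 1) - of_real x))" by (simp only: distrib_left)
      also have "\<dots> = - g (of_real x)" by (simp only: Plana_kernel_reflect[OF False] mult_minus1_right)
      finally show ?thesis by simp
    qed
  qed
  have "((\<lambda>x. l (of_real x)) has_integral ((of_real (real n + 1) * f (of_nat n) + (of_real (real n + 1) - of_nat n)\<^sup>2 / 2 * d) - 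
       (of_real (real n) * f (of_nat n) + (of_real (real n) - of_nat n)\<^sup>2 / 2 * d))) {real n..real n + 1}"
    by (rule fundamental_theorem_of_calculus)
       (auto intro!: has_vector_derivative_real_field derivative_eq_intros simp: l_def)
  hence il: "((\<lambda>x. l (of_real x)) has_integral (f (of_nat n) + f (of_nat (Suc n))) / 2) {real n..real n + 1}"
    by (simp add: d_def algebra_simps diff_divide_distrib add_divide_distrib)
  have "((\<lambda>x. l (of_real x) + g (of_real x)) has_integral ((f (of_nat n) + f (of_nat (Suc n))) / 2 + - (I1 + I2))) {real n..real n + 1}"
    by (intro has_integral_add il ig)
  thus "((\<lambda>x. f (of_real x)) has_integral ((f (of_nat n) + f (of_nat (Suc n))) / 2 - 
           \<i> * (LBINT y:{0<..}. (vertical_diff f n y - vertical_diff f (Suc n) y) / of_real (exp (2 * pi * y) - 1)))) {real n..real (Suc n)}"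
    unfolding L by (simp add: g_def algebra_simps)
qed

theorem Abel_Plana_finite:
  assumes e: "0 < e" "e < 1" and hol: "f holomorphic_on {z. - e < Re z}"
    and bd: "\<And>n. strip_bound (real n) (real n + 1) (1/2) f"
  shows "set_integrable lborel {0<..} (\<lambda>y. (vertical_diff f 0 y - vertical_diff f N y) / of_real (exp (2 * pi * y) - 1)) \<and>
     ((\<lambda>x. f (of_real x)) has_integral ((\<Sum>n<N. (f (of_nat n) + f (of_nat (Suc n))) / 2) - 
       \<i> * (LBINT y:{0<..}. (vertical_diff f 0 y - vertical_diff f N y) / of_real (exp (2 * pi * y) - 1)))) {0..real N}"
proof (induction N)
  case 0
  show ?case by (simp add: set_integrable_def set_lebesgue_integral_def has_integral_refl)
next
  case (Suc N)
  have h: "f holomorphic_on {z. real N - e < Re z \<and> Re z < real N + 1 + e}"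
    by (rule holomorphic_on_subset[OF hol]) auto
  note S = Abel_Plana_strip[OF e h bd]
  have D: "(vertical_diff f 0 y - vertical_diff f (Suc N) y) / of_real (exp (2 * pi * y) - 1) =
      (vertical_diff f 0 y - vertical_diff f N y) / of_real (exp (2 * pi * y) - 1) + 
      (vertical_diff f N y - vertical_diff f (Suc N) y) / of_real (exp (2 * pi * y) - 1)" for y
    by (simp flip: add_divide_distrib)
  have L: "(LBINT y:{0<..}. (vertical_diff f 0 y - vertical_diff f (Suc N) y) / of_real (exp (2 * pi * y) - 1)) =
     (LBINT y:{0<..}. (vertical_diff f 0 y - vertical_diff f N y) / of_real (exp (2 * pi * y) - 1)) +
     (LBINT y:{0<..}. (vertical_diff f N y - vertical_diff f (Suc N) y) / of_real (exp (2 * pi * y) - 1))"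
    unfolding D using Suc S by (intro set_integral_add(2)) auto
  have int: "set_integrable lborel {0<..} (\<lambda>y. (vertical_diff f 0 y - vertical_diff f (Suc N) y) / of_real (exp (2 * pi * y) - 1))"
    unfolding D using Suc S by (intro set_integral_add(1)) auto
  have "((\<lambda>x. f (of_real x)) has_integral ((\<Sum>n<N. (f (of_nat n) + f (of_nat (Suc n))) / 2) - 
       \<i> * (LBINT y:{0<..}. (vertical_diff f 0 y - vertical_diff f N y) / of_real (exp (2 * pi * y) - 1)) +
       ((f (of_nat N) + f (of_nat (Suc N))) / 2 - 
           \<i> * (LBINT y:{0<..}. (vertical_diff f N y - vertical_diff f (Suc N) y) / of_real (exp (2 * pi * y) - 1))))) {0..real (Suc N)}"
    using Suc S(2) by (intro has_integral_combine[of 0 "real N"]) auto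
  thus ?case using int unfolding L by (simp add: algebra_simps)
qed

section \<open>The zeta function as a Plana integral\<close>

lemma Gamma_integral_scaled:
  assumes z: "Re z > 0" and a: "a > 0"
  shows "set_integrable lborel {0<..} (\<lambda>t. of_real t powr (z - 1) * of_real (exp (- a * t)))"
    and "(LBINT t:{0<..}. of_real t powr (z - 1) * of_real (exp (- a * t))) = Gamma z * of_real a powr (- z)"
proof -
  define F where "F = (\<lambda>c t. indicator {0<..} t *\<^sub>R (of_real t powr (z - 1) * of_real (exp (- c * t))) :: complex)"
  have int: "integrable lborel (F c)" if c: "c > 0" for c
  proof -
    have "(\<lambda>t. complex_of_real t powr (z - 1) / of_real (exp (c * t))) absolutely_integrable_on {0<..}"
      by (rule absolutely_integrable_Gamma_integral[OF z c])
    hence "integrable lebesgue (F c)"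
      by (simp add: set_integrable_def F_def exp_minus divide_inverse)
    moreover have "F c \<in> borel_measurable lborel"
    proof -
      have "continuous_on {0<..} (\<lambda>t. of_real t powr (z - 1) * of_real (exp (- c * t)) :: complex)"
        by (intro continuous_intros) auto
      from borel_measurable_continuous_on_indicator[OF _ this] show ?thesis by (simp add: F_def)
    qed
    ultimately show ?thesis by (subst (asm) integrable_completion) auto
  qed
  show "set_integrable lborel {0<..} (\<lambda>t. of_real t powr (z - 1) * of_real (exp (- a * t)))"
    using int[OF a] by (simp add: set_integrable_def F_def)
  have "(LBINT t:{0<..}. of_real t powr (z - 1) * of_real (exp (- 1 * t))) = integral {0<..} (\<lambda>t. of_real t powr (z - 1) * of_real (exp (- 1 * t)))"
    using int[of 1] by (intro set_borel_integral_eq_integral(2)) (simp add: set_integrable_def F_def)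
  also have "\<dots> = Gamma z"
    using Gamma_integral_complex'[OF z] by (intro integral_unique) (simp add: exp_minus divide_inverse)
  finally have one: "(LINT t|lborel. F 1 t) = Gamma z" by (simp add: F_def set_lebesgue_integral_def)
  have "(LINT t|lborel. F 1 t) = \<bar>a\<bar> *\<^sub>R (LINT t|lborel. F 1 (0 + a * t))"
    using a by (intro lborel_integral_real_affine) auto
  also have "(\<lambda>t. F 1 (0 + a * t)) = (\<lambda>t. of_real a powr (z - 1) * F a t)"
  proof
    fix t
    show "F 1 (0 + a * t) = of_real a powr (z - 1) * F a t"
    proof (cases "t > 0")
      case True
      hence "complex_of_real (a * t) powr (z - 1) = of_real a powr (z - 1) * of_real t powr (z - 1)"
        using a by (simp add: powr_times_real)
      thus ?thesis using True a by (simp add: F_def indicator_def)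
    next
      case False
      thus ?thesis using a by (simp add: F_def indicator_def zero_less_mult_iff)
    qed
  qed
  also have "(LINT t|lborel. of_real a powr (z - 1) * F a t) = of_real a powr (z - 1) * (LINT t|lborel. F a t)" by simp
  finally have "Gamma z = of_real a * of_real a powr (z - 1) * (LINT t|lborel. F a t)"
    using a one by (simp add: scaleR_conv_of_real)
  also have "of_real a * of_real a powr (z - 1) = (of_real a powr z :: complex)"
    using a by (simp add: powr_diff)
  finally have "Gamma z * of_real a powr (- z) = (LINT t|lborel. F a t)"
    using a by (simp add: powr_minus)
  thus "(LBINT t:{0<..}. of_real t powr (z - 1) * of_real (exp (- a * t))) = Gamma z * of_real a powr (- z)"
    by (simp add: F_def set_lebesgue_integral_def)
qed

lemma integrable_powr_exp:
  assumes "c > 0" "a > 0"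
  shows "set_integrable lborel {0<..} (\<lambda>t::real. t powr (c - 1) * exp (- a * t))"
proof -
  have "set_integrable lborel {0<..} (\<lambda>t. norm (of_real t powr (of_real c - 1) * of_real (exp (- a * t)) :: complex))"
    using Gamma_integral_scaled(1)[of "of_real c" a] assms by (intro set_integrable_norm) auto
  also have "?this \<longleftrightarrow> ?thesis"
    by (intro set_integrable_cong) (auto simp: norm_mult norm_powr_real_powr)
  finally show ?thesis .
qed

lemma inverse_exp_minus_1_le:
  assumes "y > 0"
  shows "1 / (exp (2 * pi * y) - 1) \<le> exp (- pi * y) / y"
proof -
  have "1 + pi * y \<le> exp (pi * y)" by (rule exp_ge_add_one_self)
  moreover have "y \<le> pi * y" using assms pi_gt3 by simp
  ultimately have 1: "y \<le> exp (pi * y) - 1" by linarith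
  have "y * exp (pi * y) \<le> (exp (pi * y) - 1) * exp (pi * y)" using 1 by (intro mult_right_mono) auto
  also have "\<dots> \<le> (exp (pi * y) - 1) * (exp (pi * y) + 1)"
    using assms by (intro mult_left_mono) auto
  also have "\<dots> = exp (pi * y) * exp (pi * y) - 1" by (simp add: algebra_simps)
  also have "exp (pi * y) * exp (pi * y) = exp (2 * pi * y)" by (simp flip: exp_add)
  finally have le: "y * exp (pi * y) \<le> exp (2 * pi * y) - 1" .
  have "1 / (exp (2 * pi * y) - 1) \<le> 1 / (y * exp (pi * y))"
    using le assms by (intro divide_left_mono mult_pos_pos) auto
  thus ?thesis by (simp add: exp_minus field_simps)
qed

lemma exp_minus_exp_neg_le: "norm (exp w - exp (- w)) \<le> 2 * norm w * exp (norm w)" for w :: complex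
proof -
  have "norm (exp w - exp (- w)) \<le> exp (norm w) * norm (w - (- w))"
  proof (rule field_differentiable_bound[of "cball 0 (norm w)" exp exp])
    show "(exp has_field_derivative exp z) (at z within cball 0 (norm w))" for z :: complex
      by (auto intro!: derivative_eq_intros)
    show "norm (exp z) \<le> exp (norm w)" if "z \<in> cball 0 (norm w)" for z :: complex
      using norm_exp[of z] that by (auto intro: order_trans)
  qed auto
  also have "norm (w - (- w)) = 2 * norm w"
    by (metis diff_minus_eq_add mult_2 norm_mult norm_numeral)
  finally show ?thesis by (simp add: mult_ac)
qed

lemma vertical_diff_powr_le:
  assumes s: "Re s < 0" and a: "a \<ge> 0" and y: "y > 0"
  shows "norm (Complex a y powr (-s) - Complex a (-y) powr (-s)) 
           \<le> 16 * norm s * exp (pi * norm s) * y * norm (Complex a y) powr (- Re s - 1)"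
proof -
  define z where "z = Complex a y"
  define \<rho> \<phi> where "\<rho> = norm z" and "\<phi> = Im (Ln z)"
  have z: "z \<noteq> 0" "z \<notin> \<real>\<^sub>\<le>\<^sub>0" using y by (auto simp: z_def complex_eq_iff complex_nonpos_Reals_iff)
  have \<rho>: "\<rho> > 0" "\<rho> \<le> a + y" using z a y cmod_le[of z] by (auto simp: \<rho>_def z_def)
  have lnz: "Ln z = Complex (ln \<rho>) \<phi>" using z by (simp add: complex_eq_iff \<rho>_def \<phi>_def)
  have cnj: "Complex a (-y) = cnj z" by (simp add: z_def complex_eq_iff)
  have lncnj: "Ln (cnj z) = Complex (ln \<rho>) (- \<phi>)" using z by (simp add: cnj_Ln[symmetric] lnz complex_eq_iff)
  have \<phi>0: "\<phi> \<ge> 0" "\<phi> \<le> pi"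
    using Im_Ln_pos_le[OF z(1)] Im_Ln_le_pi[OF z(1)] y by (auto simp: \<phi>_def z_def)
  have \<phi>le: "\<phi> \<le> 8 * y / \<rho>"
  proof (cases "y \<le> a")
    case True
    hence a0: "a > 0" using y by simp
    have "\<phi> = arctan (y / a)" using arg_conv_arctan[of z] a0 z by (simp add: \<phi>_def Arg_eq_Im_Ln z_def)
    also have "\<dots> \<le> y / a" using a0 y by (intro arctan_le_self) auto
    also have "\<dots> \<le> 8 * y / \<rho>"
    proof -
      have "y * \<rho> \<le> y * (8 * a)" using \<rho> True y a0 by (intro mult_left_mono) auto
      thus ?thesis using a0 \<rho> by (simp add: field_simps)
    qed
    finally show ?thesis .
  next
    case False
    have "\<phi> \<le> 4" using \<phi>0 pi_less_4 by linarith
    also have "4 \<le> 8 * y / \<rho>" using False \<rho> a by (simp add: field_simps)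
    finally show ?thesis .
  qed
  define w where "w = - (\<i> * of_real \<phi> * s)"
  have nw: "norm w = \<phi> * norm s" using \<phi>0 by (simp add: w_def norm_mult)
  have e1: "z powr (-s) = of_real \<rho> powr (-s) * exp w"
    using z \<rho> by (simp add: powr_def lnz w_def Ln_of_real Complex_eq algebra_simps flip: exp_add)
  have e2: "cnj z powr (-s) = of_real \<rho> powr (-s) * exp (- w)"
    using z \<rho> by (simp add: powr_def lncnj w_def Ln_of_real Complex_eq algebra_simps flip: exp_add)
  have "norm (z powr (-s) - cnj z powr (-s)) = \<rho> powr (- Re s) * norm (exp w - exp (- w))"
    unfolding e1 e2 using \<rho> by (simp add: norm_mult norm_powr_real_powr flip: right_diff_distrib)
  also have "\<dots> \<le> \<rho> powr (- Re s) * (2 * (8 * y / \<rho> * norm s) * exp (pi * norm s))"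
  proof (intro mult_left_mono)
    have "norm (exp w - exp (- w)) \<le> 2 * norm w * exp (norm w)" by (rule exp_minus_exp_neg_le)
    also have "\<dots> \<le> 2 * (8 * y / \<rho> * norm s) * exp (pi * norm s)"
      unfolding nw using \<phi>0 \<phi>le \<rho> y by (intro mult_mono) (auto intro!: mult_right_mono)
    finally show "norm (exp w - exp (- w)) \<le> 2 * (8 * y / \<rho> * norm s) * exp (pi * norm s)" .
  qed auto
  also have "\<dots> = 16 * norm s * exp (pi * norm s) * y * \<rho> powr (- Re s - 1)"
    using \<rho> by (simp add: powr_diff)
  finally show ?thesis unfolding cnj by (simp add: z_def \<rho>_def)
qed

definition Plana_diff :: "complex \<Rightarrow> real \<Rightarrow> real \<Rightarrow> complex" where
  "Plana_diff s a y = (Complex a y powr (-s) - Complex a (-y) powr (-s)) / of_real (exp (2 * pi * y) - 1)"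

lemma norm_Plana_diff_le:
  assumes s: "-1 < Re s" "Re s < 0" and a: "a \<ge> 0" and y: "y > 0" and r: "0 < r" "r \<le> norm (Complex a y)"
  shows "norm (Plana_diff s a y) \<le> 16 * norm s * exp (pi * norm s) * r powr (- Re s - 1) * exp (- pi * y)"
proof -
  have E: "exp (2 * pi * y) - 1 > 0" using y by simp
  have "norm (Plana_diff s a y) = norm (Complex a y powr (-s) - Complex a (-y) powr (-s)) * (1 / (exp (2 * pi * y) - 1))"
    using E by (simp add: Plana_diff_def norm_divide del: of_real_diff)
  also have "\<dots> \<le> (16 * norm s * exp (pi * norm s) * y * norm (Complex a y) powr (- Re s - 1)) * (exp (- pi * y) / y)"
    using vertical_diff_powr_le[OF s(2) a y] inverse_exp_minus_1_le[OF y] E y by (intro mult_mono) auto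
  also have "\<dots> = 16 * norm s * exp (pi * norm s) * norm (Complex a y) powr (- Re s - 1) * exp (- pi * y)"
    using y by simp
  also have "\<dots> \<le> 16 * norm s * exp (pi * norm s) * r powr (- Re s - 1) * exp (- pi * y)"
    using s r by (intro mult_right_mono mult_left_mono powr_mono2') auto
  finally show ?thesis .
qed

lemma norm_Plana_diff_le_self:
  assumes s: "-1 < Re s" "Re s < 0" and a: "a \<ge> 0" and y: "y > 0"
  shows "norm (Plana_diff s a y) \<le> (16 * norm s * exp (pi * norm s)) * (y powr (- Re s - 1) * exp (- pi * y))"
  using norm_Plana_diff_le[OF s a y y] abs_Im_le_cmod[of "Complex a y"] y by (simp add: mult.assoc)

lemma Plana_diff_measurable: "(\<lambda>y. indicator {0<..} y *\<^sub>R Plana_diff s a y) \<in> borel_measurable lborel"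
proof -
  have "continuous_on {0<..} (Plana_diff s a)"
    unfolding Plana_diff_def Complex_eq by (intro continuous_intros) (auto simp: complex_nonpos_Reals_iff complex_eq_iff)
  from borel_measurable_continuous_on_indicator[OF _ this] show ?thesis by simp
qed

lemma set_integrable_Plana_diff:
  assumes s: "-1 < Re s" "Re s < 0" and a: "a \<ge> 0"
  shows "set_integrable lborel {0<..} (Plana_diff s a)"
  unfolding set_integrable_def
proof (rule Bochner_Integration.integrable_bound)
  have "set_integrable lborel {0<..} (\<lambda>t::real. (16 * norm s * exp (pi * norm s)) * (t powr (- Re s - 1) * exp (- pi * t)))"
    using integrable_powr_exp[of "- Re s" pi] s by (intro set_integrable_mult_right) auto
  thus "integrable lborel (\<lambda>t::real. indicator {0<..} t *\<^sub>R ((16 * norm s * exp (pi * norm s)) * (t powr (- Re s - 1) * exp (- pi * t))))"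
    by (simp add: set_integrable_def)
  show "AE y in lborel. norm (indicator {0<..} y *\<^sub>R Plana_diff s a y) \<le> norm (indicator {0<..} y *\<^sub>R ((16 * norm s * exp (pi * norm s)) * (y powr (- Re s - 1) * exp (- pi * y))))"
    using norm_Plana_diff_le_self[OF s a]
    by (intro AE_I2) (auto simp: indicator_def abs_mult simp del: minus_diff_eq)
qed (rule Plana_diff_measurable)

lemma tendsto_nat_shift_powr:
  assumes "Re z > 0" "X \<longlonglongrightarrow> 0" "\<And>k. X k > 0"
  shows "(\<lambda>k. (of_nat n + of_real (X k)) powr z) \<longlonglongrightarrow> (of_nat n powr z :: complex)"
proof (cases "n = 0")
  case True
  have "(\<lambda>k. X k powr Re z) \<longlonglongrightarrow> 0 powr Re z"
    using assms by (intro tendsto_powr' tendsto_const) (auto intro: always_eventually less_imp_le)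
  moreover have "norm (of_real (X k) powr z) = X k powr Re z" for k
    using assms(3)[of k] by (simp add: norm_powr_real_powr)
  ultimately have "(\<lambda>k. norm (of_real (X k) powr z)) \<longlonglongrightarrow> 0" by simp
  hence "(\<lambda>k. of_real (X k) powr z) \<longlonglongrightarrow> 0" by (rule tendsto_norm_zero_cancel)
  thus ?thesis using True by simp
next
  case False
  have "(\<lambda>k. (of_nat n + of_real (X k)) powr z) \<longlonglongrightarrow> (of_nat n + of_real 0) powr z"
    using assms False by (intro tendsto_intros) (auto simp: complex_nonpos_Reals_iff)
  thus ?thesis by simp
qed

lemma strip_bound_shifted_powr:
  assumes "-1 < Re s" "Re s < 0" "0 < \<epsilon>" "\<epsilon> < 1"
  shows "strip_bound (real n) (real n + 1) (1/2) (\<lambda>z. (z + of_real \<epsilon>) powr (-s))"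
proof (rule strip_bound_power_growth)
  fix x y :: real assume xy: "real n \<le> x" "x \<le> real n + 1" "0 \<le> \<bar>y\<bar>"
  define z where "z = Complex x y + of_real \<epsilon>"
  have z0: "norm z > 0" using xy assms by (auto simp: z_def complex_eq_iff)
  have nz: "norm z \<le> (real n + 2) * (1 + \<bar>y\<bar>)"
  proof -
    have "norm z \<le> \<bar>x + \<epsilon>\<bar> + \<bar>y\<bar>" using cmod_le[of z] by (simp add: z_def)
    also have "\<dots> \<le> (real n + 2) + \<bar>y\<bar>" using xy assms by auto
    also have "\<dots> \<le> (real n + 2) * (1 + \<bar>y\<bar>)" by (simp add: algebra_simps)
    finally show ?thesis .
  qed
  have "norm (z powr (-s)) = norm z powr (- Re s) * exp (Im s * Arg z)" by (simp add: norm_powr_complex)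
  also have "\<dots> \<le> (1 + norm z) * exp (\<bar>Im s\<bar> * pi)"
  proof (intro mult_mono)
    show "norm z powr (- Re s) \<le> 1 + norm z"
    proof (cases "norm z \<le> 1")
      case True
      hence "norm z powr (- Re s) \<le> 1" using assms z0 by (intro powr_le1) auto
      thus ?thesis using z0 by linarith
    next
      case False
      hence "norm z powr (- Re s) \<le> norm z powr 1" using assms by (intro powr_mono) auto
      thus ?thesis using z0 by simp
    qed
    have "Im s * Arg z \<le> \<bar>Im s\<bar> * \<bar>Arg z\<bar>" by (simp flip: abs_mult)
    also have "\<dots> \<le> \<bar>Im s\<bar> * pi" using mpi_less_Arg[of z] Arg_le_pi[of z] by (intro mult_left_mono) auto
    finally show "exp (Im s * Arg z) \<le> exp (\<bar>Im s\<bar> * pi)" by simp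
  qed (use z0 in auto)
  also have "1 + norm z \<le> (real n + 3) * (1 + \<bar>y\<bar>)" using nz by (simp add: algebra_simps)
  finally show "norm ((Complex x y + of_real \<epsilon>) powr (-s)) \<le> ((real n + 3) * exp (\<bar>Im s\<bar> * pi)) * (1 + \<bar>y\<bar>) ^ 1"
    by (simp add: z_def mult_ac mult_right_mono)
qed auto

lemma shifted_powr_sum_near_integral:
  assumes s: "-1 < Re s" "Re s < 0" and \<epsilon>: "0 < \<epsilon>" "\<epsilon> < 1" and N: "N > 0"
  shows "norm ((\<Sum>n<N. ((of_nat n + of_real \<epsilon>) powr (-s) + (of_nat (Suc n) + of_real \<epsilon>) powr (-s)) / 2)
           - ((of_nat N + of_real \<epsilon>) powr (1 - s) - of_real \<epsilon> powr (1 - s)) / (1 - s) 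
           - \<i> * (LBINT y:{0<..}. Plana_diff s \<epsilon> y))
         \<le> 16 * norm s * exp (pi * norm s) * real N powr (- Re s - 1) * (LBINT y:{0<..}. exp (- pi * y))"
proof -
  define f where "f = (\<lambda>z. (z + of_real \<epsilon>) powr (-s))"
  have hol: "f holomorphic_on {z. - (\<epsilon> / 2) < Re z}" unfolding f_def
    by (intro holomorphic_intros) (use \<epsilon> in \<open>auto simp: complex_nonpos_Reals_iff\<close>)
  have V: "(vertical_diff f 0 y - vertical_diff f N y) / of_real (exp (2 * pi * y) - 1) = Plana_diff s \<epsilon> y - Plana_diff s (real N + \<epsilon>) y" for y
  proof -
    have "Complex x y + of_real \<epsilon> = Complex (x + \<epsilon>) y" for x y by (simp add: complex_eq_iff)
    thus ?thesis by (simp add: vertical_diff_def f_def Plana_diff_def diff_divide_distrib)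
  qed
  note i0 = set_integrable_Plana_diff[OF s, of \<epsilon>] and iN = set_integrable_Plana_diff[OF s, of "real N + \<epsilon>"]
  have AP: "((\<lambda>x. f (of_real x)) has_integral ((\<Sum>n<N. (f (of_nat n) + f (of_nat (Suc n))) / 2) - 
       \<i> * (LBINT y:{0<..}. Plana_diff s \<epsilon> y - Plana_diff s (real N + \<epsilon>) y))) {0..real N}"
  proof -
    have bdf: "strip_bound (real n) (real n + 1) (1/2) f" for n
      unfolding f_def by (rule strip_bound_shifted_powr[OF s \<epsilon>])
    have "0 < \<epsilon> / 2" "\<epsilon> / 2 < 1" using \<epsilon> by auto
    from Abel_Plana_finite[OF this hol bdf, of N] show ?thesis unfolding V by blast
  qed
  have s1: "s \<noteq> 1" "1 - s \<noteq> 0" using s by auto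
  have "((\<lambda>x. f (of_real x)) has_integral ((of_real (real N) + of_real \<epsilon>) powr (1 - s) / (1 - s) - (of_real 0 + of_real \<epsilon>) powr (1 - s) / (1 - s))) {0..real N}"
  proof (rule fundamental_theorem_of_calculus)
    fix x assume x: "x \<in> {0..real N}"
    have "((\<lambda>z. (z + of_real \<epsilon>) powr (1 - s) / (1 - s)) has_field_derivative f (of_real x)) (at (of_real x))"
      unfolding f_def using x \<epsilon> s1 by (auto intro!: derivative_eq_intros simp: complex_nonpos_Reals_iff)
    thus "((\<lambda>x. (of_real x + of_real \<epsilon>) powr (1 - s) / (1 - s)) has_vector_derivative f (of_real x)) (at x within {0..real N})"
      by (rule has_vector_derivative_real_field)
  qed auto
  from has_integral_unique[OF AP this]
  have "(\<Sum>n<N. (f (of_nat n) + f (of_nat (Suc n))) / 2) - ((of_nat N + of_real \<epsilon>) powr (1 - s) - of_real \<epsilon> powr (1 - s)) / (1 - s) =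
     \<i> * (LBINT y:{0<..}. Plana_diff s \<epsilon> y - Plana_diff s (real N + \<epsilon>) y)"
    by (simp add: diff_divide_distrib algebra_simps)
  also have "\<dots> = \<i> * (LBINT y:{0<..}. Plana_diff s \<epsilon> y) - \<i> * (LBINT y:{0<..}. Plana_diff s (real N + \<epsilon>) y)"
    using i0 iN \<epsilon> by (subst set_integral_diff(2)) (auto simp: right_diff_distrib)
  finally have eq: "(\<Sum>n<N. (f (of_nat n) + f (of_nat (Suc n))) / 2) - ((of_nat N + of_real \<epsilon>) powr (1 - s) - of_real \<epsilon> powr (1 - s)) / (1 - s)
      - \<i> * (LBINT y:{0<..}. Plana_diff s \<epsilon> y) = - \<i> * (LBINT y:{0<..}. Plana_diff s (real N + \<epsilon>) y)" by simp
  have "norm (- \<i> * (LBINT y:{0<..}. Plana_diff s (real N + \<epsilon>) y)) = norm (LBINT y:{0<..}. Plana_diff s (real N + \<epsilon>) y)"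
    by (simp add: norm_mult)
  also have "\<dots> \<le> (LBINT y:{0<..}. norm (Plana_diff s (real N + \<epsilon>) y))"
    using iN \<epsilon> by (intro set_integral_norm_bound) auto
  also have "\<dots> \<le> (LBINT y:{0<..}. 16 * norm s * exp (pi * norm s) * real N powr (- Re s - 1) * exp (- pi * y))"
  proof (rule set_integral_mono)
    show "set_integrable lborel {0<..} (\<lambda>y. norm (Plana_diff s (real N + \<epsilon>) y))"
      using iN \<epsilon> by (intro set_integrable_norm) auto
    have "set_integrable lborel {0<..} (\<lambda>y::real. exp (- pi * y))"
    proof -
      have "set_integrable lborel {0<..} (\<lambda>t::real. t powr (1 - 1) * exp (- pi * t)) \<longleftrightarrow> set_integrable lborel {0<..} (\<lambda>t::real. exp (- pi * t))"
        by (intro set_integrable_cong) auto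
      thus ?thesis using integrable_powr_exp[of 1 pi] by simp
    qed
    thus "set_integrable lborel {0<..} (\<lambda>y. 16 * norm s * exp (pi * norm s) * real N powr (- Re s - 1) * exp (- pi * y))"
      by (intro set_integrable_mult_right) auto
    fix y :: real assume y: "y \<in> {0<..}"
    have "real N \<le> norm (Complex (real N + \<epsilon>) y)" using abs_Re_le_cmod[of "Complex (real N + \<epsilon>) y"] \<epsilon> by simp
    thus "norm (Plana_diff s (real N + \<epsilon>) y) \<le> 16 * norm s * exp (pi * norm s) * real N powr (- Re s - 1) * exp (- pi * y)"
      using y N \<epsilon> by (intro norm_Plana_diff_le s) auto
  qed
  also have "\<dots> = 16 * norm s * exp (pi * norm s) * real N powr (- Re s - 1) * (LBINT y:{0<..}. exp (- pi * y))"
    by (rule set_integral_mult_right)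
  finally show ?thesis unfolding f_def[symmetric] using eq by (simp add: f_def)
qed

lemma Plana_diff_tendsto:
  assumes s: "-1 < Re s" "Re s < 0" and X: "X \<longlonglongrightarrow> 0" "\<And>k. X k > 0"
  shows "(\<lambda>k. LBINT y:{0<..}. Plana_diff s (X k) y) \<longlonglongrightarrow> (LBINT y:{0<..}. Plana_diff s 0 y)"
  unfolding set_lebesgue_integral_def
proof (rule integral_dominated_convergence)
  have "set_integrable lborel {0<..} (\<lambda>t::real. (16 * norm s * exp (pi * norm s)) * (t powr (- Re s - 1) * exp (- pi * t)))"
    using integrable_powr_exp[of "- Re s" pi] s by (intro set_integrable_mult_right) auto
  thus "integrable lborel (\<lambda>t::real. indicator {0<..} t *\<^sub>R ((16 * norm s * exp (pi * norm s)) * (t powr (- Re s - 1) * exp (- pi * t))))"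
    by (simp add: set_integrable_def)
  show "AE y in lborel. norm (indicator {0<..} y *\<^sub>R Plana_diff s (X k) y) \<le> indicator {0<..} y *\<^sub>R ((16 * norm s * exp (pi * norm s)) * (y powr (- Re s - 1) * exp (- pi * y)))" for k
    using norm_Plana_diff_le_self[OF s less_imp_le[OF X(2)[of k]]]
    by (intro AE_I2) (auto simp: indicator_def)
  show "AE y in lborel. (\<lambda>k. indicator {0<..} y *\<^sub>R Plana_diff s (X k) y) \<longlonglongrightarrow> indicator {0<..} y *\<^sub>R Plana_diff s 0 y"
  proof (intro AE_I2)
    fix y :: real
    show "(\<lambda>k. indicator {0<..} y *\<^sub>R Plana_diff s (X k) y) \<longlonglongrightarrow> indicator {0<..} y *\<^sub>R Plana_diff s 0 y"
    proof (cases "y > 0")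
      case True
      have "(\<lambda>k. ((of_real (X k) + \<i> * of_real y) powr (-s) - (of_real (X k) + \<i> * of_real (- y)) powr (-s)) / of_real (exp (2 * pi * y) - 1)) \<longlonglongrightarrow>
        ((of_real 0 + \<i> * of_real y) powr (-s) - (of_real 0 + \<i> * of_real (- y)) powr (-s)) / of_real (exp (2 * pi * y) - 1)"
        using True by (intro tendsto_intros X(1)) (auto simp: complex_nonpos_Reals_iff)
      thus ?thesis using True by (simp add: Plana_diff_def Complex_eq)
    qed auto
  qed
qed (rule Plana_diff_measurable)+

text \<open>The Abel-Plana formula for \<open>z^(-s)\<close> would have to start at the branch point 0. It is applied to
\<open>(z + \<epsilon>)^(-s)\<close> instead, with a bound uniform in \<open>\<epsilon>\<close>, and \<open>\<epsilon>\<close> tends to 0 while the number of terms grows. For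
\<open>-1 < Re s < 0\<close> the boundary terms vanish at both ends.\<close>

lemma zeta_cont_integral:
  assumes s: "-1 < Re s" "Re s < 0"
  shows "zeta_cont s = \<i> * (LBINT y:{0<..}. Plana_diff s 0 y)"
proof -
  define K where "K = 16 * norm s * exp (pi * norm s) * (LBINT y:{0<..}. exp (- pi * y))"
  define X where "X = (\<lambda>k. 1 / (real k + 2))"
  have X: "X \<longlonglongrightarrow> 0" "\<And>k. X k > 0" "\<And>k. X k < 1" unfolding X_def by real_asymp auto
  define A where "A = (\<lambda>N. (\<Sum>n<N. of_nat (Suc n) powr (-s)) + of_nat (Suc N) powr (-s) / 2 - of_nat (Suc N) powr (1 - s) / (1 - s))"
  have s1: "s \<noteq> 1" "1 - s \<noteq> 0" "s \<noteq> 0" using s by auto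
  have bound: "norm (A N - \<i> * (LBINT y:{0<..}. Plana_diff s 0 y)) \<le> K * real (Suc N) powr (- Re s - 1)" for N
  proof -
    have "(\<lambda>k. norm ((\<Sum>n<Suc N. ((of_nat n + of_real (X k)) powr (-s) + (of_nat (Suc n) + of_real (X k)) powr (-s)) / 2)
           - ((of_nat (Suc N) + of_real (X k)) powr (1 - s) - (of_nat 0 + of_real (X k)) powr (1 - s)) / (1 - s) 
           - \<i> * (LBINT y:{0<..}. Plana_diff s (X k) y))) \<longlonglongrightarrow>
        norm ((\<Sum>n<Suc N. (of_nat n powr (-s) + of_nat (Suc n) powr (-s)) / 2)
           - (of_nat (Suc N) powr (1 - s) - of_nat 0 powr (1 - s)) / (1 - s) 
           - \<i> * (LBINT y:{0<..}. Plana_diff s 0 y))"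
      using s s1 X by (intro tendsto_norm tendsto_diff tendsto_sum tendsto_divide tendsto_add tendsto_mult tendsto_const
         tendsto_nat_shift_powr Plana_diff_tendsto) auto
    moreover have "(\<Sum>n<Suc N. (of_nat n powr (-s) + of_nat (Suc n) powr (-s)) / 2) = (\<Sum>n<N. of_nat (Suc n) powr (-s)) + of_nat (Suc N) powr (-s) / 2"
      by (induction N) (simp_all add: add_divide_distrib s1)
    ultimately have "(\<lambda>k. norm ((\<Sum>n<Suc N. ((of_nat n + of_real (X k)) powr (-s) + (of_nat (Suc n) + of_real (X k)) powr (-s)) / 2)
           - ((of_nat (Suc N) + of_real (X k)) powr (1 - s) - (of_nat 0 + of_real (X k)) powr (1 - s)) / (1 - s) 
           - \<i> * (LBINT y:{0<..}. Plana_diff s (X k) y))) \<longlonglongrightarrow> norm (A N - \<i> * (LBINT y:{0<..}. Plana_diff s 0 y))"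
      using s1 by (simp only: A_def) simp
    thus ?thesis
    proof (rule LIMSEQ_le_const2)
      show "\<exists>N0. \<forall>k\<ge>N0. norm ((\<Sum>n<Suc N. ((of_nat n + of_real (X k)) powr (-s) + (of_nat (Suc n) + of_real (X k)) powr (-s)) / 2)
           - ((of_nat (Suc N) + of_real (X k)) powr (1 - s) - (of_nat 0 + of_real (X k)) powr (1 - s)) / (1 - s) 
           - \<i> * (LBINT y:{0<..}. Plana_diff s (X k) y)) \<le> K * real (Suc N) powr (- Re s - 1)"
        using shifted_powr_sum_near_integral[OF s X(2) X(3), of "Suc N"] by (auto simp: K_def mult_ac)
    qed
  qed
  have "(\<lambda>N. real (Suc N) powr (- Re s - 1)) \<longlonglongrightarrow> 0"
  proof -
    define c where "c = Re s + 1"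
    have "c > 0" using s by (simp add: c_def)
    hence "(\<lambda>N. real (Suc N) powr (- c)) \<longlonglongrightarrow> 0" by real_asymp
    thus ?thesis by (simp add: c_def)
  qed
  hence K0: "(\<lambda>N. K * real (Suc N) powr (- Re s - 1)) \<longlonglongrightarrow> 0" by (rule tendsto_mult_right_zero)
  have "(\<lambda>N. A N - \<i> * (LBINT y:{0<..}. Plana_diff s 0 y)) \<longlonglongrightarrow> 0"
    by (rule Lim_null_comparison[OF always_eventually[OF allI[OF bound]] K0])
  hence "A \<longlonglongrightarrow> \<i> * (LBINT y:{0<..}. Plana_diff s 0 y)" by (subst (asm) LIM_zero_iff)
  moreover have "A \<longlonglongrightarrow> zeta_cont s" unfolding A_def using s s1 by (intro zeta_cont_lim) auto
  ultimately show ?thesis by (rule LIMSEQ_unique[rotated])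
qed

section \<open>The functional equation of the zeta function\<close>

lemma Plana_diff_0:
  assumes y: "y > 0"
  shows "Plana_diff s 0 y = - 2 * \<i> * sin (of_real (pi / 2) * s) * (of_real y powr (-s) / of_real (exp (2 * pi * y) - 1))"
proof -
  have l1: "Ln (Complex 0 y) = Complex (ln y) (pi / 2)"
  proof -
    have "Complex 0 y = exp (Complex (ln y) (pi / 2))" using y by (simp add: exp_eq_polar complex_eq_iff)
    thus ?thesis by (simp add: Ln_exp)
  qed
  have l2: "Ln (Complex 0 (- y)) = Complex (ln y) (- pi / 2)"
  proof -
    have "Complex 0 (- y) = exp (Complex (ln y) (- pi / 2))" using y by (simp add: exp_eq_polar complex_eq_iff)
    moreover have "- pi < Im (Complex (ln y) (- pi / 2))" "Im (Complex (ln y) (- pi / 2)) \<le> pi"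
      using pi_gt_zero by (simp_all add: field_simps)
    ultimately show ?thesis by (simp only: Ln_exp)
  qed
  have nz: "Complex 0 y \<noteq> 0" "Complex 0 (- y) \<noteq> 0" "complex_of_real y \<noteq> 0" using y by (auto simp: complex_eq_iff)
  note l1 = l1[unfolded Complex_eq[of "ln y"]] and l2 = l2[unfolded Complex_eq[of "ln y"]]
  have e1: "Complex 0 y powr (-s) = of_real y powr (-s) * exp (- (\<i> * (of_real (pi / 2) * s)))"
    using nz y by (simp add: powr_def l1 Ln_of_real algebra_simps flip: exp_add)
  have e2: "Complex 0 (- y) powr (-s) = of_real y powr (-s) * exp (\<i> * (of_real (pi / 2) * s))"
    using nz y by (simp add: powr_def l2 Ln_of_real algebra_simps flip: exp_add)
  have "sin (of_real (pi / 2) * s) * (2 * \<i>) = exp (\<i> * (of_real (pi / 2) * s)) - exp (- (\<i> * (of_real (pi / 2) * s)))"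
    unfolding sin_exp_eq by (subst times_divide_eq_left, rule nonzero_mult_div_cancel_right) simp
  hence "exp (- (\<i> * (of_real (pi / 2) * s))) - exp (\<i> * (of_real (pi / 2) * s)) = - 2 * \<i> * sin (of_real (pi / 2) * s)"
    by (simp add: algebra_simps)
  hence "Complex 0 y powr (-s) - Complex 0 (- y) powr (-s) = of_real y powr (-s) * (- 2 * \<i> * sin (of_real (pi / 2) * s))"
    unfolding e1 e2 by (simp only: flip: right_diff_distrib)
  thus ?thesis unfolding Plana_diff_def by (simp only:) (simp add: mult_ac)
qed

text \<open>Expanding \<open>1 / (exp (2 \<pi> y) - 1)\<close> into a geometric series and integrating termwise gives Euler integrals, whose sum is
the Dirichlet series at \<open>1 - s\<close>.\<close>

lemma integral_powr_over_exp_minus_1: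
  assumes s: "Re s < 0"
  shows "(LBINT y:{0<..}. of_real y powr (-s) / of_real (exp (2 * pi * y) - 1)) =
           of_real (2 * pi) powr (s - 1) * Gamma (1 - s) * zeta_cont (1 - s)"
proof -
  define F where "F = (\<lambda>k y. indicator {0<..} y *\<^sub>R (of_real y powr (-s) * of_real (exp (- (2 * pi * real (Suc k)) * y))) :: complex)"
  have G1: "set_integrable lborel {0<..} (\<lambda>t. of_real t powr (1 - s - 1) * of_real (exp (- a * t)))"
     and G2: "(LBINT t:{0<..}. of_real t powr (1 - s - 1) * of_real (exp (- a * t))) = Gamma (1 - s) * of_real a powr (- (1 - s))" if "a > 0" for a
    using Gamma_integral_scaled[of "1 - s" a] that s by auto
  have R1: "set_integrable lborel {0<..} (\<lambda>t. of_real t powr (of_real (1 - Re s) - 1) * of_real (exp (- a * t)) :: complex)"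
     and R2: "(LBINT t:{0<..}. of_real t powr (of_real (1 - Re s) - 1) * of_real (exp (- a * t))) = Gamma (of_real (1 - Re s)) * of_real a powr (- of_real (1 - Re s) :: complex)" if "a > 0" for a
    using Gamma_integral_scaled[of "of_real (1 - Re s)" a] that s by auto
  have intF: "integrable lborel (F k)" for k
    using G1[of "2 * pi * real (Suc k)"] by (simp add: F_def set_integrable_def)
  have valF: "(LINT y|lborel. F k y) = Gamma (1 - s) * (of_real (2 * pi) powr (s - 1) * (1 / of_nat (Suc k) powr (1 - s)))" for k
  proof -
    have "(LINT y|lborel. F k y) = Gamma (1 - s) * of_real (2 * pi * real (Suc k)) powr (- (1 - s))"
      using G2[of "2 * pi * real (Suc k)"] by (simp add: F_def set_lebesgue_integral_def)
    also have "complex_of_real (2 * pi * real (Suc k)) powr (- (1 - s)) = of_real (2 * pi) powr (- (1 - s)) * of_real (real (Suc k)) powr (- (1 - s))"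
      by (simp only: of_real_mult) (rule powr_times_real, auto)
    also have "of_real (real (Suc k)) powr (- (1 - s)) = (1 / of_nat (Suc k) powr (1 - s) :: complex)"
      by (subst powr_minus) (simp add: divide_inverse)
    also have "- (1 - s) = s - 1" by simp
    finally show ?thesis .
  qed
  have normF: "norm (F k y) = indicator {0<..} y *\<^sub>R (y powr (- Re s) * exp (- (2 * pi * real (Suc k)) * y))" for k y
    by (simp add: F_def norm_mult norm_powr_real_powr indicator_def)
  have "(LINT y|lborel. norm (F k y)) = Gamma (1 - Re s) * (2 * pi * real (Suc k)) powr (Re s - 1)" for k
  proof -
    have "complex_of_real (LINT y|lborel. norm (F k y)) = (LINT y|lborel. complex_of_real (norm (F k y)))"
      by (rule integral_complex_of_real[symmetric])
    also have "\<dots> = (LBINT t:{0<..}. of_real t powr (of_real (1 - Re s) - 1) * of_real (exp (- (2 * pi * real (Suc k)) * t)))"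
      unfolding set_lebesgue_integral_def normF
    proof (rule Bochner_Integration.integral_cong)
      fix t :: real
      show "complex_of_real (indicat_real {0<..} t *\<^sub>R (t powr - Re s * exp (- (2 * pi * real (Suc k)) * t))) =
           indicat_real {0<..} t *\<^sub>R (of_real t powr (of_real (1 - Re s) - 1) * of_real (exp (- (2 * pi * real (Suc k)) * t)))"
      proof (cases "t > 0")
        case True
        have "complex_of_real t powr (of_real (1 - Re s) - 1) = of_real (t powr (- Re s))"
          using True powr_of_real[of t "- Re s"] by simp
        thus ?thesis by (simp add: scaleR_conv_of_real)
      qed auto
    qed auto
    also have "\<dots> = Gamma (of_real (1 - Re s)) * of_real (2 * pi * real (Suc k)) powr (- of_real (1 - Re s))"
      by (rule R2) auto
    also have "of_real (2 * pi * real (Suc k)) powr (- of_real (1 - Re s)) = complex_of_real ((2 * pi * real (Suc k)) powr (Re s - 1))"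
      using powr_of_real[of "2 * pi * real (Suc k)" "Re s - 1"] by simp
    also have "Gamma (complex_of_real (1 - Re s)) * \<dots> = complex_of_real (Gamma (1 - Re s) * (2 * pi * real (Suc k)) powr (Re s - 1))"
      by (simp only: Gamma_complex_of_real of_real_mult)
    finally show ?thesis by (simp only: of_real_eq_iff)
  qed
  moreover have "summable (\<lambda>k. Gamma (1 - Re s) * (2 * pi * real (Suc k)) powr (Re s - 1))"
  proof -
    have "summable (\<lambda>k. Gamma (1 - Re s) * (2 * pi) powr (Re s - 1) * real (Suc k) powr (- (1 - Re s)))"
      using s by (intro summable_mult summable_powr_neg) auto
    moreover have "Gamma (1 - Re s) * (2 * pi * real (Suc k)) powr (Re s - 1) =
        Gamma (1 - Re s) * (2 * pi) powr (Re s - 1) * real (Suc k) powr (- (1 - Re s))" for k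
      by (simp only: powr_mult mult.assoc) simp
    ultimately show ?thesis by (simp only:)
  qed
  ultimately have sm: "summable (\<lambda>k. LINT y|lborel. norm (F k y))" by simp
  have geo: "(\<lambda>k. F k y) sums (indicator {0<..} y *\<^sub>R (of_real y powr (-s) / of_real (exp (2 * pi * y) - 1)))"
     and geosum: "summable (\<lambda>k. norm (F k y))" for y
  proof -
    define x where "x = exp (- (2 * pi * y))"
    have xk: "exp (- (2 * pi * real (Suc k)) * y) = x * x ^ k" for k
      by (simp add: x_def exp_of_nat_mult[symmetric] algebra_simps flip: exp_add)
    show "(\<lambda>k. F k y) sums (indicator {0<..} y *\<^sub>R (of_real y powr (-s) / of_real (exp (2 * pi * y) - 1)))"
    proof (cases "y > 0")
      case True
      hence x: "0 < x" "x < 1" by (auto simp: x_def)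
      have "(\<lambda>k. x * x ^ k) sums (x * (1 / (1 - x)))" using x by (intro sums_mult geometric_sums) auto
      also have "x * (1 / (1 - x)) = 1 / (exp (2 * pi * y) - 1)"
      proof -
        have "exp (2 * pi * y) = 1 / x" by (simp add: x_def exp_minus divide_inverse)
        moreover have "1 / x - 1 = (1 - x) / x" using x by (simp add: field_simps)
        ultimately show ?thesis by (simp only:) simp
      qed
      finally have "(\<lambda>k. of_real y powr (-s) * complex_of_real (x * x ^ k)) sums (of_real y powr (-s) * complex_of_real (1 / (exp (2 * pi * y) - 1)))"
        by (intro sums_mult sums_of_real)
      thus ?thesis using True unfolding F_def xk by simp
    next
      case False
      thus ?thesis by (simp add: F_def)
    qed
    show "summable (\<lambda>k. norm (F k y))"
    proof (cases "y > 0")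
      case True
      hence x: "0 < x" "x < 1" by (auto simp: x_def)
      have "summable (\<lambda>k. y powr (- Re s) * x * x ^ k)" using x by (intro summable_mult summable_geometric) auto
      thus ?thesis using True unfolding normF xk by (simp add: mult_ac)
    next
      case False
      thus ?thesis by (simp add: F_def)
    qed
  qed
  have "(\<lambda>k. LINT y|lborel. F k y) sums (LINT y|lborel. (\<Sum>k. F k y))"
    using intF geosum sm by (intro sums_integral) auto
  also have "(\<lambda>y. \<Sum>k. F k y) = (\<lambda>y. indicator {0<..} y *\<^sub>R (of_real y powr (-s) / of_real (exp (2 * pi * y) - 1)))"
    using geo by (auto simp: sums_iff)
  finally have "(\<lambda>k. LINT y|lborel. F k y) sums (LBINT y:{0<..}. of_real y powr (-s) / of_real (exp (2 * pi * y) - 1))"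
    by (simp add: set_lebesgue_integral_def)
  moreover have "(\<lambda>k. LINT y|lborel. F k y) sums (Gamma (1 - s) * (of_real (2 * pi) powr (s - 1) * zeta_cont (1 - s)))"
    unfolding valF using s by (intro sums_mult zeta_cont_sums) auto
  ultimately have "(LBINT y:{0<..}. of_real y powr (-s) / of_real (exp (2 * pi * y) - 1)) = Gamma (1 - s) * (of_real (2 * pi) powr (s - 1) * zeta_cont (1 - s))"
    by (rule sums_unique2)
  thus ?thesis by (simp add: mult_ac)
qed

definition zeta_reflected :: "complex \<Rightarrow> complex" where
  "zeta_reflected s = 2 * sin (of_real (pi / 2) * s) * (of_real (2 * pi) powr (s - 1) * Gamma (1 - s) * zeta_cont (1 - s))"

lemma zeta_cont_functional:
  assumes s: "-1 < Re s" "Re s < 0"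
  shows "zeta_cont s = zeta_reflected s"
proof -
  have "(LBINT y:{0<..}. Plana_diff s 0 y) = (LBINT y:{0<..}. - 2 * \<i> * sin (of_real (pi / 2) * s) * (of_real y powr (-s) / of_real (exp (2 * pi * y) - 1)))"
    by (intro set_lebesgue_integral_cong) (auto simp: Plana_diff_0 simp del: of_real_diff)
  also have "\<dots> = - 2 * \<i> * sin (of_real (pi / 2) * s) * (LBINT y:{0<..}. of_real y powr (-s) / of_real (exp (2 * pi * y) - 1))"
    by (rule set_integral_mult_right)
  finally show ?thesis
    unfolding zeta_cont_integral[OF s] zeta_reflected_def integral_powr_over_exp_minus_1[OF s(2)] by (simp add: mult_ac)
qed

text \<open>The two formulas agree on the strip \<open>-1 < Re s < 0\<close>, so that this is holomorphic across the line where the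
definition changes.\<close>

definition zeta_ext :: "complex \<Rightarrow> complex" where
  "zeta_ext s = (if Re s > -1 then zeta_cont s else zeta_reflected s)"

lemma is_zeta_zeta_ext: "is_zeta zeta_ext"
proof -
  have "zeta_cont holomorphic_on {s. Re s > -1} - {1}" by (rule zeta_cont_holomorphic)
  hence 1: "zeta_ext holomorphic_on {s. Re s > -1} - {1}"
    by (rule holomorphic_transform) (auto simp: zeta_ext_def)
  have "zeta_reflected holomorphic_on {s. Re s < 0}"
    unfolding zeta_reflected_def[abs_def]
    by (intro holomorphic_intros holomorphic_on_compose_gen[OF _ zeta_cont_holomorphic, unfolded o_def])
       (auto elim!: nonpos_Ints_cases simp: complex_eq_iff)
  hence 2: "zeta_ext holomorphic_on {s. Re s < 0}"
    by (rule holomorphic_transform) (auto simp: zeta_ext_def zeta_cont_functional)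
  have "open ({s. Re s > -1} - {1::complex})" by (intro open_Diff open_halfspace_Re_gt) auto
  hence "zeta_ext holomorphic_on ({s. Re s > -1} - {1}) \<union> {s. Re s < 0}"
    using 1 2 open_halfspace_Re_lt[of 0] by (intro holomorphic_on_Un) auto
  also have "({s. Re s > -1} - {1}) \<union> {s. Re s < 0} = - {1::complex}"
    by (auto simp: complex_eq_iff)
  finally have "zeta_ext holomorphic_on - {1}" .
  moreover have "\<forall>s. Re s > 1 \<longrightarrow> (\<lambda>n. 1 / of_nat (Suc n) powr s) sums zeta_ext s"
    using zeta_cont_sums by (auto simp: zeta_ext_def)
  ultimately show ?thesis unfolding is_zeta_def by blast
qed

lemma is_zeta_zeta: "is_zeta zeta"
  unfolding zeta_def by (rule someI[of is_zeta]) (rule is_zeta_zeta_ext)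

lemma zeta_holomorphic: "A \<subseteq> - {1} \<Longrightarrow> zeta holomorphic_on A"
  using is_zeta_zeta holomorphic_on_subset unfolding is_zeta_def by blast

lemma zeta_sums: "Re s > 1 \<Longrightarrow> (\<lambda>n. 1 / of_nat (Suc n) powr s) sums zeta s"
  using is_zeta_zeta unfolding is_zeta_def by blast

lemma zeta_eq_zeta_cont: "s \<noteq> 1 \<Longrightarrow> Re s > -1 \<Longrightarrow> zeta s = zeta_cont s"
  using zeta_eqI[OF is_zeta_zeta_ext] by (simp add: zeta_ext_def)

text \<open>For \<open>-1 < Re s < 0\<close> the difference of the two powers in the Plana integral along the imaginary axis is a multiple of
\<open>sin (\<pi> s / 2) y^(-s)\<close>; the general case follows because \<open>\<zeta>\<close> is determined by its Dirichlet series.\<close>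

theorem zeta_functional_equation:
  assumes "Re s < 0"
  shows "zeta s = 2 * sin (of_real (pi / 2) * s) * (of_real (2 * pi) powr (s - 1) * Gamma (1 - s) * zeta (1 - s))"
proof -
  have "zeta s = zeta_reflected s"
  proof -
    have "s \<noteq> 1" using assms by auto
    thus ?thesis using zeta_eqI[OF is_zeta_zeta_ext, of s] zeta_cont_functional[of s] assms by (auto simp: zeta_ext_def)
  qed
  moreover have "zeta (1 - s) = zeta_cont (1 - s)" using assms by (intro zeta_eq_zeta_cont) auto
  ultimately show ?thesis by (simp add: zeta_reflected_def)
qed

lemma zeta_pole: "((\<lambda>s. (s - 1) * zeta s) \<longlongrightarrow> 1) (at 1)"
proof (rule Lim_transform_eventually[OF zeta_cont_residue_lim])
  have "eventually (\<lambda>s. s \<in> {s. Re s > 0} - {1}) (at (1::complex))"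
    using open_halfspace_Re_gt[of 0] by (intro eventually_at_in_open) auto
  thus "eventually (\<lambda>s. (s - 1) * zeta_cont s = (s - 1) * zeta s) (at 1)"
    by eventually_elim (simp add: zeta_eq_zeta_cont)
qed

lemma strip_bound_zeta:
  assumes e: "\<epsilon> > 0"
  shows "strip_bound a b \<epsilon> zeta"
proof -
  have R: "strip_bound (-1/2) b \<epsilon> zeta" for b
    using strip_bound_zeta_cont[OF e]
  proof (rule strip_bound_cong)
    fix x y :: real assume xy: "-1/2 \<le> x" "y \<noteq> 0"
    have "Complex x y \<noteq> 1" "Re (Complex x y) > -1" using xy by (auto simp: complex_eq_iff)
    thus "zeta (Complex x y) = zeta_cont (Complex x y)" by (rule zeta_eq_zeta_cont)
  qed
  have L: "strip_bound a (-1/2) \<epsilon> zeta" for a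
  proof -
    have "strip_bound a (-1/2) (\<bar>pi/2\<bar> + (0 + (- ((pi - \<epsilon>) / 2) * \<bar>-1\<bar> + \<epsilon> / 2 * \<bar>-1\<bar>)))
       (\<lambda>s. sin (of_real (pi/2) * s) * ((2 * of_real (2 * pi) powr (s - 1)) * (Gamma (of_real 1 + of_real (-1) * s) * zeta_cont (of_real 1 + of_real (-1) * s))))"
    proof (intro strip_bound_mult strip_bound_sin)
      have "strip_bound a (-1/2) \<bar>Im (of_real (ln (2 * pi)))\<bar> (\<lambda>s. (2 * exp (- of_real (ln (2 * pi)))) * exp (of_real (ln (2 * pi)) * s))"
        by (intro strip_bound_cmult strip_bound_exp)
      moreover have "(2 * exp (- of_real (ln (2 * pi)))) * exp (of_real (ln (2 * pi)) * s) = 2 * of_real (2 * pi) powr (s - 1)" for s :: complex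
      proof -
        have "complex_of_real (2 * pi) powr (s - 1) = exp ((s - 1) * of_real (ln (2 * pi)))"
          by (subst powr_def) (simp add: Ln_of_real flip: of_real_mult del: of_real_mult)
        also have "\<dots> = exp (- of_real (ln (2 * pi))) * exp (of_real (ln (2 * pi)) * s)"
          by (simp add: algebra_simps flip: exp_add)
        finally show ?thesis by (simp only: mult.assoc)
      qed
      ultimately show "strip_bound a (-1/2) 0 (\<lambda>s. 2 * of_real (2 * pi) powr (s - 1))" by simp
      show "strip_bound a (-1/2) (- ((pi - \<epsilon>) / 2) * \<bar>-1\<bar>) (\<lambda>s. Gamma (of_real 1 + of_real (-1) * s))"
        using e by (intro strip_bound_affine[OF strip_bound_Gamma[where a = 1 and b = "1 - a"]]) (auto simp: field_simps)
      show "strip_bound a (-1/2) (\<epsilon> / 2 * \<bar>-1\<bar>) (\<lambda>s. zeta_cont (of_real 1 + of_real (-1) * s))"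
        using e by (intro strip_bound_affine[OF strip_bound_zeta_cont[where b = "1 - a"]]) (auto simp: field_simps)
    qed
    also have "\<bar>pi/2\<bar> + (0 + (- ((pi - \<epsilon>) / 2) * \<bar>-1\<bar> + \<epsilon> / 2 * \<bar>-1\<bar>)) = \<epsilon>" by (simp add: field_simps)
    finally show ?thesis
    proof (rule strip_bound_cong)
      fix x y :: real assume xy: "a \<le> x" "x \<le> -1/2" "y \<noteq> 0"
      have "Re (Complex x y) < 0" using xy by simp
      hence "zeta (1 - Complex x y) = zeta_cont (1 - Complex x y)" by (intro zeta_eq_zeta_cont) (auto simp: complex_eq_iff)
      thus "zeta (Complex x y) = sin (of_real (pi/2) * Complex x y) * ((2 * of_real (2 * pi) powr (Complex x y - 1)) * (Gamma (of_real 1 + of_real (-1) * Complex x y) * zeta_cont (of_real 1 + of_real (-1) * Complex x y)))"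
        using zeta_functional_equation[of "Complex x y"] xy by (simp add: mult_ac)
    qed
  qed
  show ?thesis by (rule strip_bound_union[OF L R])
qed

section \<open>Reduction of the series to a Mellin-Barnes integral\<close>

lemma line_integral_reflect: "line_integral c (\<lambda>s. F (- s)) = line_integral (- c) F"
proof -
  have "line_integral (- c) F = \<bar>-1\<bar> *\<^sub>R (LINT t|lborel. F (Complex (- c) (0 + (-1) * t)) * \<i>)"
    unfolding line_integral_def by (rule lborel_integral_real_affine) auto
  moreover have "Complex (- c) (0 + (-1) * t) = - Complex c t" for t by (simp add: complex_eq_iff)
  ultimately show ?thesis by (simp add: line_integral_def)
qed

lemma line_integral_cong:
  assumes "\<And>t. t \<noteq> 0 \<Longrightarrow> f (Complex \<sigma> t) = g (Complex \<sigma> t)"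
  shows "line_integral \<sigma> f = line_integral \<sigma> g"
  unfolding line_integral_def
  by (rule integral_discrete_difference[of "{0}"]) (use assms in auto)

lemma line_integral_cmult: "line_integral \<sigma> (\<lambda>s. c * f s) = c * line_integral \<sigma> f"
  by (simp add: line_integral_def mult.assoc)

lemma line_integral_add:
  assumes "integrable lborel (\<lambda>t. f (Complex \<sigma> t))" "integrable lborel (\<lambda>t. g (Complex \<sigma> t))"
  shows "line_integral \<sigma> (\<lambda>s. f s + g s) = line_integral \<sigma> f + line_integral \<sigma> g"
  using assms by (simp add: line_integral_def distrib_right)

lemma line_integral_sum:
  assumes "\<And>i. i \<in> A \<Longrightarrow> integrable lborel (\<lambda>t. f i (Complex \<sigma> t))"
  shows "line_integral \<sigma> (\<lambda>s. \<Sum>i\<in>A. f i s) = (\<Sum>i\<in>A. line_integral \<sigma> (f i))"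
  using assms by (simp add: line_integral_def sum_distrib_right)

definition dirichlet_kernel :: "nat \<Rightarrow> complex \<Rightarrow> complex" where
  "dirichlet_kernel l s = (\<Sum>r<l div 2. exp (pi * \<i> * of_real (real l - 2 * real r - 1) * s) +
      exp (- (pi * \<i> * of_real (real l - 2 * real r - 1) * s))) + (if odd l then 1 else 0)"

lemma exp_plus_exp_neg_mult_sin: "(exp (\<i> * u) + exp (- (\<i> * u))) * sin v = sin (u + v) - sin (u - v)" for u v :: complex
proof -
  have "exp (\<i> * u) + exp (- (\<i> * u)) = 2 * cos u" by (simp add: cos_exp_eq)
  thus ?thesis by (simp add: sin_add sin_diff)
qed

text \<open>Multiplication by \<open>sin (\<pi> s)\<close> telescopes the sum of exponentials. The recursion from \<open>l\<close> to \<open>l + 2\<close> adds the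
outermost pair.\<close>

lemma dirichlet_kernel_mult_sin: "dirichlet_kernel l s * sin (of_real pi * s) = sin (of_real (pi * real l) * s)"
proof (induction l rule: induct_nat_012)
  case 0
  show ?case by (simp add: dirichlet_kernel_def)
next
  case 1
  show ?case by (simp add: dirichlet_kernel_def)
next
  case (ge2 l)
  define u where "u = of_real (pi * (real l + 1)) * s"
  have "dirichlet_kernel (Suc (Suc l)) s = (exp (\<i> * u) + exp (- (\<i> * u))) + dirichlet_kernel l s"
    by (simp add: dirichlet_kernel_def sum.lessThan_Suc_shift u_def algebra_simps del: sum.lessThan_Suc)
  hence "dirichlet_kernel (Suc (Suc l)) s * sin (of_real pi * s) =
      (exp (\<i> * u) + exp (- (\<i> * u))) * sin (of_real pi * s) + dirichlet_kernel l s * sin (of_real pi * s)"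
    by (simp only: distrib_right[of "exp (\<i> * u) + exp (- (\<i> * u))"])
  hence "dirichlet_kernel (Suc (Suc l)) s * sin (of_real pi * s) = (sin (u + of_real pi * s) - sin (u - of_real pi * s)) + sin (of_real (pi * real l) * s)"
    by (simp only: exp_plus_exp_neg_mult_sin ge2(1))
  also have "u - of_real pi * s = of_real (pi * real l) * s" by (simp add: u_def algebra_simps)
  also have "u + of_real pi * s = of_real (pi * real (Suc (Suc l))) * s" by (simp add: u_def algebra_simps)
  finally show ?case by simp
qed

lemma N_par_even: "N_par (real (2 * l)) = l div 2"
proof -
  have "nearest_int (real (2 * l) / 4) = int (l div 2)"
  proof (cases "even l")
    case True
    then obtain k where k: "l = 2 * k" by blast
    show ?thesis unfolding nearest_int_eq_iff by (simp add: k)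
  next
    case False
    then obtain k where k: "l = 2 * k + 1" by (rule oddE)
    show ?thesis unfolding nearest_int_eq_iff by (simp add: k field_simps)
  qed
  thus ?thesis by (simp add: N_par_def)
qed

lemma not_nonpos_Ints_if_Re_pos: "Re z > 0 \<Longrightarrow> z \<notin> \<int>\<^sub>\<le>\<^sub>0"
  by (auto elim!: nonpos_Ints_cases)

text \<open>The power of \<open>\<chi>\<close> and the exponential of \<open>J\<close> are merged into one exponential with parameter \<open>L\<close>, a logarithm of
the rotated \<open>\<chi>\<close>. The rotation may leave the range of the principal logarithm, but not the strip
\<open>\<bar>Im L\<bar> < \<kappa> \<pi> / 2\<close> in which the line integrals converge.\<close>

definition ratio_exp :: "nat \<Rightarrow> real \<Rightarrow> complex \<Rightarrow> complex \<Rightarrow> complex" where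
  "ratio_exp p w L s = Gamma_ratio p w s * exp (- L * s)"

lemma strip_bound_ratio_exp:
  assumes "p > 0" "\<bar>Im L\<bar> < kappa p * (pi / 2)"
  shows "strip_bound a b ((\<bar>Im L\<bar> - kappa p * (pi / 2)) / 2) (ratio_exp p w L)"
proof -
  define d where "d = kappa p * (pi / 2) - \<bar>Im L\<bar>"
  define e where "e = d / (2 * (real p + 1))"
  have d: "d > 0" using assms by (simp add: d_def)
  hence e: "e > 0" using assms by (simp add: e_def)
  have bnd: "1 - w + real p * a \<le> (1 - w) + real p * x \<and> (1 - w) + real p * x \<le> 1 - w + real p * b" if "a \<le> x" "x \<le> b" for x
    using that by (auto intro!: mult_left_mono)
  have "strip_bound a b (- (pi / 2 - e) * \<bar>real p\<bar>) (\<lambda>s. Gamma (of_real (1 - w) + of_real (real p) * s))"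
    using e assms by (intro strip_bound_affine[OF strip_bound_Gamma[where a = "1 - w + real p * a" and b = "1 - w + real p * b"]] bnd) auto
  moreover have "strip_bound a b ((pi / 2 + e) * \<bar>1\<bar>) (\<lambda>s. rGamma (of_real 1 + of_real 1 * s))"
    using e by (intro strip_bound_affine[OF strip_bound_rGamma[where a = "1 + a" and b = "1 + b"]]) auto
  moreover have "strip_bound a b \<bar>Im (-L)\<bar> (\<lambda>s. exp (- L * s))" by (rule strip_bound_exp)
  ultimately have "strip_bound a b (- (pi / 2 - e) * \<bar>real p\<bar> + ((pi / 2 + e) * \<bar>1\<bar> + \<bar>Im (-L)\<bar>))
     (\<lambda>s. Gamma (of_real (1 - w) + of_real (real p) * s) * (rGamma (of_real 1 + of_real 1 * s) * exp (- L * s)))"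
    by (intro strip_bound_mult)
  also have "- (pi / 2 - e) * \<bar>real p\<bar> + ((pi / 2 + e) * \<bar>1\<bar> + \<bar>Im (-L)\<bar>) = (real p + 1) * e - d"
    by (simp add: d_def kappa_def algebra_simps diff_divide_distrib add_divide_distrib)
  also have "(real p + 1) * e = d / 2" by (simp add: e_def field_simps)
  also have "d / 2 - d = (\<bar>Im L\<bar> - kappa p * (pi / 2)) / 2" by (simp add: d_def field_simps)
  finally show ?thesis
    by (rule strip_bound_cong) (simp add: ratio_exp_def Gamma_ratio_def rGamma_inverse_Gamma divide_inverse mult_ac)
qed

lemma ratio_exp_holomorphic:
  assumes "p > 0"
  shows "ratio_exp p w L holomorphic_on {s. (w - 1) / real p < Re s}"
proof -
  have "(\<lambda>s. Gamma (1 - of_real w + of_real (real p) * s) * rGamma (1 + s) * exp (- L * s)) holomorphic_on {s. (w - 1) / real p < Re s}"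
  proof (intro holomorphic_intros)
    fix s assume "s \<in> {s. (w - 1) / real p < Re s}"
    hence "0 < Re (1 - of_real w + of_real (real p) * s)" using assms by (simp add: field_simps)
    thus "1 - of_real w + of_real (real p) * s \<notin> \<int>\<^sub>\<le>\<^sub>0" by (rule not_nonpos_Ints_if_Re_pos)
  qed
  thus ?thesis by (simp add: ratio_exp_def[abs_def] Gamma_ratio_def rGamma_inverse_Gamma divide_inverse)
qed

definition zeta_ratio_exp :: "nat \<Rightarrow> real \<Rightarrow> complex \<Rightarrow> complex \<Rightarrow> complex" where
  "zeta_ratio_exp p w L s = zeta (1 - of_real w + of_real p * s) * ratio_exp p w L s"

lemma strip_bound_zeta_ratio_exp:
  assumes "p > 0" "\<bar>Im L\<bar> < kappa p * (pi / 2)"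
  shows "strip_bound a b ((\<bar>Im L\<bar> - kappa p * (pi / 2)) / 4) (zeta_ratio_exp p w L)"
proof -
  define d where "d = kappa p * (pi / 2) - \<bar>Im L\<bar>"
  have d: "d > 0" using assms by (simp add: d_def)
  have bnd: "1 - w + real p * a \<le> (1 - w) + real p * x \<and> (1 - w) + real p * x \<le> 1 - w + real p * b" if "a \<le> x" "x \<le> b" for x
    using that by (auto intro!: mult_left_mono)
  have "strip_bound a b (d / (4 * real p) * \<bar>real p\<bar>) (\<lambda>s. zeta (of_real (1 - w) + of_real (real p) * s))"
    using d assms by (intro strip_bound_affine[OF strip_bound_zeta[where a = "1 - w + real p * a" and b = "1 - w + real p * b"]] bnd) auto
  from strip_bound_mult[OF this strip_bound_ratio_exp[OF assms, of a b w]]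
  have "strip_bound a b (d / (4 * real p) * \<bar>real p\<bar> + (\<bar>Im L\<bar> - kappa p * (pi / 2)) / 2) (zeta_ratio_exp p w L)"
    by (rule strip_bound_cong) (simp add: zeta_ratio_exp_def)
  moreover have "d / (4 * real p) * \<bar>real p\<bar> + (\<bar>Im L\<bar> - kappa p * (pi / 2)) / 2 = (\<bar>Im L\<bar> - kappa p * (pi / 2)) / 4"
  proof -
    have "d / (4 * real p) * \<bar>real p\<bar> = d / 4" using assms by simp
    thus ?thesis by (simp only:) (simp add: d_def field_simps)
  qed
  ultimately show ?thesis by (simp only:)
qed

lemma zeta_ratio_exp_holomorphic:
  assumes "p > 0"
  shows "zeta_ratio_exp p w L holomorphic_on {s. w / real p < Re s}"
proof -
  have ne: "1 - of_real w + of_real (real p) * s \<noteq> 1" if "w / real p < Re s" for s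
  proof
    assume "1 - of_real w + of_real (real p) * s = (1 :: complex)"
    hence "Re (1 - of_real w + of_real (real p) * s) = 1" by simp
    thus False using that assms by (simp add: field_simps)
  qed
  have "(\<lambda>s. zeta (1 - of_real w + of_real (real p) * s)) holomorphic_on {s. w / real p < Re s}"
    by (rule holomorphic_on_compose_gen[OF _ zeta_holomorphic[of "- {1}"], unfolded o_def])
       (use ne in \<open>auto intro!: holomorphic_intros\<close>)
  moreover have "{s. w / real p < Re s} \<subseteq> {s. (w - 1) / real p < Re s}"
  proof
    fix s assume "s \<in> {s. w / real p < Re s}"
    moreover have "(w - 1) / real p \<le> w / real p" by (intro divide_right_mono) auto
    ultimately show "s \<in> {s. (w - 1) / real p < Re s}" by simp
  qed
  hence "ratio_exp p w L holomorphic_on {s. w / real p < Re s}"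
    by (rule holomorphic_on_subset[OF ratio_exp_holomorphic[OF assms]])
  ultimately show ?thesis unfolding zeta_ratio_exp_def[abs_def] by (intro holomorphic_intros)
qed

lemma integrable_zeta_ratio_exp:
  assumes "p > 0" "\<bar>Im L\<bar> < kappa p * (pi / 2)" "\<sigma> > w / real p"
  shows "integrable lborel (\<lambda>t. zeta_ratio_exp p w L (Complex \<sigma> t))"
  by (rule integrable_on_line[OF continuous_on_line_holomorphic[OF zeta_ratio_exp_holomorphic] strip_bound_zeta_ratio_exp])
     (use assms in auto)

lemma line_integral_zeta_ratio_exp_shift:
  assumes "p > 0" "\<bar>Im L\<bar> < kappa p * (pi / 2)" "\<sigma> > w / real p" "\<tau> \<ge> \<sigma>"
  shows "line_integral \<sigma> (zeta_ratio_exp p w L) = line_integral \<tau> (zeta_ratio_exp p w L)"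
proof (rule line_integral_shift_holomorphic[OF _ _ _ _ strip_bound_zeta_ratio_exp])
  show "zeta_ratio_exp p w L holomorphic_on {s. w / real p < Re s \<and> Re s < \<tau> + 1}"
    by (rule holomorphic_on_subset[OF zeta_ratio_exp_holomorphic]) (use assms in auto)
qed (use assms in auto)

lemma isCont_zeta: "s \<noteq> 1 \<Longrightarrow> isCont zeta s"
  using holomorphic_on_imp_continuous_on[OF zeta_holomorphic[of "- {1}"]]
    continuous_on_eq_continuous_at[of "- {1}" zeta] by auto

definition log_chi :: "nat \<Rightarrow> complex \<Rightarrow> complex" where
  "log_chi p a = of_real (real p * ln (2 * pi)) - Ln a"

definition freq :: "nat \<Rightarrow> nat \<Rightarrow> real" where
  "freq p r = real p / 2 - 2 * real r - 1"

context
  fixes m p l :: nat and w :: real and a :: complex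
  assumes m: "m > 0" and l: "l > 0" "p = 2 * l" and w: "w = 2 * real m" and a: "a \<in> right_half_sector"
begin

lemma p_pos: "p > 0" and a_nz: "a \<noteq> 0" and Arg_a: "\<bar>Im (Ln a)\<bar> < pi / 2"
  using l a by (auto simp: right_half_sector_def Arg_eq_Im_Ln)

text \<open>This keeps the pole of \<open>\<zeta>(w + p z)\<close> away from those of \<open>\<Gamma>\<close>, so that all residues come from simple poles: an odd
number is no multiple of the even number \<open>p\<close>.\<close>

lemma odd_not_multiple: "w - real p * real k \<noteq> 1" "1 - w \<noteq> - (real p * real k)"
proof -
  have *: "2 * int m - 2 * (int l * int k) \<noteq> 1" by presburger
  show "w - real p * real k \<noteq> 1"
  proof
    assume "w - real p * real k = 1"
    hence "real_of_int (2 * int m - 2 * (int l * int k)) = real_of_int 1" by (simp add: w l(2))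
    thus False using * by (simp only: of_int_eq_iff)
  qed
  thus "1 - w \<noteq> - (real p * real k)" by linarith
qed

definition mellin_zeta :: "complex \<Rightarrow> complex" where
  "mellin_zeta z = Gamma z * zeta (of_real w + of_real (real p) * z) * exp (- Ln a * z)"

lemma strip_bound_mellin_zeta: "strip_bound x y ((\<bar>Im (Ln a)\<bar> - pi / 2) / 2) mellin_zeta"
proof -
  define d where "d = pi / 2 - \<bar>Im (Ln a)\<bar>"
  have d: "d > 0" using Arg_a by (simp add: d_def)
  have bnd: "w + real p * x \<le> w + real p * t \<and> w + real p * t \<le> w + real p * y" if "x \<le> t" "t \<le> y" for t
    using that by (auto intro!: mult_left_mono)
  have "strip_bound x y (- (pi / 2 - d / 4)) Gamma" using d by (intro strip_bound_Gamma) auto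
  moreover have "strip_bound x y (d / (4 * real p) * \<bar>real p\<bar>) (\<lambda>s. zeta (of_real w + of_real (real p) * s))"
    using d p_pos by (intro strip_bound_affine[OF strip_bound_zeta[where a = "w + real p * x" and b = "w + real p * y"]] bnd) auto
  moreover have "strip_bound x y \<bar>Im (- Ln a)\<bar> (\<lambda>s. exp (- Ln a * s))" by (rule strip_bound_exp)
  ultimately have "strip_bound x y (- (pi / 2 - d / 4) + d / (4 * real p) * \<bar>real p\<bar> + \<bar>Im (- Ln a)\<bar>) mellin_zeta"
    unfolding mellin_zeta_def[abs_def] by (intro strip_bound_mult)
  also have "d / (4 * real p) * \<bar>real p\<bar> = d / 4" using p_pos by simp
  also have "- (pi / 2 - d / 4) + d / 4 + \<bar>Im (- Ln a)\<bar> = (\<bar>Im (Ln a)\<bar> - pi / 2) / 2"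
    by (simp add: d_def field_simps)
  finally show ?thesis .
qed

lemma exp_Ln_nat_powr: "exp (Ln a + of_real (real p * ln (real (Suc n)))) = a * of_real (real (Suc n) powr real p)"
  using a_nz by (simp add: exp_add powr_def mult_ac flip: exp_of_real)

text \<open>The Cahen-Mellin formula for each term of the Dirichlet series; on the line \<open>Re z = 1\<close> the series converges absolutely.\<close>

lemma line_integral_mellin_zeta_right: "line_integral 1 mellin_zeta = 2 * pi * \<i> * S_series (real p) a w"
proof -
  define g where "g = (\<lambda>s. Gamma s * exp (- Ln a * s))"
  define u where "u = (\<lambda>n s. 1 / of_nat (Suc n) powr (of_real w + of_real (real p) * s) :: complex)"
  have g: "g = Mellin_Gamma (Ln a)" by (simp add: g_def Mellin_Gamma_def fun_eq_iff)
  have "(\<lambda>n. line_integral 1 (\<lambda>s. g s * u n s)) sums line_integral 1 (\<lambda>s. g s * (\<Sum>n. u n s))"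
  proof (rule line_integral_suminf)
    show "strip_bound 1 1 ((\<bar>Im (Ln a)\<bar> - pi / 2) / 2) g" unfolding g by (rule strip_bound_Mellin_Gamma[OF Arg_a])
    show "(\<bar>Im (Ln a)\<bar> - pi / 2) / 2 < 0" using Arg_a by simp
    have "g holomorphic_on {s. Re s > 0}" unfolding g_def
      by (intro holomorphic_intros) (auto dest: not_nonpos_Ints_if_Re_pos)
    thus "continuous_on UNIV (\<lambda>t. g (Complex 1 t))" by (rule continuous_on_line_holomorphic) auto
    show "continuous_on UNIV (\<lambda>t. u n (Complex 1 t))" for n
      by (rule continuous_on_line_holomorphic[where A = UNIV]) (auto simp: u_def intro!: holomorphic_intros)
    show "summable (\<lambda>n. real (Suc n) powr (- (w + real p)))"
      using m w p_pos by (intro summable_powr_neg) auto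
    fix n t
    have "norm (u n (Complex 1 t)) = 1 / real (Suc n) powr (w + real p)"
      unfolding u_def norm_divide using norm_powr_real_powr[of "of_nat (Suc n)" "of_real w + of_real (real p) * Complex 1 t"] by simp
    also have "\<dots> = real (Suc n) powr (- (w + real p))" by (simp only: powr_minus divide_inverse mult_1_left)
    finally show "norm (u n (Complex 1 t)) \<le> real (Suc n) powr (- (w + real p))" by (rule eq_refl)
  qed
  moreover have "line_integral 1 (\<lambda>s. g s * (\<Sum>n. u n s)) = line_integral 1 mellin_zeta"
  proof (rule line_integral_cong)
    fix t
    have "Re (of_real w + of_real (real p) * Complex 1 t) > 1" using m w p_pos by simp
    from zeta_sums[OF this] show "g (Complex 1 t) * (\<Sum>n. u n (Complex 1 t)) = mellin_zeta (Complex 1 t)"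
      by (simp add: sums_iff u_def g_def mellin_zeta_def mult_ac)
  qed
  moreover have "line_integral 1 (\<lambda>s. g s * u n s) = 
      2 * pi * \<i> * (of_real (real (Suc n) powr (- w)) * exp (- a * of_real (real (Suc n) powr real p)))" for n
  proof -
    define Y where "Y = Ln a + of_real (real p * ln (real (Suc n)))"
    have "g s * u n s = of_real (real (Suc n) powr (- w)) * Mellin_Gamma Y s" for s
    proof -
      define c where "c = ln (real (Suc n))"
      have "of_nat (Suc n) powr z = exp (z * of_real c)" for z :: complex
        unfolding c_def by (simp add: powr_def Ln_of_nat del: of_nat_Suc)
      hence "u n s = exp (- ((of_real w + of_real (real p) * s) * of_real c))"
        by (simp only: u_def exp_minus divide_inverse mult_1_left)
      also have "\<dots> = exp (- of_real w * of_real (ln (real (Suc n)))) * exp (- of_real (real p * ln (real (Suc n))) * s)"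
        unfolding exp_add[symmetric] c_def by (rule arg_cong[where f = exp]) (simp add: algebra_simps)
      finally have "u n s = exp (- of_real w * of_real (ln (real (Suc n)))) * exp (- of_real (real p * ln (real (Suc n))) * s)" .
      also have "exp (- of_real w * of_real (ln (real (Suc n)))) = complex_of_real (real (Suc n) powr (- w))"
        by (simp add: powr_def flip: exp_of_real)
      finally show ?thesis by (simp add: g_def Mellin_Gamma_def Y_def algebra_simps flip: exp_add)
    qed
    hence "line_integral 1 (\<lambda>s. g s * u n s) = of_real (real (Suc n) powr (- w)) * line_integral 1 (Mellin_Gamma Y)"
      by (simp add: line_integral_cmult)
    also have "line_integral 1 (Mellin_Gamma Y) = 2 * pi * \<i> * exp (- exp Y)"
      using Arg_a by (intro Cahen_Mellin) (auto simp: Y_def)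
    also have "exp Y = a * of_real (real (Suc n) powr real p)" unfolding Y_def by (rule exp_Ln_nat_powr)
    finally show ?thesis by (simp add: mult_ac)
  qed
  ultimately have "(\<lambda>n. 2 * pi * \<i> * (of_real (real (Suc n) powr (- w)) * exp (- a * of_real (real (Suc n) powr real p)))) sums
      line_integral 1 mellin_zeta" by (simp only:)
  hence "(\<lambda>n. (2 * pi * \<i> * (of_real (real (Suc n) powr (- w)) * exp (- a * of_real (real (Suc n) powr real p)))) / (2 * pi * \<i>)) sums
      (line_integral 1 mellin_zeta / (2 * pi * \<i>))" by (rule sums_divide)
  hence "S_series (real p) a w = line_integral 1 mellin_zeta / (2 * pi * \<i>)"
    unfolding S_series_def by (simp add: sums_iff)
  thus ?thesis by simp
qed

lemma residue_mellin_zeta_Gamma_pole: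
  assumes U: "open U" "- of_nat k \<in> U" "mellin_zeta holomorphic_on U - {- of_nat k}"
  shows "residue mellin_zeta (- of_nat k) = (-1) ^ k / fact k * zeta (of_real (w - real p * real k)) * a ^ k"
proof -
  define z0 :: complex where "z0 = - of_nat k"
  have v: "of_real w + of_real (real p) * z0 = of_real (w - real p * real k)" by (simp add: z0_def)
  have "complex_of_real (w - real p * real k) \<noteq> 1" using odd_not_multiple(1)[of k] by (metis of_real_eq_1_iff)
  hence "isCont zeta (of_real (w - real p * real k))"
    by (rule isCont_zeta)
  hence "((\<lambda>z. zeta (of_real w + of_real (real p) * z)) \<longlongrightarrow> zeta (of_real (w - real p * real k))) (at z0)"
    by (rule isCont_tendsto_compose) (subst v[symmetric], intro tendsto_intros)
  moreover have "((\<lambda>z. Gamma z * (z + of_nat k)) \<longlongrightarrow> (-1) ^ k / fact k) (at z0)"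
    unfolding z0_def by (rule Gamma_residues)
  moreover have "((\<lambda>z. exp (- Ln a * z)) \<longlongrightarrow> exp (- Ln a * z0)) (at z0)" by (intro tendsto_intros)
  ultimately have "((\<lambda>z. (Gamma z * (z + of_nat k)) * zeta (of_real w + of_real (real p) * z) * exp (- Ln a * z)) \<longlongrightarrow>
      (-1) ^ k / fact k * zeta (of_real (w - real p * real k)) * exp (- Ln a * z0)) (at z0)"
    by (intro tendsto_mult)
  hence "((\<lambda>z. mellin_zeta z * (z - z0)) \<longlongrightarrow> (-1) ^ k / fact k * zeta (of_real (w - real p * real k)) * exp (- Ln a * z0)) (at z0)"
    by (simp add: mellin_zeta_def z0_def mult_ac)
  hence "residue mellin_zeta z0 = (-1) ^ k / fact k * zeta (of_real (w - real p * real k)) * exp (- Ln a * z0)"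
    using U by (intro residue_simple'[of U]) (auto simp: z0_def)
  also have "exp (- Ln a * z0) = exp (of_nat k * Ln a)" by (simp add: z0_def mult.commute)
  also have "\<dots> = a ^ k" using a_nz by (simp add: exp_of_nat_mult)
  finally show ?thesis by (simp add: z0_def)
qed

lemma residue_mellin_zeta_zeta_pole:
  assumes U: "open U" "of_real ((1 - w) / real p) \<in> U" "mellin_zeta holomorphic_on U - {of_real ((1 - w) / real p)}"
  shows "residue mellin_zeta (of_real ((1 - w) / real p)) = 
           of_real (1 / real p * Gamma ((1 - w) / real p)) * a powr of_real ((w - 1) / real p)"
proof -
  define z0 :: complex where "z0 = of_real ((1 - w) / real p)"
  define h where "h = (\<lambda>z. of_real w + of_real (real p) * z :: complex)"
  have pz0: "of_real (real p) * z0 = of_real (1 - w)" using p_pos by (simp add: z0_def)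
  have h0: "h z0 = 1" unfolding h_def pz0 by simp
  have "z0 \<notin> \<int>\<^sub>\<le>\<^sub>0"
  proof
    assume "z0 \<in> \<int>\<^sub>\<le>\<^sub>0"
    then obtain k where "z0 = - of_nat k" by (auto elim!: nonpos_Ints_cases')
    hence "complex_of_real (1 - w) = of_real (- (real p * real k))" using pz0 by simp
    hence "1 - w = - (real p * real k)" by (simp only: of_real_eq_iff)
    thus False using odd_not_multiple(2) by blast
  qed
  hence "((\<lambda>z. Gamma z * exp (- Ln a * z)) \<longlongrightarrow> Gamma z0 * exp (- Ln a * z0)) (at z0)" by (intro tendsto_intros)
  moreover have "((\<lambda>z. (h z - 1) * zeta (h z)) \<longlongrightarrow> 1) (at z0)"
  proof (rule filterlim_compose[OF zeta_pole])
    have "(h \<longlongrightarrow> h z0) (at z0)" unfolding h_def by (intro tendsto_intros)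
    moreover have "h z \<noteq> 1" if "z \<noteq> z0" for z
    proof
      assume "h z = 1"
      hence "h z = h z0" using h0 by simp
      hence "of_real (real p) * z = of_real (real p) * z0" unfolding h_def by (rule add_left_imp_eq)
      thus False using p_pos that by simp
    qed
    hence "eventually (\<lambda>z. h z \<noteq> 1) (at z0)" by (auto simp: eventually_at_filter)
    ultimately show "filterlim h (at 1) (at z0)" unfolding h0 by (simp add: filterlim_at)
  qed
  ultimately have "((\<lambda>z. (1 / of_real (real p)) * ((Gamma z * exp (- Ln a * z)) * ((h z - 1) * zeta (h z)))) \<longlongrightarrow>
      (1 / of_real (real p)) * ((Gamma z0 * exp (- Ln a * z0)) * 1)) (at z0)"
    by (intro tendsto_mult[OF tendsto_const tendsto_mult])
  moreover have "(1 / of_real (real p)) * ((Gamma z * exp (- Ln a * z)) * ((h z - 1) * zeta (h z))) = mellin_zeta z * (z - z0)" for z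
  proof -
    have "h z - 1 = of_real (real p) * (z - z0)" using pz0 by (simp add: h_def algebra_simps)
    hence "(1 / of_real (real p)) * ((Gamma z * exp (- Ln a * z)) * ((h z - 1) * zeta (h z))) =
        (1 / of_real (real p) * of_real (real p)) * (Gamma z * zeta (h z) * exp (- Ln a * z) * (z - z0))"
      by (simp only: mult_ac)
    also have "1 / of_real (real p) * of_real (real p) = (1 :: complex)" using p_pos by simp
    finally show ?thesis by (simp only: mellin_zeta_def h_def mult_1_left)
  qed
  ultimately have "((\<lambda>z. mellin_zeta z * (z - z0)) \<longlongrightarrow> (1 / of_real (real p)) * ((Gamma z0 * exp (- Ln a * z0)) * 1)) (at z0)"
    by (simp only:)
  hence "residue mellin_zeta z0 = (1 / of_real (real p)) * ((Gamma z0 * exp (- Ln a * z0)) * 1)"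
    using U by (intro residue_simple'[of U]) (auto simp: z0_def)
  also have "exp (- Ln a * z0) = a powr of_real ((w - 1) / real p)"
  proof -
    have "- z0 = of_real ((w - 1) / real p)" by (simp add: z0_def diff_divide_distrib)
    hence "- Ln a * z0 = of_real ((w - 1) / real p) * Ln a" by (metis minus_mult_commute mult.commute)
    thus ?thesis using a_nz by (simp only: powr_def if_False)
  qed
  also have "Gamma z0 = of_real (Gamma ((1 - w) / real p))" by (simp only: z0_def Gamma_complex_of_real)
  finally show ?thesis by (simp add: z0_def)
qed

text \<open>The hypothesis \<open>\<sigma> < K + 1\<close> makes \<open>K\<close> the last pole of the gamma function that is crossed.\<close>

lemma mellin_zeta_shift:
  assumes K: "real K \<le> w / real p" and \<sigma>: "w / real p < \<sigma>" "\<sigma> < real K + 1"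
  shows "line_integral 1 mellin_zeta - line_integral (- \<sigma>) mellin_zeta = 2 * pi * \<i> *
     (of_real (1 / real p * Gamma ((1 - w) / real p)) * a powr of_real ((w - 1) / real p) +
      (\<Sum>k=0..K. (-1) ^ k / fact k * zeta (of_real (w - real p * real k)) * a ^ k))"
proof -
  define z0 :: complex where "z0 = of_real ((1 - w) / real p)"
  define P :: "complex set" where "P = (\<lambda>k. - of_nat k) ` {0..K}"
  define S where "S = insert z0 P"
  define a' where "a' = (- \<sigma> - (real K + 1)) / 2"
  define U where "U = {s. a' < Re s \<and> Re s < 2}"
  have a': "- (real K + 1) < a'" "a' < - \<sigma>" using \<sigma> by (auto simp: a'_def field_simps)
  have finS: "finite S" by (simp add: S_def P_def)
  have openU: "open U" unfolding U_def
    using open_halfspace_Re_gt[of a'] open_halfspace_Re_lt[of 2] by (auto simp: Collect_conj_eq)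
  have z0P: "z0 \<notin> P"
  proof
    assume "z0 \<in> P"
    then obtain k where "z0 = - of_nat k" by (auto simp: P_def)
    hence "Re z0 = - real k" by simp
    hence "1 - w = - (real p * real k)" using p_pos by (simp add: z0_def field_simps)
    thus False using odd_not_multiple(2) by blast
  qed
  have inS: "- \<sigma> < Re z \<and> Re z < 1" if "z \<in> S" for z
  proof (cases "z = z0")
    case True
    have "- \<sigma> * real p < 1 - w" using \<sigma> p_pos by (simp add: field_simps)
    moreover have "1 - w < real p" using m w p_pos by simp
    ultimately show ?thesis using p_pos by (simp add: True z0_def field_simps)
  next
    case False
    hence "z \<in> P" using that by (simp add: S_def)
    then obtain k where "k \<in> {0..K}" "z = - of_nat k" unfolding P_def by blast
    thus ?thesis using K \<sigma> by auto
  qed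
  have hol: "mellin_zeta holomorphic_on U - S"
  proof -
    have "(U - S) \<inter> \<int>\<^sub>\<le>\<^sub>0 = {}"
    proof (intro equals0I)
      fix z assume z: "z \<in> (U - S) \<inter> \<int>\<^sub>\<le>\<^sub>0"
      then obtain k where k: "z = - of_nat k" by (auto elim!: nonpos_Ints_cases')
      have "real k < real K + 1" using z k a' by (auto simp: U_def)
      hence "k \<le> K" by linarith
      thus False using z k by (auto simp: S_def P_def)
    qed
    hence h1: "Gamma holomorphic_on U - S" by (rule holomorphic_Gamma)
    have img: "(\<lambda>z. of_real w + of_real (real p) * z) ` (U - S) \<subseteq> - {1}"
    proof (intro subsetI)
      fix y assume "y \<in> (\<lambda>z. of_real w + of_real (real p) * z) ` (U - S)"
      then obtain z where z: "z \<notin> S" "y = of_real w + of_real (real p) * z" by blast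
      have "y \<noteq> 1"
      proof
        assume "y = 1"
        hence "of_real (real p) * z = of_real (1 - w)" using z(2) by (simp add: algebra_simps)
        hence "z = z0" using p_pos by (simp add: z0_def field_simps)
        thus False using z by (simp add: S_def)
      qed
      thus "y \<in> - {1}" by simp
    qed
    have "(\<lambda>z. of_real w + of_real (real p) * z) holomorphic_on U - S" by (intro holomorphic_intros)
    from holomorphic_on_compose_gen[OF this zeta_holomorphic[OF order.refl] img]
    have h2: "(\<lambda>z. zeta (of_real w + of_real (real p) * z)) holomorphic_on U - S" by (simp only: o_def)
    have h3: "(\<lambda>z. exp (- Ln a * z)) holomorphic_on U - S" by (intro holomorphic_intros)
    show ?thesis unfolding mellin_zeta_def[abs_def] by (intro holomorphic_on_mult h1 h2 h3)
  qed
  have "line_integral 1 mellin_zeta - line_integral (- \<sigma>) mellin_zeta = 2 * pi * \<i> * (\<Sum>z\<in>S. residue mellin_zeta z)"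
  proof (rule line_integral_shift_residues[OF _ _ _ finS _ hol[unfolded U_def] strip_bound_mellin_zeta])
    have "0 \<le> w / real p" using w by simp
    thus "- \<sigma> < 1" using \<sigma> by linarith
    show "a' < - \<sigma>" "(1::real) < 2" using a' by auto
    show "(\<bar>Im (Ln a)\<bar> - pi / 2) / 2 < 0" using Arg_a by simp
  qed (use inS in auto)
  also have "(\<Sum>z\<in>S. residue mellin_zeta z) = residue mellin_zeta z0 + (\<Sum>z\<in>P. residue mellin_zeta z)"
    unfolding S_def using z0P by (subst sum.insert) (auto simp: P_def)
  also have "(\<Sum>z\<in>P. residue mellin_zeta z) = (\<Sum>k=0..K. residue mellin_zeta (- of_nat k))"
    unfolding P_def by (subst sum.reindex) (auto simp: inj_on_def)
  also have "(\<Sum>k=0..K. residue mellin_zeta (- of_nat k)) = (\<Sum>k=0..K. (-1) ^ k / fact k * zeta (of_real (w - real p * real k)) * a ^ k)"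
  proof (rule sum.cong)
    fix k assume k: "k \<in> {0..K}"
    have mem: "- of_nat k \<in> S" using k by (auto simp: S_def P_def)
    show "residue mellin_zeta (- of_nat k) = (-1) ^ k / fact k * zeta (of_real (w - real p * real k)) * a ^ k"
    proof (rule residue_mellin_zeta_Gamma_pole[of "U - (S - {- of_nat k})"])
      show "open (U - (S - {- of_nat k}))" using openU finS by (intro open_Diff finite_imp_closed) auto
      show "- of_nat k \<in> U - (S - {- of_nat k})" using inS[OF mem] a' by (auto simp: U_def)
      have "U - (S - {- of_nat k}) - {- of_nat k} = U - S" using mem by auto
      thus "mellin_zeta holomorphic_on U - (S - {- of_nat k}) - {- of_nat k}" using hol by simp
    qed
  qed simp
  also have "residue mellin_zeta z0 = of_real (1 / real p * Gamma ((1 - w) / real p)) * a powr of_real ((w - 1) / real p)"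
    unfolding z0_def
  proof (rule residue_mellin_zeta_zeta_pole[of "U - P"], fold z0_def)
    show "open (U - P)" using openU by (intro open_Diff finite_imp_closed) (auto simp: P_def)
    show "z0 \<in> U - P" using inS[of z0] a' z0P by (auto simp: U_def S_def)
    have "U - P - {z0} = U - S" by (auto simp: S_def)
    thus "mellin_zeta holomorphic_on U - P - {z0}" using hol by simp
  qed
  finally show ?thesis .
qed

text \<open>The functional equation at \<open>w - p s\<close> produces \<open>sin (\<pi> (w - p s) / 2)\<close>, which up to its sign is \<open>sin (\<pi> l s)\<close>,
since \<open>w = 2 m\<close> and \<open>p = 2 l\<close>. The reflection formula for \<open>\<Gamma>(-s)\<close> supplies the denominator \<open>sin (\<pi> s)\<close>. Real
points are excluded because both sines may vanish there; they are negligible for the line integral.\<close>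

lemma mellin_zeta_reflected:
  assumes s: "Re s > w / real p" "Im s \<noteq> 0"
  defines "Lc \<equiv> of_real (real p * ln (2 * pi)) - Ln a"
  shows "(-1) ^ m * of_real ((2 * pi) powr (- w)) * mellin_zeta (- s) = zeta_ratio_exp p w Lc s * dirichlet_kernel l s"
proof -
  define u where "u = of_real w - of_real (real p) * s"
  define G where "G = Gamma (1 - u) * zeta (1 - u)"
  have Reu: "Re u < 0" using s p_pos by (simp add: u_def field_simps)
  have sin_nz: "sin (of_real pi * s) \<noteq> 0"
  proof
    assume "sin (of_real pi * s) = 0"
    then obtain n :: int where "of_real pi * s = of_real (of_int n * pi)" by (auto simp: sin_eq_0)
    hence "Im (of_real pi * s) = 0" by (metis Im_complex_of_real)
    thus False using s by simp
  qed
  have 1: "zeta u = 2 * sin (of_real (pi / 2) * u) * (of_real (2 * pi) powr (u - 1) * Gamma (1 - u) * zeta (1 - u))"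
    by (rule zeta_functional_equation[OF Reu])
  have "of_real (pi / 2) * u = of_real (real m * pi) - of_real (pi * real l) * s"
    by (simp add: u_def w l(2) algebra_simps)
  hence 2: "sin (of_real (pi / 2) * u) = - ((-1) ^ m * sin (of_real (pi * real l) * s))"
  proof -
    have "sin (complex_of_real (real m * pi)) = 0" "cos (complex_of_real (real m * pi)) = (-1) ^ m"
      by (simp_all only: sin_of_real cos_of_real sin_npi cos_npi) simp_all
    thus ?thesis unfolding \<open>of_real (pi / 2) * u = _\<close> sin_diff by simp
  qed
  have 3: "of_real (2 * pi) powr (u - 1) = of_real ((2 * pi) powr w) * (1 / of_real (2 * pi)) * exp (- of_real (real p * ln (2 * pi)) * s)"
  proof -
    define c where "c = ln (2 * pi)"
    have ec: "complex_of_real (2 * pi) = exp (of_real c)" unfolding c_def by (subst exp_of_real) simp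
    have pw: "complex_of_real (2 * pi) powr z = exp (z * of_real c)" for z
      unfolding c_def by (subst powr_def) (simp add: Ln_of_real flip: of_real_mult del: of_real_mult)
    have "complex_of_real ((2 * pi) powr w) = complex_of_real (exp (w * c))" by (simp add: powr_def c_def)
    also have "\<dots> = exp (of_real w * of_real c)" by (simp flip: exp_of_real)
    finally have pw2: "complex_of_real ((2 * pi) powr w) = exp (of_real w * of_real c)" .
    have "1 / complex_of_real (2 * pi) = exp (- of_real c)" unfolding ec by (simp only: exp_minus divide_inverse mult_1_left)
    moreover have "(u - 1) * of_real c = of_real w * of_real c + - of_real c + - of_real (real p * c) * s"
      by (simp add: u_def algebra_simps)
    ultimately show ?thesis unfolding pw pw2 c_def[symmetric] by (simp only: exp_add)
  qed
  have 4: "Gamma (- s) = - (of_real pi * rGamma (1 + s) / sin (of_real pi * s))"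
  proof -
    have nz: "1 + s \<notin> \<int>\<^sub>\<le>\<^sub>0" using s by (auto elim!: nonpos_Ints_cases simp: complex_eq_iff)
    have "Gamma (- s) * Gamma (1 - (- s)) = of_real pi / sin (of_real pi * (- s))" by (rule Gamma_reflection_complex)
    hence "Gamma (- s) * Gamma (1 + s) = - (of_real pi / sin (of_real pi * s))" by simp
    hence "Gamma (- s) = - (of_real pi / sin (of_real pi * s)) / Gamma (1 + s)"
      using nz by (subst eq_divide_eq) (simp add: Gamma_eq_zero_iff)
    thus ?thesis by (simp add: rGamma_inverse_Gamma divide_inverse mult_ac)
  qed
  have mz: "mellin_zeta (- s) = Gamma (- s) * zeta u * exp (Ln a * s)" by (simp add: mellin_zeta_def u_def)
  have one: "of_real ((2 * pi) powr (- w)) * of_real ((2 * pi) powr w) = (1 :: complex)"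
    by (simp add: powr_minus flip: of_real_mult)
  have "(-1) ^ m * of_real ((2 * pi) powr (- w)) * mellin_zeta (- s) = 
     ((-1) ^ m * (-1) ^ m) * (of_real ((2 * pi) powr (- w)) * of_real ((2 * pi) powr w)) * (2 * of_real pi * (1 / of_real (2 * pi))) *
     (sin (of_real (pi * real l) * s) / sin (of_real pi * s)) * (rGamma (1 + s) * G) *
     (exp (- of_real (real p * ln (2 * pi)) * s) * exp (Ln a * s))"
    unfolding mz 1 2 3 4 G_def by (simp only: mult_minus_left mult_minus_right minus_minus divide_inverse mult_ac)
  also have "(-1 :: complex) ^ m * (-1) ^ m = 1" by (simp flip: power_mult_distrib)
  also have "2 * of_real pi * (1 / of_real (2 * pi)) = (1 :: complex)" by simp
  also have "sin (of_real (pi * real l) * s) / sin (of_real pi * s) = dirichlet_kernel l s"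
    using dirichlet_kernel_mult_sin[of l s] sin_nz by (simp add: field_simps)
  also have "exp (- of_real (real p * ln (2 * pi)) * s) * exp (Ln a * s) = exp (- Lc * s)"
    by (simp add: Lc_def algebra_simps flip: exp_add)
  also have "rGamma (1 + s) * G = zeta (1 - of_real w + of_real p * s) * Gamma_ratio p w s"
    by (simp add: G_def u_def Gamma_ratio_def rGamma_inverse_Gamma divide_inverse algebra_simps)
  finally show ?thesis unfolding one by (simp add: zeta_ratio_exp_def ratio_exp_def mult_ac)
qed

lemma freq_eq: "freq p r = real l - 2 * real r - 1"
  unfolding freq_def by (simp add: l(2))

lemma freq_bounds: "r < l div 2 \<Longrightarrow> 0 \<le> freq p r \<and> freq p r \<le> real l - 1"
proof -
  assume "r < l div 2"
  hence "2 * r + 2 \<le> l" by linarith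
  hence "2 * real r + 2 \<le> real l" by linarith
  thus ?thesis by (simp add: freq_eq)
qed

lemma kappa_half_pi: "kappa (real p) * (pi / 2) = pi / 2 + pi * (real l - 1)"
  by (simp add: kappa_def l(2) field_simps)

lemma Im_log_chi_rotated:
  assumes "\<bar>e\<bar> = 1" "r < l div 2"
  shows "\<bar>Im ((log_chi p a) - of_real e * pi * \<i> * of_real (freq p r))\<bar> < kappa (real p) * (pi / 2)"
proof -
  have "Im ((log_chi p a) - of_real e * pi * \<i> * of_real (freq p r)) = - Im (Ln a) - e * (pi * freq p r)" by (simp add: log_chi_def)
  hence "\<bar>Im ((log_chi p a) - of_real e * pi * \<i> * of_real (freq p r))\<bar> \<le> \<bar>Im (Ln a)\<bar> + \<bar>e * (pi * freq p r)\<bar>" by linarith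
  also have "\<bar>e * (pi * freq p r)\<bar> = pi * freq p r" using assms freq_bounds[OF assms(2)] by (simp add: abs_mult)
  also have "\<dots> \<le> pi * (real l - 1)" using freq_bounds[OF assms(2)] by (intro mult_left_mono) auto
  finally show ?thesis unfolding kappa_half_pi using Arg_a by linarith
qed

lemma Im_log_chi: "\<bar>Im (log_chi p a)\<bar> < kappa (real p) * (pi / 2)"
proof -
  have "\<bar>Im (log_chi p a)\<bar> = \<bar>Im (Ln a)\<bar>" by (simp add: log_chi_def)
  moreover have "0 \<le> pi * (real l - 1)" using l by simp
  ultimately show ?thesis unfolding kappa_half_pi using Arg_a by linarith
qed

lemma chi_eq_exp: "chi (real p) a = exp (log_chi p a)" and Ln_chi: "Ln (chi (real p) a) = (log_chi p a)"
proof -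
  have "exp (complex_of_real (real p * ln (2 * pi))) = of_real ((2 * pi) powr real p)"
    by (subst exp_of_real) (simp add: powr_def)
  thus 1: "chi (real p) a = exp (log_chi p a)" using a_nz by (simp add: chi_def log_chi_def exp_diff)
  have "- pi < Im (log_chi p a)" "Im (log_chi p a) \<le> pi" using Arg_a by (auto simp: log_chi_def abs_if split: if_splits)
  thus "Ln (chi (real p) a) = (log_chi p a)" unfolding 1 by (rule Ln_exp)
qed

lemma chi_powr: "chi (real p) a powr (- s) = exp (- (log_chi p a) * s)"
proof -
  have "chi (real p) a \<noteq> 0" by (simp add: chi_eq_exp)
  thus ?thesis by (simp add: powr_def Ln_chi mult.commute)
qed

lemma J_pm_eq: "J_pm \<sigma> e (real p) w r a = 1 / (2 * pi * \<i>) * line_integral \<sigma> (zeta_ratio_exp p w ((log_chi p a) - of_real e * pi * \<i> * of_real (freq p r)))"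
proof -
  have "zeta (1 - of_real w + of_real (real p) * s) * Gamma_ratio (real p) w s * chi (real p) a powr (- s) * exp (of_real e * pi * \<i> * of_real (freq p r) * s) =
     zeta_ratio_exp p w ((log_chi p a) - of_real e * pi * \<i> * of_real (freq p r)) s" for s
    by (simp add: zeta_ratio_exp_def ratio_exp_def chi_powr mult.assoc flip: exp_add) (simp add: algebra_simps)
  thus ?thesis unfolding J_pm_def freq_def[symmetric] by simp
qed

lemma E_hat_eq: "E_hat \<sigma> (real p) w a = 1 / (2 * pi * \<i>) * line_integral \<sigma> (zeta_ratio_exp p w (log_chi p a))"
  by (simp add: E_hat_def zeta_ratio_exp_def[abs_def] ratio_exp_def chi_powr mult.assoc)

theorem I_L_eq_sum_E:
  assumes \<sigma>: "\<sigma> > w / real p"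
  shows "I_L \<sigma> m (real p) w a = (\<Sum>r<l div 2. E_fun \<sigma> (real p) w r a) + (if odd l then 1 else 0) * E_hat \<sigma> (real p) w a"
proof -
  define z where "z = zeta_ratio_exp p w"
  define L where "L = (\<lambda>e r. (log_chi p a) - of_real e * pi * \<i> * of_real (freq p r))"
  have int: "integrable lborel (\<lambda>t. z (L e r) (Complex \<sigma> t))" if "\<bar>e\<bar> = 1" "r < l div 2" for e r
    unfolding z_def L_def using integrable_zeta_ratio_exp[OF p_pos Im_log_chi_rotated[OF that] \<sigma>] .
  have int0: "integrable lborel (\<lambda>t. z (log_chi p a) (Complex \<sigma> t))"
    unfolding z_def by (rule integrable_zeta_ratio_exp[OF p_pos Im_log_chi \<sigma>])
  have "(-1) ^ m * of_real ((2 * pi) powr (- w)) * line_integral \<sigma> (\<lambda>s. mellin_zeta (- s)) =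
     line_integral \<sigma> (\<lambda>s. (-1) ^ m * of_real ((2 * pi) powr (- w)) * mellin_zeta (- s))"
    by (rule line_integral_cmult[symmetric])
  also have "\<dots> = line_integral \<sigma> (\<lambda>s. (\<Sum>r<l div 2. z (L 1 r) s + z (L (-1) r) s) + (if odd l then 1 else 0) * z (log_chi p a) s)"
  proof (rule line_integral_cong)
    fix t :: real assume t: "t \<noteq> 0"
    define s where "s = Complex \<sigma> t"
    have shift: "z (log_chi p a) s * exp (pi * \<i> * of_real (real l - 2 * real r - 1) * s) = z (L 1 r) s"
      "z (log_chi p a) s * exp (- (pi * \<i> * of_real (real l - 2 * real r - 1) * s)) = z (L (-1) r) s" for r
    proof -
      have "freq p r = real l - 2 * real r - 1" by (rule freq_eq)
      thus "z (log_chi p a) s * exp (pi * \<i> * of_real (real l - 2 * real r - 1) * s) = z (L 1 r) s"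
        "z (log_chi p a) s * exp (- (pi * \<i> * of_real (real l - 2 * real r - 1) * s)) = z (L (-1) r) s"
        by (simp_all add: z_def L_def zeta_ratio_exp_def ratio_exp_def mult.assoc flip: exp_add) (simp_all add: algebra_simps)
    qed
    have "(-1) ^ m * of_real ((2 * pi) powr (- w)) * mellin_zeta (- s) = z (log_chi p a) s * dirichlet_kernel l s"
      unfolding z_def log_chi_def using \<sigma> t by (intro mellin_zeta_reflected) (auto simp: s_def)
    also have "\<dots> = (\<Sum>r<l div 2. z (L 1 r) s + z (L (-1) r) s) + (if odd l then 1 else 0) * z (log_chi p a) s"
      unfolding dirichlet_kernel_def by (simp only: distrib_left sum_distrib_left shift mult.commute[of "z (log_chi p a) s" "if odd l then 1 else 0"])
    finally show "(-1) ^ m * of_real ((2 * pi) powr (- w)) * mellin_zeta (- Complex \<sigma> t) = 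
      (\<Sum>r<l div 2. z (L 1 r) (Complex \<sigma> t) + z (L (-1) r) (Complex \<sigma> t)) + (if odd l then 1 else 0) * z (log_chi p a) (Complex \<sigma> t)"
      by (simp only: s_def)
  qed
  also have "\<dots> = line_integral \<sigma> (\<lambda>s. \<Sum>r<l div 2. z (L 1 r) s + z (L (-1) r) s) + line_integral \<sigma> (\<lambda>s. (if odd l then 1 else 0) * z (log_chi p a) s)"
    using int int0 by (intro line_integral_add Bochner_Integration.integrable_sum Bochner_Integration.integrable_add integrable_mult_right) auto
  also have "line_integral \<sigma> (\<lambda>s. \<Sum>r<l div 2. z (L 1 r) s + z (L (-1) r) s) = (\<Sum>r<l div 2. line_integral \<sigma> (\<lambda>s. z (L 1 r) s + z (L (-1) r) s))"
    using int by (intro line_integral_sum Bochner_Integration.integrable_add) auto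
  also have "\<dots> = (\<Sum>r<l div 2. line_integral \<sigma> (z (L 1 r)) + line_integral \<sigma> (z (L (-1) r)))"
    using int by (intro sum.cong line_integral_add refl) auto
  also have "line_integral \<sigma> (\<lambda>s. (if odd l then 1 else 0) * z (log_chi p a) s) = (if odd l then 1 else 0) * line_integral \<sigma> (z (log_chi p a))"
    by (rule line_integral_cmult)
  finally have eq: "(-1) ^ m * of_real ((2 * pi) powr (- w)) * line_integral \<sigma> (\<lambda>s. mellin_zeta (- s)) =
     (\<Sum>r<l div 2. line_integral \<sigma> (z (L 1 r)) + line_integral \<sigma> (z (L (-1) r))) + (if odd l then 1 else 0) * line_integral \<sigma> (z (log_chi p a))" .
  have "line_integral \<sigma> (\<lambda>s. Gamma (- s) * zeta (of_real w - of_real (real p) * s) * a powr s) = line_integral \<sigma> (\<lambda>s. mellin_zeta (- s))"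
    using a_nz by (simp add: mellin_zeta_def powr_def mult_ac)
  hence "I_L \<sigma> m (real p) w a = 1 / (2 * pi * \<i>) * ((-1) ^ m * of_real ((2 * pi) powr (- w)) * line_integral \<sigma> (\<lambda>s. mellin_zeta (- s)))"
    unfolding I_L_def by (simp only:) simp
  also have "\<dots> = (\<Sum>r<l div 2. 1 / (2 * pi * \<i>) * line_integral \<sigma> (z (L 1 r)) + 1 / (2 * pi * \<i>) * line_integral \<sigma> (z (L (-1) r))) + 
      (if odd l then 1 else 0) * (1 / (2 * pi * \<i>) * line_integral \<sigma> (z (log_chi p a)))"
    unfolding eq by (simp only: distrib_left sum_distrib_left mult.left_commute)
  finally show ?thesis unfolding E_fun_def J_pm_eq E_hat_eq z_def L_def by simp
qed

text \<open>The poles of \<open>\<Gamma>(-s)\<close> at integers beyond \<open>K\<close> may lie to the left of \<open>\<sigma>\<close>, but after reflection the integrand is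
holomorphic to the right of \<open>w / p\<close>; hence the line may first be moved to an abscissa below \<open>K + 1\<close>.\<close>

theorem S_series_eq:
  assumes K: "K = nat \<lfloor>w / real p\<rfloor>" and \<sigma>: "\<sigma> > w / real p"
  shows "S_series (real p) a w =
          of_real (1 / real p * Gamma ((1 - w) / real p)) * a powr of_real ((w - 1) / real p)
          + (\<Sum>k=0..K. (-1) ^ k / fact k * zeta (of_real (w - real p * real k)) * a ^ k)
          + (-1) ^ m * of_real ((2 * pi) powr w) * I_L \<sigma> m (real p) w a"
proof -
  have w0: "0 \<le> w / real p" using w by simp
  have K1: "real K \<le> w / real p" "w / real p < real K + 1"
    using w0 of_int_floor_le[of "w / real p"] floor_correct[of "w / real p"] by (auto simp: K of_nat_nat)
  obtain \<tau> where \<tau>: "w / real p < \<tau>" "\<tau> < min \<sigma> (real K + 1)"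
    using dense[of "w / real p" "min \<sigma> (real K + 1)"] K1 \<sigma> by auto
  have "J_pm \<tau> e (real p) w r a = J_pm \<sigma> e (real p) w r a" if "\<bar>e\<bar> = 1" "r < l div 2" for e r
    unfolding J_pm_eq using line_integral_zeta_ratio_exp_shift[OF p_pos Im_log_chi_rotated[OF that] \<tau>(1), of \<sigma>] \<tau> by simp
  hence "E_fun \<tau> (real p) w r a = E_fun \<sigma> (real p) w r a" if "r < l div 2" for r
    using that by (simp add: E_fun_def)
  moreover have "E_hat \<tau> (real p) w a = E_hat \<sigma> (real p) w a"
    unfolding E_hat_eq using line_integral_zeta_ratio_exp_shift[OF p_pos Im_log_chi \<tau>(1), of \<sigma>] \<tau> by simp
  ultimately have same: "I_L \<tau> m (real p) w a = I_L \<sigma> m (real p) w a"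
    unfolding I_L_eq_sum_E[OF \<sigma>] I_L_eq_sum_E[OF \<tau>(1)] by simp
  define R where "R = of_real (1 / real p * Gamma ((1 - w) / real p)) * a powr of_real ((w - 1) / real p) +
      (\<Sum>k=0..K. (-1) ^ k / fact k * zeta (of_real (w - real p * real k)) * a ^ k)"
  have "line_integral \<tau> (\<lambda>s. Gamma (- s) * zeta (of_real w - of_real (real p) * s) * a powr s) = line_integral \<tau> (\<lambda>s. mellin_zeta (- s))"
    using a_nz by (simp add: mellin_zeta_def powr_def mult_ac)
  also have "\<dots> = line_integral (- \<tau>) mellin_zeta" by (rule line_integral_reflect)
  finally have IL: "I_L \<tau> m (real p) w a = (-1) ^ m * of_real ((2 * pi) powr (- w)) / (2 * pi * \<i>) * line_integral (- \<tau>) mellin_zeta"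
    unfolding I_L_def by (simp only:)
  have "(-1) ^ m * of_real ((2 * pi) powr w) * I_L \<tau> m (real p) w a = 
     (((-1) ^ m * (-1) ^ m) * (of_real ((2 * pi) powr w) * of_real ((2 * pi) powr (- w)))) * (line_integral (- \<tau>) mellin_zeta / (2 * pi * \<i>))"
    unfolding IL by (simp only: divide_inverse mult_ac)
  also have "((-1) ^ m * (-1) ^ m) * (of_real ((2 * pi) powr w) * of_real ((2 * pi) powr (- w))) = (1 :: complex)"
    by (simp add: powr_minus flip: of_real_mult power_mult_distrib)
  finally have "(-1) ^ m * of_real ((2 * pi) powr w) * I_L \<tau> m (real p) w a = line_integral (- \<tau>) mellin_zeta / (2 * pi * \<i>)" by simp
  moreover have "S_series (real p) a w = R + line_integral (- \<tau>) mellin_zeta / (2 * pi * \<i>)"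
    using mellin_zeta_shift[OF K1(1) \<tau>(1)] \<tau>(2) line_integral_mellin_zeta_right unfolding R_def[symmetric]
    by (simp add: field_simps)
  ultimately show ?thesis unfolding same by (simp add: R_def)
qed

end

section \<open>Sharp bounds for the Cahen-Mellin integrand\<close>

lemma integrable_Mellin_Gamma:
  assumes Y: "\<bar>Im Y\<bar> < pi / 2" and x: "x > 0 \<or> x = - 1/2"
  shows "integrable lborel (\<lambda>t. Mellin_Gamma Y (Complex x t))"
proof (rule integrable_on_line[OF _ strip_bound_Mellin_Gamma[OF Y]])
  have "Mellin_Gamma Y holomorphic_on (- \<int>\<^sub>\<le>\<^sub>0)"
    unfolding Mellin_Gamma_def by (intro holomorphic_intros) auto
  thus "continuous_on UNIV (\<lambda>t. Mellin_Gamma Y (Complex x t))"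
  proof (rule continuous_on_line_holomorphic)
    fix t
    show "Complex x t \<in> - \<int>\<^sub>\<le>\<^sub>0"
    proof
      assume "Complex x t \<in> \<int>\<^sub>\<le>\<^sub>0"
      then obtain n where "Complex x t = - of_nat n" by (auto elim!: nonpos_Ints_cases')
      hence n: "x = - real n" by (simp add: complex_eq_iff)
      hence "real (2 * n) = real 1" using x by auto
      hence "2 * n = 1" by (simp only: of_nat_eq_iff)
      thus False by presburger
    qed
  qed
qed (use Y in auto)

text \<open>An elementary form of the upper bound in Stirling's formula.\<close>

lemma fact_le_power: "n \<ge> 1 \<Longrightarrow> (fact n :: real) \<le> real n ^ Suc n * exp (1 - real n)"
proof (induction n rule: dec_induct)
  case base
  show ?case by simp
next
  case (step n)
  have n: "real n > 0" using step by simp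
  have "1 - 1 / real (Suc n) \<le> exp (- (1 / real (Suc n)))"
    using exp_ge_add_one_self[of "- (1 / real (Suc n))"] by simp
  hence "(real n / real (Suc n)) ^ Suc n \<le> exp (- (1 / real (Suc n))) ^ Suc n"
    using n by (intro power_mono) (auto simp: field_simps)
  also have "\<dots> = exp (real (Suc n) * (- (1 / real (Suc n))))" by (rule exp_of_nat_mult[symmetric])
  also have "real (Suc n) * (- (1 / real (Suc n))) = - 1" by simp
  finally have le: "real n ^ Suc n \<le> exp (- 1) * real (Suc n) ^ Suc n"
    by (simp only: power_divide) (simp add: field_simps del: of_nat_Suc power_Suc)
  have "(fact (Suc n) :: real) = real (Suc n) * fact n" by simp
  also have "\<dots> \<le> real (Suc n) * (real n ^ Suc n * exp (1 - real n))" using step by (intro mult_left_mono) auto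
  also have "\<dots> \<le> real (Suc n) * ((exp (- 1) * real (Suc n) ^ Suc n) * exp (1 - real n))"
    by (intro mult_left_mono mult_right_mono le) auto
  also have "\<dots> = real (Suc n) ^ Suc (Suc n) * (exp (- 1) * exp (1 - real n))" by simp
  also have "exp (- 1) * exp (1 - real n) = exp (1 - real (Suc n))" by (simp flip: exp_add)
  finally show ?case .
qed

lemma fact_div_power_le:
  fixes u :: real
  assumes u: "u \<ge> 1" and n: "u \<le> real n" "real n \<le> u + 1"
  shows "fact (Suc n) / u ^ (n + 2) \<le> 6 * exp 3 * exp (- u)"
proof -
  have n1: "n \<ge> 1" using u n by linarith
  have "real n \<le> u * exp (1 / u)"
  proof -
    have "1 + 1 / u \<le> exp (1 / u)" by (rule exp_ge_add_one_self)
    hence "u * (1 + 1 / u) \<le> u * exp (1 / u)" using u by (intro mult_left_mono) auto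
    moreover have "u * (1 + 1 / u) = u + 1" using u by (simp add: distrib_left)
    ultimately show ?thesis using n by linarith
  qed
  hence "real n ^ n \<le> (u * exp (1 / u)) ^ n" by (intro power_mono) auto
  also have "\<dots> = u ^ n * exp (real n * (1 / u))" by (simp only: power_mult_distrib exp_of_nat_mult)
  also have "\<dots> \<le> u ^ n * exp 2"
  proof -
    have "real n * (1 / u) \<le> 2" using n u by (simp add: field_simps)
    thus ?thesis using u by (intro mult_left_mono) auto
  qed
  finally have nn: "real n ^ n \<le> u ^ n * exp 2" .
  have "(fact (Suc n) :: real) = (real n + 1) * fact n" by simp
  also have "\<dots> \<le> (real n + 1) * (real n ^ Suc n * exp (1 - real n))"
    using fact_le_power[OF n1] by (intro mult_left_mono) auto
  also have "\<dots> = ((real n + 1) * real n) * real n ^ n * exp (1 - real n)" by simp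
  also have "\<dots> \<le> ((3 * u) * (2 * u)) * (u ^ n * exp 2) * exp (1 - u)"
    using n u nn by (intro mult_mono) auto
  also have "\<dots> = 6 * (exp 2 * exp (1 - u)) * u ^ (n + 2)" by (simp add: power2_eq_square power_add)
  also have "exp 2 * exp (1 - u) = exp 3 * exp (- u)" by (simp flip: exp_add)
  finally show ?thesis using u by (simp add: field_simps)
qed

lemma norm_Mellin_Gamma_le:
  assumes Y: "\<bar>Im Y\<bar> < pi / 2" and n: "n \<ge> 1"
  shows "norm (Mellin_Gamma Y (Complex (real n) t)) \<le> exp (2 * Re Y) * (fact (Suc n) / Re (exp Y) ^ (n + 2)) * (1 / (1 + t\<^sup>2))"
proof -
  define v where "v = Complex (real n) t"
  define c where "c = cos (Im Y)"
  have c: "c > 0" using Y by (auto simp: c_def intro!: cos_gt_zero_pi)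
  have pos: "1 + t\<^sup>2 > 0" by (simp add: add_pos_nonneg)
  have nz: "v \<notin> \<int>\<^sub>\<le>\<^sub>0" "v + 1 \<notin> \<int>\<^sub>\<le>\<^sub>0" using n by (auto simp: v_def intro!: not_nonpos_Ints_if_Re_pos)
  have "Gamma (v + 2) = (v + 1) * v * Gamma v"
    using Gamma_plus1[OF nz(1)] Gamma_plus1[OF nz(2)] by (simp add: add.assoc)
  hence eq: "norm (Gamma (v + 2)) = norm (v + 1) * norm v * norm (Gamma v)" by (simp add: norm_mult)
  have sq: "sqrt (1 + t\<^sup>2) \<le> norm v" "sqrt (1 + t\<^sup>2) \<le> norm (v + 1)"
    using n by (auto simp: v_def cmod_def intro!: real_sqrt_le_mono one_le_power)
  have "(1 + t\<^sup>2) = sqrt (1 + t\<^sup>2) * sqrt (1 + t\<^sup>2)" using pos by simp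
  also have "\<dots> \<le> norm (v + 1) * norm v" using sq pos by (intro mult_mono) auto
  finally have "(1 + t\<^sup>2) * norm (Gamma v) \<le> norm (Gamma (v + 2))"
    unfolding eq by (intro mult_right_mono) auto
  hence 1: "norm (Gamma v) \<le> norm (Gamma (v + 2)) * (1 / (1 + t\<^sup>2))" using pos by (simp add: field_simps)
  have "norm (Gamma (v + 2)) * exp (Im Y * Im (v + 2)) \<le> Gamma (Re (v + 2)) / cos (Im Y) powr Re (v + 2)"
    using Y by (intro norm_Gamma_le_rotated) (auto simp: v_def)
  also have "Re (v + 2) = real (Suc n) + 1" by (simp add: v_def)
  also have "Gamma (real (Suc n) + 1) = fact (Suc n)" by (subst Gamma_fact[symmetric]) (simp add: add_ac)
  also have "cos (Im Y) powr (real (Suc n) + 1) = c ^ (n + 2)"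
    using c powr_realpow[OF c, of "n + 2"] by (simp add: c_def add_ac)
  finally have 2: "norm (Gamma (v + 2)) * exp (Im Y * t) \<le> fact (Suc n) / c ^ (n + 2)" by (simp add: v_def)
  have e: "norm (exp (- Y * v)) = exp (- (real n * Re Y)) * exp (Im Y * t)"
    by (simp add: v_def algebra_simps flip: exp_add)
  have "norm (Mellin_Gamma Y v) = norm (Gamma v) * (exp (- (real n * Re Y)) * exp (Im Y * t))"
    unfolding Mellin_Gamma_def norm_mult e ..
  also have "\<dots> \<le> (norm (Gamma (v + 2)) * (1 / (1 + t\<^sup>2))) * (exp (- (real n * Re Y)) * exp (Im Y * t))"
    by (intro mult_right_mono 1) auto
  also have "\<dots> = exp (- (real n * Re Y)) * (norm (Gamma (v + 2)) * exp (Im Y * t)) * (1 / (1 + t\<^sup>2))" by (simp add: mult_ac)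
  also have "\<dots> \<le> exp (- (real n * Re Y)) * (fact (Suc n) / c ^ (n + 2)) * (1 / (1 + t\<^sup>2))"
    using pos by (intro mult_right_mono mult_left_mono 2) auto
  also have "exp (- (real n * Re Y)) * (fact (Suc n) / c ^ (n + 2)) = exp (2 * Re Y) * (fact (Suc n) / Re (exp Y) ^ (n + 2))"
  proof -
    have "Re (exp Y) ^ (n + 2) = exp (Re Y) ^ (n + 2) * c ^ (n + 2)" by (simp only: Re_exp c_def power_mult_distrib)
    also have "exp (Re Y) ^ (n + 2) = exp (real (n + 2) * Re Y)" by (rule exp_of_nat_mult[symmetric])
    also have "real (n + 2) * Re Y = 2 * Re Y + real n * Re Y" by (simp add: algebra_simps)
    finally have "Re (exp Y) ^ (n + 2) = exp (2 * Re Y) * exp (real n * Re Y) * c ^ (n + 2)" by (simp only: exp_add)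
    moreover have "inverse F * (f / C) = E * (f / (E * F * C))" if "E \<noteq> 0" for E F C f :: real
      using that by (simp add: divide_inverse)
    ultimately show ?thesis unfolding exp_minus by (simp only: exp_not_eq_zero simp_thms)
  qed
  finally show ?thesis by (simp add: v_def)
qed

text \<open>On this line the reflection formula gives the exact decay, without the loss of \<open>strip_bound_Gamma\<close>.\<close>

lemma norm_Gamma_half_line_le: "norm (Gamma (Complex (1/2) t)) \<le> sqrt (2 * pi) * exp (- (pi / 2) * \<bar>t\<bar>)"
proof -
  define z where "z = Complex (1/2) t"
  have "1 - z = cnj z" by (simp add: z_def complex_eq_iff)
  hence "Gamma z * Gamma (cnj z) = of_real pi / sin (of_real pi * z)" using Gamma_reflection_complex[of z] by simp
  moreover have "Gamma (cnj z) = cnj (Gamma z)" by (rule cnj_Gamma[symmetric])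
  ultimately have "of_real ((norm (Gamma z))\<^sup>2) = of_real pi / sin (of_real pi * z)"
    by (simp add: complex_norm_square flip: of_real_power)
  also have "sin (of_real pi * z) = of_real (cosh (pi * t))"
  proof -
    have "of_real pi * z = of_real pi / 2 + \<i> * of_real (pi * t)" by (simp add: z_def complex_eq_iff)
    hence "sin (of_real pi * z) = cos (\<i> * of_real (pi * t))"
      by (metis add_diff_cancel_left' cos_sin_eq cos_minus diff_add_cancel diff_diff_eq2 minus_diff_eq)
    also have "\<dots> = of_real (cosh (pi * t))"
      by (simp add: cos_exp_eq cosh_def exp_of_real flip: of_real_mult of_real_minus)
    finally show ?thesis .
  qed
  finally have "(norm (Gamma z))\<^sup>2 = pi / cosh (pi * t)" by (simp only: of_real_eq_iff flip: of_real_divide)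
  also have "\<dots> \<le> 2 * pi * exp (- pi * \<bar>t\<bar>)"
  proof -
    have "exp (pi * \<bar>t\<bar>) / 2 \<le> cosh (pi * t)"
      by (cases "t \<ge> 0") (auto simp: cosh_def)
    hence "pi / cosh (pi * t) \<le> pi / (exp (pi * \<bar>t\<bar>) / 2)" by (intro divide_left_mono mult_pos_pos) (auto simp: cosh_real_pos)
    thus ?thesis by (simp add: exp_minus field_simps)
  qed
  also have "\<dots> = (sqrt (2 * pi) * exp (- (pi / 2) * \<bar>t\<bar>))\<^sup>2"
    by (simp add: power_mult_distrib flip: exp_double)
  finally show ?thesis unfolding z_def by (rule power2_le_imp_le) simp
qed

section \<open>Line integrals of inverse factorial series\<close>

lemma line_integral_translate: "line_integral \<sigma> (\<lambda>v. f (v - of_nat j)) = line_integral (\<sigma> - real j) f"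
proof -
  have "Complex \<sigma> t - of_nat j = Complex (\<sigma> - real j) t" for t by (simp add: complex_eq_iff)
  thus ?thesis by (simp add: line_integral_def)
qed

lemma norm_line_integral_le:
  assumes "\<And>t. norm (f (Complex \<sigma> t)) \<le> C * (1 / (1 + t\<^sup>2))"
  shows "norm (line_integral \<sigma> f) \<le> C * (LINT t|lborel. 1 / (1 + t\<^sup>2))"
proof (cases "integrable lborel (\<lambda>t. f (Complex \<sigma> t) * \<i>)")
  case True
  have "norm (line_integral \<sigma> f) \<le> (LINT t|lborel. norm (f (Complex \<sigma> t) * \<i>))"
    unfolding line_integral_def by (rule integral_norm_bound)
  also have "\<dots> \<le> (LINT t|lborel. C * (1 / (1 + t\<^sup>2)))"
    using True assms by (intro integral_mono integrable_norm integrable_mult_right integrable_inverse_1_plus_square_UNIV) (auto simp: norm_mult)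
  also have "\<dots> = C * (LINT t|lborel. 1 / (1 + t\<^sup>2))" by (rule integral_mult_right_zero)
  finally show ?thesis .
next
  case False
  have "0 \<le> C" using order_trans[OF norm_ge_zero assms[of 0]] by simp
  moreover have "(LINT t|lborel. 1 / (1 + t\<^sup>2 :: real)) \<ge> 0" by (intro Bochner_Integration.integral_nonneg) (auto simp: add_nonneg_nonneg)
  moreover have "line_integral \<sigma> f = 0"
    unfolding line_integral_def by (rule not_integrable_integral_eq[OF False])
  ultimately show ?thesis by simp
qed

lemma line_integral_remainder:
  assumes Y: "\<bar>Im Y\<bar> < pi / 2" and F: "integrable lborel (\<lambda>t. F (Complex \<sigma> t) * exp (- Y * Complex \<sigma> t))"
    and \<sigma>: "\<And>j. j < M \<Longrightarrow> \<sigma> - real j > 0 \<or> \<sigma> - real j = -1/2"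
  shows "line_integral \<sigma> (\<lambda>v. (F v - (\<Sum>j<M. d j * Gamma (v - of_nat j))) * exp (- Y * v)) =
     line_integral \<sigma> (\<lambda>v. F v * exp (- Y * v)) - 
     (\<Sum>j<M. d j * (exp (- of_nat j * Y) * line_integral (\<sigma> - real j) (Mellin_Gamma Y)))"
proof -
  have e: "Gamma (v - of_nat j) * exp (- Y * v) = exp (- of_nat j * Y) * Mellin_Gamma Y (v - of_nat j)" for v j
    by (simp add: Mellin_Gamma_def algebra_simps flip: exp_add)
  have int: "integrable lborel (\<lambda>t. d j * (exp (- of_nat j * Y) * Mellin_Gamma Y (Complex \<sigma> t - of_nat j)))" if "j < M" for j
  proof -
    have "Complex \<sigma> t - of_nat j = Complex (\<sigma> - real j) t" for t by (simp add: complex_eq_iff)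
    thus ?thesis using integrable_Mellin_Gamma[OF Y \<sigma>[OF that]] by (intro integrable_mult_right) simp
  qed
  have intS: "integrable lborel (\<lambda>t. (-1) * (\<Sum>j<M. d j * (exp (- of_nat j * Y) * Mellin_Gamma Y (Complex \<sigma> t - of_nat j))))"
    by (intro integrable_mult_right Bochner_Integration.integrable_sum int) auto
  have "(F v - (\<Sum>j<M. d j * Gamma (v - of_nat j))) * exp (- Y * v) =
      F v * exp (- Y * v) + (-1) * (\<Sum>j<M. d j * (exp (- of_nat j * Y) * Mellin_Gamma Y (v - of_nat j)))" for v
  proof -
    have "(\<Sum>j<M. d j * Gamma (v - of_nat j)) * exp (- Y * v) = (\<Sum>j<M. d j * (exp (- of_nat j * Y) * Mellin_Gamma Y (v - of_nat j)))"
      by (simp only: sum_distrib_right mult.assoc e)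
    thus ?thesis by (simp add: left_diff_distrib)
  qed
  hence "line_integral \<sigma> (\<lambda>v. (F v - (\<Sum>j<M. d j * Gamma (v - of_nat j))) * exp (- Y * v)) =
      line_integral \<sigma> (\<lambda>v. F v * exp (- Y * v)) + line_integral \<sigma> (\<lambda>v. (-1) * (\<Sum>j<M. d j * (exp (- of_nat j * Y) * Mellin_Gamma Y (v - of_nat j))))"
    by (simp only:) (rule line_integral_add[OF F intS])
  also have "line_integral \<sigma> (\<lambda>v. (-1) * (\<Sum>j<M. d j * (exp (- of_nat j * Y) * Mellin_Gamma Y (v - of_nat j)))) =
      (-1) * (\<Sum>j<M. line_integral \<sigma> (\<lambda>v. d j * (exp (- of_nat j * Y) * Mellin_Gamma Y (v - of_nat j))))"
    using int by (subst line_integral_cmult, subst line_integral_sum) auto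
  also have "(\<Sum>j<M. line_integral \<sigma> (\<lambda>v. d j * (exp (- of_nat j * Y) * Mellin_Gamma Y (v - of_nat j)))) =
     (\<Sum>j<M. d j * (exp (- of_nat j * Y) * line_integral (\<sigma> - real j) (Mellin_Gamma Y)))"
    by (simp only: line_integral_cmult line_integral_translate)
  finally show ?thesis by simp
qed

text \<open>The expansion is carried \<open>N > M\<close> terms far, and the additional terms are absorbed into the bound. For the remainder
integral the abscissa is adapted to \<open>u = Re (exp Y)\<close>: for large \<open>u\<close> it is close to \<open>u\<close>, where the factorial over a
power of \<open>u\<close> in \<open>norm_Mellin_Gamma_le\<close> is of order \<open>exp (- u)\<close> up to powers of \<open>u\<close>. For bounded \<open>u\<close> the factor
\<open>exp (- u)\<close> is harmless, and a fixed line suffices, as there the exact decay of \<open>\<Gamma>\<close> leaves an integral that stays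
bounded up to \<open>\<bar>Im Y\<bar> = \<pi> / 2\<close>.\<close>

theorem inverse_Mellin_factorial_expansion:
  fixes F :: "complex \<Rightarrow> complex" and d :: "nat \<Rightarrow> complex"
  assumes hol: "F holomorphic_on {v. c0 < Re v}" and c: "c > c0"
    and sb: "\<And>Y a b. \<bar>Im Y\<bar> < pi / 2 \<Longrightarrow> \<exists>\<mu><0. strip_bound a b \<mu> (\<lambda>v. F v * exp (- Y * v))"
    and asy: "\<And>M. M > 0 \<Longrightarrow> \<exists>C B. \<forall>v. Re v > 0 \<and> norm v \<ge> B \<longrightarrow>
                norm (F v - (\<Sum>j<M. d j * Gamma (v - of_nat j))) \<le> C * norm (Gamma (v - of_nat M))"
  shows "\<exists>C X0. \<forall>Y. \<bar>Im Y\<bar> < pi / 2 \<and> exp (Re Y) \<ge> X0 \<longrightarrow>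
     norm (line_integral c (\<lambda>v. F v * exp (- Y * v)) - 2 * pi * \<i> * (\<Sum>j<M. d j * exp (- of_nat j * Y) * exp (- exp Y)))
       \<le> C * exp (- real M * Re Y) * exp (- Re (exp Y))"
proof -
  obtain n0 :: nat where n0: "real n0 \<ge> max (real M) c0" by (metis real_arch_simple)
  hence n0M: "M \<le> n0" "c0 \<le> real n0" by auto
  define N where "N = n0 + 2"
  define K1 where "K1 = (LINT t|lborel. 1 / (1 + t\<^sup>2 :: real))"
  have K1: "K1 \<ge> 0" unfolding K1_def by (intro Bochner_Integration.integral_nonneg) (auto simp: add_nonneg_nonneg)
  have "N > 0" by (simp add: N_def)
  from asy[OF this] obtain C0 B0 where CB0: "\<And>v. Re v > 0 \<Longrightarrow> norm v \<ge> B0 \<Longrightarrow>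
      norm (F v - (\<Sum>j<N. d j * Gamma (v - of_nat j))) \<le> C0 * norm (Gamma (v - of_nat N))" by blast
  define D where "D = (\<lambda>v. F v - (\<Sum>j<N. d j * Gamma (v - of_nat j)))"
  define C where "C = max C0 0"
  define B where "B = max B0 1"
  have CB: "norm (D v) \<le> C * norm (Gamma (v - of_nat N))" if "Re v > 0" "norm v \<ge> B" for v
  proof -
    have "norm (D v) \<le> C0 * norm (Gamma (v - of_nat N))" unfolding D_def using that by (intro CB0) (auto simp: B_def)
    also have "\<dots> \<le> C * norm (Gamma (v - of_nat N))" by (intro mult_right_mono) (auto simp: C_def)
    finally show ?thesis .
  qed
  have C: "C \<ge> 0" and B: "B \<ge> 1" by (auto simp: C_def B_def)
  define I where "I = (\<lambda>Y. line_integral c (\<lambda>v. F v * exp (- Y * v)))"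
  define E where "E = (\<lambda>Y. I Y - 2 * pi * \<i> * (\<Sum>j<N. d j * exp (- of_nat j * Y) * exp (- exp Y)))"
  have cont: "continuous_on UNIV (\<lambda>t. F (Complex \<sigma> t) * exp (- Y * Complex \<sigma> t))" if "\<sigma> > c0" for \<sigma> Y
    using that by (intro continuous_on_line_holomorphic[where A = "{v. c0 < Re v}" and f = "\<lambda>v. F v * exp (- Y * v)"] holomorphic_intros hol) auto
  have int: "integrable lborel (\<lambda>t. F (Complex \<sigma> t) * exp (- Y * Complex \<sigma> t))" if \<sigma>: "\<sigma> > c0" and Y: "\<bar>Im Y\<bar> < pi / 2" for \<sigma> Y
  proof -
    obtain \<mu> where "\<mu> < 0" "strip_bound \<sigma> \<sigma> \<mu> (\<lambda>v. F v * exp (- Y * v))" using sb[OF Y] by blast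
    thus ?thesis using integrable_on_line[OF cont[OF \<sigma>]] by blast
  qed
  have shift: "I Y = line_integral \<sigma> (\<lambda>v. F v * exp (- Y * v))" if \<sigma>: "\<sigma> > c0" and Y: "\<bar>Im Y\<bar> < pi / 2" for \<sigma> Y
  proof -
    obtain \<mu> where "\<mu> < 0" "strip_bound (min c \<sigma>) (max c \<sigma>) \<mu> (\<lambda>v. F v * exp (- Y * v))" using sb[OF Y] by blast
    moreover have "(\<lambda>v. F v * exp (- Y * v)) holomorphic_on {v. c0 < Re v \<and> Re v < max c \<sigma> + 1}"
      by (intro holomorphic_intros holomorphic_on_subset[OF hol]) auto
    ultimately have "line_integral (min c \<sigma>) (\<lambda>v. F v * exp (- Y * v)) = line_integral (max c \<sigma>) (\<lambda>v. F v * exp (- Y * v))"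
      using c \<sigma> by (intro line_integral_shift_holomorphic[of c0 "min c \<sigma>" "max c \<sigma>" "max c \<sigma> + 1"]) auto
    thus ?thesis unfolding I_def by (cases "c \<le> \<sigma>") (auto simp: min_def max_def)
  qed

  (* far from the imaginary axis: the line passes close to the saddle point *)
  have far: "norm (E Y) \<le> (C * K1 * 6 * exp 3) * exp (- real M * Re Y) * exp (- Re (exp Y))"
    if Y: "\<bar>Im Y\<bar> < pi / 2" and u: "Re (exp Y) \<ge> B" and r: "exp (Re Y) \<ge> 1" for Y
  proof -
    define n where "n = nat \<lceil>Re (exp Y)\<rceil>"
    have n: "Re (exp Y) \<le> real n" "real n \<le> Re (exp Y) + 1" "n \<ge> 1" using u B by (auto simp: n_def) linarith+
    define \<sigma> where "\<sigma> = real (n + N)"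
    have \<sigma>: "\<sigma> > c0" using n n0M by (simp add: \<sigma>_def N_def)
    have "line_integral (\<sigma> - real j) (Mellin_Gamma Y) = 2 * pi * \<i> * exp (- exp Y)" if "j < N" for j
      using that n by (intro Cahen_Mellin[OF Y]) (auto simp: \<sigma>_def)
    hence "(\<Sum>j<N. d j * (exp (- of_nat j * Y) * line_integral (\<sigma> - real j) (Mellin_Gamma Y))) =
        2 * pi * \<i> * (\<Sum>j<N. d j * exp (- of_nat j * Y) * exp (- exp Y))"
      by (simp add: sum_distrib_left mult_ac)
    hence "E Y = line_integral \<sigma> (\<lambda>v. D v * exp (- Y * v))"
      unfolding E_def D_def shift[OF \<sigma> Y] using n
      by (subst line_integral_remainder[OF Y int[OF \<sigma> Y]]) (auto simp: \<sigma>_def)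
    also have "norm \<dots> \<le> (C * exp (- real N * Re Y) * (exp (2 * Re Y) * (6 * exp 3 * exp (- Re (exp Y))))) * (LINT t|lborel. 1 / (1 + t\<^sup>2))"
    proof (rule norm_line_integral_le)
      fix t
      define v where "v = Complex \<sigma> t"
      have vN: "v - of_nat N = Complex (real n) t" by (simp add: v_def \<sigma>_def complex_eq_iff)
      have "\<sigma> \<le> norm v" using abs_Re_le_cmod[of v] by (simp add: v_def)
      moreover have "B \<le> \<sigma>" using u n by (simp add: \<sigma>_def)
      ultimately have "norm (D v) \<le> C * norm (Gamma (v - of_nat N))" using n by (intro CB) (auto simp: v_def \<sigma>_def)
      hence "norm (D v * exp (- Y * v)) \<le> C * norm (Gamma (v - of_nat N)) * norm (exp (- Y * v))"
        unfolding norm_mult by (intro mult_right_mono) auto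
      also have "norm (exp (- Y * v)) = norm (exp (- of_nat N * Y) * exp (- Y * (v - of_nat N)))" by (simp add: algebra_simps flip: exp_add)
      also have "C * norm (Gamma (v - of_nat N)) * \<dots> = C * exp (- real N * Re Y) * norm (Mellin_Gamma Y (v - of_nat N))"
        by (simp add: Mellin_Gamma_def norm_mult)
      also have "\<dots> \<le> C * exp (- real N * Re Y) * (exp (2 * Re Y) * (fact (Suc n) / Re (exp Y) ^ (n + 2)) * (1 / (1 + t\<^sup>2)))"
        unfolding vN using C n by (intro mult_left_mono norm_Mellin_Gamma_le Y) auto
      also have "\<dots> \<le> C * exp (- real N * Re Y) * (exp (2 * Re Y) * (6 * exp 3 * exp (- Re (exp Y))) * (1 / (1 + t\<^sup>2)))"
        using C n u B by (intro mult_left_mono mult_right_mono fact_div_power_le) auto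
      finally show "norm (D (Complex \<sigma> t) * exp (- Y * Complex \<sigma> t)) \<le> (C * exp (- real N * Re Y) * (exp (2 * Re Y) * (6 * exp 3 * exp (- Re (exp Y))))) * (1 / (1 + t\<^sup>2))"
        by (simp add: v_def mult.assoc)
    qed
    also have "\<dots> = (C * K1 * 6 * exp 3) * (exp (- real N * Re Y) * exp (2 * Re Y)) * exp (- Re (exp Y))"
      by (simp add: K1_def mult_ac)
    also have "exp (- real N * Re Y) * exp (2 * Re Y) = exp (- real n0 * Re Y)" by (simp add: N_def algebra_simps flip: exp_add)
    also have "(C * K1 * 6 * exp 3) * exp (- real n0 * Re Y) * exp (- Re (exp Y)) \<le> (C * K1 * 6 * exp 3) * exp (- real M * Re Y) * exp (- Re (exp Y))"
    proof -
      have "Re Y \<ge> 0" using r by simp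
      hence "real M * Re Y \<le> real n0 * Re Y" using n0M by (intro mult_right_mono) auto
      thus ?thesis using C K1 by (intro mult_right_mono mult_left_mono) auto
    qed
    finally show ?thesis .
  qed

  (* near the imaginary axis: a line on which the remainder decays like the integrand on the axis *)
  define c2 where "c2 = real n0 + 1 / 2"
  have c2: "c2 > c0" using n0M by (simp add: c2_def)
  obtain K2 where K2: "K2 \<ge> 0" "\<And>t. norm (D (Complex c2 t)) * exp (pi / 2 * \<bar>t\<bar>) \<le> K2 * (1 / (1 + t\<^sup>2))"
  proof -
    have contD: "continuous_on UNIV (\<lambda>t. D (Complex c2 t))"
    proof -
      have nz: "Complex c2 t - of_nat j \<notin> \<int>\<^sub>\<le>\<^sub>0" for t j
      proof
        assume "Complex c2 t - of_nat j \<in> \<int>\<^sub>\<le>\<^sub>0"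
        then obtain k where "Complex c2 t - of_nat j = - of_nat k" by (auto elim!: nonpos_Ints_cases')
        hence "real n0 + 1 / 2 - real j = - real k" by (simp add: complex_eq_iff c2_def)
        hence "2 * n0 + 1 + 2 * k = 2 * j" by linarith
        thus False by presburger
      qed
      have cG: "continuous_on UNIV (\<lambda>t. Gamma (Complex c2 t - of_nat j))" for j
        by (rule continuous_on_line_holomorphic[where A = "{v. v - of_nat j \<notin> \<int>\<^sub>\<le>\<^sub>0}" and f = "\<lambda>v. Gamma (v - of_nat j)"])
           (use nz in \<open>auto intro!: holomorphic_intros\<close>)
      have "continuous_on UNIV (\<lambda>t. F (Complex c2 t))"
        by (rule continuous_on_line_holomorphic[OF hol]) (use c2 in auto)
      thus ?thesis unfolding D_def by (intro continuous_intros cG)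
    qed
    define g where "g = (\<lambda>t. norm (D (Complex c2 t)) * exp (pi / 2 * \<bar>t\<bar>) * (1 + t\<^sup>2))"
    have "continuous_on {-B..B} g" unfolding g_def
      by (intro continuous_intros continuous_on_subset[OF contD]) auto
    hence "compact (g ` {-B..B})" by (intro compact_continuous_image) auto
    then obtain K where K: "\<And>t. t \<in> {-B..B} \<Longrightarrow> \<bar>g t\<bar> \<le> K"
      by (fastforce dest!: compact_imp_bounded simp: bounded_iff)
    have K0: "K \<ge> 0" using order_trans[OF abs_ge_zero K[of 0]] B by auto
    have outer: "g t \<le> 2 * C * sqrt (2 * pi)" if t: "\<bar>t\<bar> \<ge> B" for t
    proof -
      define v where "v = Complex c2 t"
      have t1: "\<bar>t\<bar> \<ge> 1" using t B by simp
      have "\<bar>t\<bar> \<le> norm v" using abs_Im_le_cmod[of v] by (simp add: v_def)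
      hence "norm (D v) \<le> C * norm (Gamma (v - of_nat N))" using t by (intro CB) (auto simp: v_def c2_def)
      moreover have "norm (Gamma (v - of_nat N)) * \<bar>t\<bar>\<^sup>2 \<le> norm (Gamma (Complex (1/2) t))"
      proof -
        have "v - of_nat N + of_nat 2 = Complex (1/2) t" by (simp add: v_def c2_def N_def complex_eq_iff)
        thus ?thesis using norm_Gamma_shift_le[of "v - of_nat N" 2] t1 by (auto simp: v_def)
      qed
      ultimately have "norm (D v) * t\<^sup>2 \<le> C * norm (Gamma (Complex (1/2) t))"
      proof -
        assume a1: "norm (D v) \<le> C * norm (Gamma (v - of_nat N))" and a2: "norm (Gamma (v - of_nat N)) * \<bar>t\<bar>\<^sup>2 \<le> norm (Gamma (Complex (1/2) t))"
        have "norm (D v) * t\<^sup>2 \<le> C * norm (Gamma (v - of_nat N)) * t\<^sup>2" using a1 by (intro mult_right_mono) auto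
        also have "\<dots> = C * (norm (Gamma (v - of_nat N)) * \<bar>t\<bar>\<^sup>2)" by simp
        also have "\<dots> \<le> C * norm (Gamma (Complex (1/2) t))" using a2 C by (intro mult_left_mono) auto
        finally show ?thesis .
      qed
      also have "\<dots> \<le> C * (sqrt (2 * pi) * exp (- (pi / 2) * \<bar>t\<bar>))" using C norm_Gamma_half_line_le by (intro mult_left_mono) auto
      finally have 1: "norm (D v) * t\<^sup>2 \<le> C * (sqrt (2 * pi) * exp (- (pi / 2) * \<bar>t\<bar>))" .
      have "1\<^sup>2 \<le> \<bar>t\<bar>\<^sup>2" using t1 by (rule power_mono) simp
      hence "1 + t\<^sup>2 \<le> 2 * t\<^sup>2" by simp
      hence "g t \<le> norm (D v) * exp (pi / 2 * \<bar>t\<bar>) * (2 * t\<^sup>2)" unfolding g_def v_def by (intro mult_left_mono) auto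
      also have "\<dots> = 2 * (norm (D v) * t\<^sup>2) * exp (pi / 2 * \<bar>t\<bar>)" by simp
      also have "\<dots> \<le> 2 * (C * (sqrt (2 * pi) * exp (- (pi / 2) * \<bar>t\<bar>))) * exp (pi / 2 * \<bar>t\<bar>)"
        using 1 by (intro mult_right_mono mult_left_mono) auto
      also have "\<dots> = 2 * C * sqrt (2 * pi) * (exp (- (pi / 2) * \<bar>t\<bar>) * exp (pi / 2 * \<bar>t\<bar>))" by simp
      also have "exp (- (pi / 2) * \<bar>t\<bar>) * exp (pi / 2 * \<bar>t\<bar>) = 1" by (simp flip: exp_add)
      finally show ?thesis by simp
    qed
    have "g t \<le> K + 2 * C * sqrt (2 * pi)" for t
    proof (cases "\<bar>t\<bar> \<le> B")
      case True
      hence "\<bar>g t\<bar> \<le> K" by (intro K) auto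
      moreover have "0 \<le> 2 * C * sqrt (2 * pi)" using C by simp
      ultimately show ?thesis by linarith
    next
      case False
      thus ?thesis using outer[of t] K0 by linarith
    qed
    moreover have "0 \<le> K + 2 * C * sqrt (2 * pi)" using K0 C by simp
    ultimately show ?thesis
      by (intro that[of "K + 2 * C * sqrt (2 * pi)"]) (auto simp: g_def field_simps add_pos_nonneg)
  qed
  have near: "norm (E Y) \<le> ((K2 * K1 + 2 * pi * norm (d (n0 + 1))) * exp B) * exp (- real M * Re Y) * exp (- Re (exp Y))"
    if Y: "\<bar>Im Y\<bar> < pi / 2" and u: "Re (exp Y) \<le> B" and r: "exp (Re Y) \<ge> 1" for Y
  proof -
    have r0: "Re Y \<ge> 0" using r by simp
    have L: "line_integral (c2 - real j) (Mellin_Gamma Y) = 2 * pi * \<i> * (exp (- exp Y) - (if j = n0 + 1 then 1 else 0))" if "j < N" for j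
    proof (cases "j = n0 + 1")
      case True
      thus ?thesis using Cahen_Mellin_left[OF Y, of 1 "c2 - real j"] by (simp add: c2_def)
    next
      case False
      hence "j \<le> n0" using that by (simp add: N_def)
      thus ?thesis using Cahen_Mellin[OF Y, of "c2 - real j"] by (simp add: c2_def)
    qed
    have "(\<Sum>j<N. d j * (exp (- of_nat j * Y) * line_integral (c2 - real j) (Mellin_Gamma Y))) =
        (\<Sum>j<N. 2 * pi * \<i> * (d j * exp (- of_nat j * Y) * exp (- exp Y)) - (if j = n0 + 1 then 2 * pi * \<i> * (d j * exp (- of_nat j * Y)) else 0))"
      by (intro sum.cong) (auto simp: L algebra_simps)
    also have "\<dots> = 2 * pi * \<i> * (\<Sum>j<N. d j * exp (- of_nat j * Y) * exp (- exp Y)) - 2 * pi * \<i> * (d (n0 + 1) * exp (- of_nat (n0 + 1) * Y))"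
    proof -
      have "(\<Sum>j<N. if j = n0 + 1 then 2 * pi * \<i> * (d j * exp (- of_nat j * Y)) else 0) = 2 * pi * \<i> * (d (n0 + 1) * exp (- of_nat (n0 + 1) * Y))"
        by (subst sum.delta) (auto simp: N_def)
      thus ?thesis by (simp only: sum_subtractf sum_distrib_left)
    qed
    finally have "E Y = line_integral c2 (\<lambda>v. D v * exp (- Y * v)) - 2 * pi * \<i> * (d (n0 + 1) * exp (- of_nat (n0 + 1) * Y))"
      unfolding E_def D_def shift[OF c2 Y]
      by (subst line_integral_remainder[OF Y int[OF c2 Y]]) (auto simp: c2_def N_def less_Suc_eq)
    hence "norm (E Y) \<le> norm (line_integral c2 (\<lambda>v. D v * exp (- Y * v))) + norm (2 * pi * \<i> * (d (n0 + 1) * exp (- of_nat (n0 + 1) * Y)))"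
      by (metis norm_triangle_ineq4)
    also have "norm (2 * pi * \<i> * (d (n0 + 1) * exp (- of_nat (n0 + 1) * Y))) = 2 * pi * norm (d (n0 + 1)) * exp (- real (n0 + 1) * Re Y)"
      by (simp add: norm_mult)
    also have "norm (line_integral c2 (\<lambda>v. D v * exp (- Y * v))) \<le> (K2 * exp (- c2 * Re Y)) * (LINT t|lborel. 1 / (1 + t\<^sup>2))"
    proof (rule norm_line_integral_le)
      fix t
      have "norm (exp (- Y * Complex c2 t)) = exp (- c2 * Re Y) * exp (Im Y * t)" by (simp add: algebra_simps flip: exp_add)
      also have "\<dots> \<le> exp (- c2 * Re Y) * exp (pi / 2 * \<bar>t\<bar>)"
      proof -
        have "Im Y * t \<le> \<bar>Im Y\<bar> * \<bar>t\<bar>" by (simp flip: abs_mult)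
        also have "\<dots> \<le> pi / 2 * \<bar>t\<bar>" using Y by (intro mult_right_mono) auto
        finally show ?thesis by (intro mult_left_mono) auto
      qed
      finally have "norm (D (Complex c2 t) * exp (- Y * Complex c2 t)) \<le> norm (D (Complex c2 t)) * (exp (- c2 * Re Y) * exp (pi / 2 * \<bar>t\<bar>))"
        unfolding norm_mult by (intro mult_left_mono) auto
      also have "\<dots> = exp (- c2 * Re Y) * (norm (D (Complex c2 t)) * exp (pi / 2 * \<bar>t\<bar>))" by simp
      also have "\<dots> \<le> exp (- c2 * Re Y) * (K2 * (1 / (1 + t\<^sup>2)))" using K2 by (intro mult_left_mono) auto
      finally show "norm (D (Complex c2 t) * exp (- Y * Complex c2 t)) \<le> (K2 * exp (- c2 * Re Y)) * (1 / (1 + t\<^sup>2))" by (simp add: mult_ac)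
    qed
    also have "(K2 * exp (- c2 * Re Y)) * (LINT t|lborel. 1 / (1 + t\<^sup>2)) + 2 * pi * norm (d (n0 + 1)) * exp (- real (n0 + 1) * Re Y)
       \<le> (K2 * K1) * exp (- real M * Re Y) + 2 * pi * norm (d (n0 + 1)) * exp (- real M * Re Y)"
    proof (intro add_mono)
      have "real M * Re Y \<le> c2 * Re Y" using n0M r0 by (intro mult_right_mono) (auto simp: c2_def)
      hence "(K2 * K1) * exp (- c2 * Re Y) \<le> (K2 * K1) * exp (- real M * Re Y)" using K1 K2 by (intro mult_left_mono) auto
      thus "(K2 * exp (- c2 * Re Y)) * (LINT t|lborel. 1 / (1 + t\<^sup>2)) \<le> (K2 * K1) * exp (- real M * Re Y)"
        by (simp add: K1_def mult_ac)
      have "real M * Re Y \<le> real (n0 + 1) * Re Y" using n0M r0 by (intro mult_right_mono) auto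
      hence "exp (- real (n0 + 1) * Re Y) \<le> exp (- real M * Re Y)"
        by (simp only: exp_le_cancel_iff mult_minus_left neg_le_iff_le)
      thus "2 * pi * norm (d (n0 + 1)) * exp (- real (n0 + 1) * Re Y) \<le> 2 * pi * norm (d (n0 + 1)) * exp (- real M * Re Y)"
        by (intro mult_left_mono) auto
    qed
    also have "\<dots> = (K2 * K1 + 2 * pi * norm (d (n0 + 1))) * exp (- real M * Re Y) * 1" by (simp add: algebra_simps)
    also have "\<dots> \<le> (K2 * K1 + 2 * pi * norm (d (n0 + 1))) * exp (- real M * Re Y) * (exp B * exp (- Re (exp Y)))"
    proof (rule mult_left_mono)
      have "1 \<le> exp (B - Re (exp Y))" unfolding one_le_exp_iff using u by (simp only: diff_ge_0_iff_ge)
      thus "1 \<le> exp B * exp (- Re (exp Y))" by (simp only: exp_diff exp_minus divide_inverse)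
      have "0 \<le> K2 * K1 + 2 * pi * norm (d (n0 + 1))"
        using K1 K2(1) by (intro add_nonneg_nonneg mult_nonneg_nonneg) auto
      thus "0 \<le> (K2 * K1 + 2 * pi * norm (d (n0 + 1))) * exp (- real M * Re Y)"
        by (rule mult_nonneg_nonneg) simp
    qed
    finally show ?thesis by (simp only: mult_ac)
  qed

  define K3 where "K3 = C * K1 * 6 * exp 3 + (K2 * K1 + 2 * pi * norm (d (n0 + 1))) * exp B"
  define K4 where "K4 = 2 * pi * (\<Sum>j\<in>{M..<N}. norm (d j))"
  have K30: "C * K1 * 6 * exp 3 \<ge> 0" "(K2 * K1 + 2 * pi * norm (d (n0 + 1))) * exp B \<ge> 0" using C K1 K2 by auto
  show ?thesis
  proof (rule exI[of _ "K3 + K4"], rule exI[of _ 1], intro allI impI)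
    fix Y assume "\<bar>Im Y\<bar> < pi / 2 \<and> 1 \<le> exp (Re Y)"
    hence Y: "\<bar>Im Y\<bar> < pi / 2" and r: "1 \<le> exp (Re Y)" by auto
    have r0: "Re Y \<ge> 0" using r by simp
    define P where "P = exp (- real M * Re Y) * exp (- Re (exp Y))"
    have P: "P > 0" by (simp add: P_def)
    have E: "norm (E Y) \<le> K3 * P"
    proof (cases "Re (exp Y) \<ge> B")
      case True
      have "norm (E Y) \<le> (C * K1 * 6 * exp 3) * P" using far[OF Y True r] by (simp add: P_def mult.assoc)
      also have "\<dots> \<le> K3 * P" unfolding K3_def using K30 P by (intro mult_right_mono) auto
      finally show ?thesis .
    next
      case False
      hence "Re (exp Y) \<le> B" by simp
      from near[OF Y this r] have "norm (E Y) \<le> ((K2 * K1 + 2 * pi * norm (d (n0 + 1))) * exp B) * P" by (simp only: P_def mult.assoc)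
      also have "\<dots> \<le> K3 * P" unfolding K3_def using K30 P by (intro mult_right_mono) auto
      finally show ?thesis .
    qed
    have tail: "norm (2 * pi * \<i> * (\<Sum>j\<in>{M..<N}. d j * exp (- of_nat j * Y) * exp (- exp Y))) \<le> K4 * P"
    proof -
      have "norm (\<Sum>j\<in>{M..<N}. d j * exp (- of_nat j * Y) * exp (- exp Y)) \<le> (\<Sum>j\<in>{M..<N}. norm (d j) * P)"
      proof (rule sum_norm_le)
        fix j assume j: "j \<in> {M..<N}"
        have "norm (d j * exp (- of_nat j * Y) * exp (- exp Y)) = norm (d j) * (exp (- real j * Re Y) * exp (- Re (exp Y)))"
          by (simp add: norm_mult)
        also have "\<dots> \<le> norm (d j) * P" unfolding P_def
        proof (intro mult_left_mono mult_right_mono)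
          have "real M * Re Y \<le> real j * Re Y" using j r0 by (intro mult_right_mono) auto
          thus "exp (- real j * Re Y) \<le> exp (- real M * Re Y)" by (simp only: exp_le_cancel_iff mult_minus_left neg_le_iff_le)
        qed auto
        finally show "norm (d j * exp (- of_nat j * Y) * exp (- exp Y)) \<le> norm (d j) * P" .
      qed
      also have "\<dots> = (\<Sum>j\<in>{M..<N}. norm (d j)) * P" by (rule sum_distrib_right[symmetric])
      finally have "2 * pi * norm (\<Sum>j\<in>{M..<N}. d j * exp (- of_nat j * Y) * exp (- exp Y)) \<le> 2 * pi * ((\<Sum>j\<in>{M..<N}. norm (d j)) * P)"
        by (rule mult_left_mono) simp
      moreover have "norm (2 * pi * \<i> * z) = 2 * pi * norm z" for z :: complex by (simp add: norm_mult)
      ultimately show ?thesis unfolding K4_def by (simp only: mult.assoc)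
    qed
    have "(\<Sum>j<N. d j * exp (- of_nat j * Y) * exp (- exp Y)) = (\<Sum>j<M. d j * exp (- of_nat j * Y) * exp (- exp Y)) + (\<Sum>j\<in>{M..<N}. d j * exp (- of_nat j * Y) * exp (- exp Y))"
    proof -
      have "{..<N} = {..<M} \<union> {M..<N}" using n0M by (auto simp: N_def)
      moreover have "sum f ({..<M} \<union> {M..<N}) = sum f {..<M} + sum f {M..<N}" for f :: "nat \<Rightarrow> complex"
        by (rule sum.union_disjoint) auto
      ultimately show ?thesis by metis
    qed
    hence "I Y - 2 * pi * \<i> * (\<Sum>j<M. d j * exp (- of_nat j * Y) * exp (- exp Y)) =
        E Y + 2 * pi * \<i> * (\<Sum>j\<in>{M..<N}. d j * exp (- of_nat j * Y) * exp (- exp Y))"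
      unfolding E_def by (simp only: distrib_left) simp
    hence "norm (I Y - 2 * pi * \<i> * (\<Sum>j<M. d j * exp (- of_nat j * Y) * exp (- exp Y))) \<le> K3 * P + K4 * P"
      by (simp only:) (rule norm_triangle_le, rule add_mono[OF E tail])
    hence "norm (I Y - 2 * pi * \<i> * (\<Sum>j<M. d j * exp (- of_nat j * Y) * exp (- exp Y))) \<le> (K3 + K4) * P"
      by (simp only: distrib_right)
    thus "norm (line_integral c (\<lambda>v. F v * exp (- Y * v)) - 2 * pi * \<i> * (\<Sum>j<M. d j * exp (- of_nat j * Y) * exp (- exp Y)))
       \<le> (K3 + K4) * exp (- real M * Re Y) * exp (- Re (exp Y))"
      by (simp only: I_def P_def mult.assoc)
  qed
qed

section \<open>Expansion of the exponentially small integrals\<close>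

lemma line_integral_scale:
  assumes "\<kappa> > 0"
  shows "line_integral (\<kappa> * \<sigma> + \<theta>) (\<lambda>v. f ((v - of_real \<theta>) / of_real \<kappa>)) = of_real \<kappa> * line_integral \<sigma> f"
proof -
  have "line_integral (\<kappa> * \<sigma> + \<theta>) (\<lambda>v. f ((v - of_real \<theta>) / of_real \<kappa>)) =
     \<bar>\<kappa>\<bar> *\<^sub>R (LINT t|lborel. f ((Complex (\<kappa> * \<sigma> + \<theta>) (0 + \<kappa> * t) - of_real \<theta>) / of_real \<kappa>) * \<i>)"
    unfolding line_integral_def using assms by (intro lborel_integral_real_affine) auto
  moreover have "(Complex (\<kappa> * \<sigma> + \<theta>) (0 + \<kappa> * t) - of_real \<theta>) / of_real \<kappa> = Complex \<sigma> t" for t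
    using assms by (simp add: complex_eq_iff)
  ultimately show ?thesis using assms by (simp add: line_integral_def scaleR_conv_of_real)
qed

text \<open>Only the right half plane is needed from the expansion, which lies in a single closed subsector; there the
remainder is measured by the modulus of the next gamma function.\<close>

lemma inverse_factorial_expansion_bound:
  assumes c: "inverse_factorial_coeffs p w c" and M: "M > 0"
    and A: "A_par p w \<noteq> 0" and q: "h_par p * kappa p powr kappa p > 0"
  shows "\<exists>C B. \<forall>s. Re s > 0 \<and> norm s \<ge> B \<longrightarrow>
     norm (of_real (2 * pi / A_par p w) * of_real (h_par p * kappa p powr kappa p) powr s * Gamma_ratio p w s
        - (\<Sum>j<M. (-1) ^ j * c j * Gamma (of_real (kappa p) * s + of_real (vartheta w) - of_nat j)))
     \<le> C * norm (Gamma (of_real (kappa p) * s + of_real (vartheta w) - of_nat M))"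
proof -
  obtain \<rho> where \<rho>: "\<And>\<epsilon>. 0 < \<epsilon> \<and> \<epsilon> < pi \<Longrightarrow>
        (\<forall>\<^sub>F s in closed_subsector_at_infinity \<epsilon>.
           Gamma_ratio p w s =
             of_real (A_par p w / (2 * pi)) * of_real (h_par p * kappa p powr kappa p) powr (- s) *
             ((\<Sum>j<M. (-1) ^ j * c j * Gamma (of_real (kappa p) * s + of_real (vartheta w) - of_nat j))
               + \<rho> s * Gamma (of_real (kappa p) * s + of_real (vartheta w) - of_nat M))) \<and>
        \<rho> \<in> O[closed_subsector_at_infinity \<epsilon>](\<lambda>_. 1)"
    using c M unfolding inverse_factorial_coeffs_def by blast
  have half: "0 < pi / 2 \<and> pi / 2 < pi" using pi_gt_zero by simp
  from \<rho>[OF half] obtain C where C: "\<forall>\<^sub>F s in closed_subsector_at_infinity (pi / 2). norm (\<rho> s) \<le> C * norm (1 :: complex)"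
    by (auto elim!: landau_o.bigE)
  from eventually_conj[OF conjunct1[OF \<rho>[OF half]] C] obtain B where B: "\<And>s. norm s \<ge> B \<Longrightarrow> \<bar>Arg s\<bar> \<le> pi - pi / 2 \<Longrightarrow>
       Gamma_ratio p w s =
             of_real (A_par p w / (2 * pi)) * of_real (h_par p * kappa p powr kappa p) powr (- s) *
             ((\<Sum>j<M. (-1) ^ j * c j * Gamma (of_real (kappa p) * s + of_real (vartheta w) - of_nat j))
               + \<rho> s * Gamma (of_real (kappa p) * s + of_real (vartheta w) - of_nat M)) \<and> norm (\<rho> s) \<le> C"
    unfolding closed_subsector_at_infinity_def eventually_inf_principal eventually_at_infinity by auto
  show ?thesis
  proof (rule exI[of _ C], rule exI[of _ B], intro allI impI)
    fix s assume s: "Re s > 0 \<and> norm s \<ge> B"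
    have s0: "s \<noteq> 0" using s by auto
    have "\<bar>Arg s\<bar> < pi / 2" using s Re_Ln_pos_lt[OF s0] by (simp add: Arg_eq_Im_Ln[OF s0])
    hence Bs: "Gamma_ratio p w s =
             of_real (A_par p w / (2 * pi)) * of_real (h_par p * kappa p powr kappa p) powr (- s) *
             ((\<Sum>j<M. (-1) ^ j * c j * Gamma (of_real (kappa p) * s + of_real (vartheta w) - of_nat j))
               + \<rho> s * Gamma (of_real (kappa p) * s + of_real (vartheta w) - of_nat M))" "norm (\<rho> s) \<le> C"
      using B[of s] s by auto
    have one: "of_real (2 * pi / A_par p w) * of_real (A_par p w / (2 * pi)) = (1 :: complex)"
      using A by (simp flip: of_real_mult)
    have qq: "of_real (h_par p * kappa p powr kappa p) powr s * of_real (h_par p * kappa p powr kappa p) powr (- s) = (1 :: complex)"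
    proof -
      have "u powr s * u powr (- s) = 1" if "u \<noteq> 0" for u :: complex using that by (simp add: powr_minus)
      moreover have "complex_of_real (h_par p * kappa p powr kappa p) \<noteq> 0" using q by (metis less_irrefl of_real_eq_0_iff)
      ultimately show ?thesis by blast
    qed
    have "of_real (2 * pi / A_par p w) * of_real (h_par p * kappa p powr kappa p) powr s * Gamma_ratio p w s =
       (of_real (2 * pi / A_par p w) * of_real (A_par p w / (2 * pi))) * (of_real (h_par p * kappa p powr kappa p) powr s * of_real (h_par p * kappa p powr kappa p) powr (- s)) *
             ((\<Sum>j<M. (-1) ^ j * c j * Gamma (of_real (kappa p) * s + of_real (vartheta w) - of_nat j))
               + \<rho> s * Gamma (of_real (kappa p) * s + of_real (vartheta w) - of_nat M))"
      unfolding Bs(1) by (simp only: mult_ac)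
    also have "\<dots> = (\<Sum>j<M. (-1) ^ j * c j * Gamma (of_real (kappa p) * s + of_real (vartheta w) - of_nat j))
               + \<rho> s * Gamma (of_real (kappa p) * s + of_real (vartheta w) - of_nat M)"
      unfolding one qq by simp
    finally have "of_real (2 * pi / A_par p w) * of_real (h_par p * kappa p powr kappa p) powr s * Gamma_ratio p w s
        - (\<Sum>j<M. (-1) ^ j * c j * Gamma (of_real (kappa p) * s + of_real (vartheta w) - of_nat j)) = 
        \<rho> s * Gamma (of_real (kappa p) * s + of_real (vartheta w) - of_nat M)" by simp
    thus "norm (of_real (2 * pi / A_par p w) * of_real (h_par p * kappa p powr kappa p) powr s * Gamma_ratio p w s
        - (\<Sum>j<M. (-1) ^ j * c j * Gamma (of_real (kappa p) * s + of_real (vartheta w) - of_nat j)))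
     \<le> C * norm (Gamma (of_real (kappa p) * s + of_real (vartheta w) - of_nat M))"
      using Bs(2) by (simp add: norm_mult mult_right_mono)
  qed
qed

definition logq :: "nat \<Rightarrow> real" where
  "logq p = ln (h_par (real p) * kappa (real p) powr kappa (real p))"

text \<open>This is \<open>ln X\<close> as a function of \<open>L = ln \<chi>\<close>: as \<open>X = \<kappa> (h \<chi>)^(1/\<kappa>)\<close>, the logarithm is affine in \<open>L\<close>, and rotations of
\<open>\<chi>\<close> beyond the principal range remain harmless.\<close>

definition log_X :: "nat \<Rightarrow> complex \<Rightarrow> complex" where
  "log_X p L = (L + of_real (logq p)) / of_real (kappa (real p))"

context
  fixes p :: nat and w :: real and c :: "nat \<Rightarrow> complex"
  assumes p2: "p \<ge> 2" and w2: "w \<ge> 1" and c: "inverse_factorial_coeffs (real p) w c"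
begin

abbreviation (input) "\<kappa> \<equiv> kappa (real p)"
abbreviation (input) "\<theta> \<equiv> vartheta w"

lemma kappa_ge_1: "\<kappa> \<ge> 1" using p2 by (simp add: kappa_def)

lemma q_pos: "h_par (real p) * \<kappa> powr \<kappa> > 0" and A_pos: "A_par (real p) w > 0"
  using kappa_ge_1 p2 by (auto simp: h_par_def A_par_def)

lemma Im_log_X: "\<bar>Im L\<bar> < \<kappa> * (pi / 2) \<longleftrightarrow> \<bar>Im (log_X p L)\<bar> < pi / 2"
  using kappa_ge_1 by (simp add: log_X_def abs_divide field_simps)

text \<open>The substitution \<open>v = \<kappa> s + \<theta>\<close> turns the arguments \<open>\<kappa> s + \<theta> - j\<close> of the gamma functions into \<open>v - j\<close>, and the parameter
\<open>L\<close> of the exponential into \<open>ln X\<close>.\<close>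

theorem line_integral_ratio_exp_asymptotic:
  assumes \<sigma>: "\<sigma> > (w - 1) / real p"
  shows "\<exists>C X0. \<forall>L. \<bar>Im L\<bar> < \<kappa> * (pi / 2) \<and> exp (Re (log_X p L)) \<ge> X0 \<longrightarrow>
     norm (1 / (2 * pi * \<i>) * line_integral \<sigma> (ratio_exp p w L) -
           of_real (A_par (real p) w / (2 * pi * \<kappa>)) * (\<Sum>j<M. (-1) ^ j * c j * exp (of_real (\<theta> - real j) * log_X p L) * exp (- exp (log_X p L))))
       \<le> C * exp ((\<theta> - real M) * Re (log_X p L)) * exp (- Re (exp (log_X p L)))"
proof -
  define a where "a = 2 * pi / A_par (real p) w"
  have a0: "a > 0" using A_pos by (simp add: a_def)
  have k0: "\<kappa> > 0" using kappa_ge_1 by simp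
  define F where "F = (\<lambda>v. of_real a * ratio_exp p w (- of_real (logq p)) ((v - of_real \<theta>) / of_real \<kappa>))"
  define c0 where "c0 = \<kappa> * ((w - 1) / real p) + \<theta>"
  have th: "\<theta> < 0" using w2 by (simp add: vartheta_def)
  have FY: "F v * exp (- Y * v) = (of_real a * exp (- of_real \<theta> * Y)) * ratio_exp p w (of_real \<kappa> * Y - of_real (logq p)) ((v - of_real \<theta>) / of_real \<kappa>)" for v Y
  proof -
    define s where "s = (v - of_real \<theta>) / of_real \<kappa>"
    have v: "v = of_real \<kappa> * s + of_real \<theta>" using k0 by (simp add: s_def)
    have "F v * exp (- Y * v) = of_real a * (Gamma_ratio p w s * exp (of_real (logq p) * s)) * exp (- Y * v)"
      by (simp add: F_def ratio_exp_def s_def)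
    also have "\<dots> = of_real a * Gamma_ratio p w s * (exp (of_real (logq p) * s) * exp (- Y * v))" by simp
    also have "exp (of_real (logq p) * s) * exp (- Y * v) = exp (- of_real \<theta> * Y) * exp (- (of_real \<kappa> * Y - of_real (logq p)) * s)"
      unfolding v by (simp add: algebra_simps flip: exp_add)
    finally show ?thesis by (simp add: ratio_exp_def s_def)
  qed
  have "\<exists>C X0. \<forall>Y. \<bar>Im Y\<bar> < pi / 2 \<and> exp (Re Y) \<ge> X0 \<longrightarrow>
     norm (line_integral (\<kappa> * \<sigma> + \<theta>) (\<lambda>v. F v * exp (- Y * v)) - 2 * pi * \<i> * (\<Sum>j<M. ((-1) ^ j * c j) * exp (- of_nat j * Y) * exp (- exp Y)))
       \<le> C * exp (- real M * Re Y) * exp (- Re (exp Y))"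
  proof (rule inverse_Mellin_factorial_expansion)
    have img: "(\<lambda>v. (v - of_real \<theta>) / of_real \<kappa>) ` {v. c0 < Re v} \<subseteq> {s. (w - 1) / real p < Re s}"
      using k0 by (auto simp: c0_def pos_less_divide_eq algebra_simps simp del: of_real_diff)
    have "(\<lambda>v. (v - of_real \<theta>) / of_real \<kappa>) holomorphic_on {v. c0 < Re v}" using k0 by (intro holomorphic_intros) auto
    from holomorphic_on_compose_gen[OF this ratio_exp_holomorphic img] p2
    show "F holomorphic_on {v. c0 < Re v}" unfolding F_def by (intro holomorphic_intros) (simp add: o_def)
    show "\<kappa> * \<sigma> + \<theta> > c0" unfolding c0_def using mult_strict_left_mono[OF \<sigma> k0] by linarith
    show "\<exists>\<mu><0. strip_bound x y \<mu> (\<lambda>v. F v * exp (- Y * v))" if Y: "\<bar>Im Y\<bar> < pi / 2" for Y x y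
    proof -
      define L where "L = of_real \<kappa> * Y - of_real (logq p)"
      have "\<bar>Im L\<bar> = \<kappa> * \<bar>Im Y\<bar>" using k0 by (simp add: L_def abs_mult)
      hence L: "\<bar>Im L\<bar> < \<kappa> * (pi / 2)" using Y k0 by simp
      have bnd: "(x - \<theta>) / \<kappa> \<le> - \<theta> / \<kappa> + (1 / \<kappa>) * t \<and> - \<theta> / \<kappa> + (1 / \<kappa>) * t \<le> (y - \<theta>) / \<kappa>" if "x \<le> t" "t \<le> y" for t
        using that k0 by (simp add: divide_simps)
      have "strip_bound x y ((\<bar>Im L\<bar> - \<kappa> * (pi / 2)) / 2 * \<bar>1 / \<kappa>\<bar>) (\<lambda>v. ratio_exp p w L (of_real (- \<theta> / \<kappa>) + of_real (1 / \<kappa>) * v))"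
        using p2 k0 by (intro strip_bound_affine[OF strip_bound_ratio_exp[OF _ L, where a = "(x - \<theta>) / \<kappa>" and b = "(y - \<theta>) / \<kappa>"]] bnd) auto
      hence "strip_bound x y ((\<bar>Im L\<bar> - \<kappa> * (pi / 2)) / 2 * \<bar>1 / \<kappa>\<bar>)
         (\<lambda>v. (of_real a * exp (- of_real \<theta> * Y)) * ratio_exp p w L (of_real (- \<theta> / \<kappa>) + of_real (1 / \<kappa>) * v))"
        by (rule strip_bound_cmult)
      moreover have "of_real (- \<theta> / \<kappa>) + of_real (1 / \<kappa>) * v = (v - of_real \<theta>) / of_real \<kappa>" for v :: complex
        by (simp add: diff_divide_distrib)
      ultimately have "strip_bound x y ((\<bar>Im L\<bar> - \<kappa> * (pi / 2)) / 2 * \<bar>1 / \<kappa>\<bar>) (\<lambda>v. F v * exp (- Y * v))"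
        unfolding FY L_def by simp
      moreover have "(\<bar>Im L\<bar> - \<kappa> * (pi / 2)) / 2 * \<bar>1 / \<kappa>\<bar> < 0"
      proof (rule mult_neg_pos)
        show "(\<bar>Im L\<bar> - \<kappa> * (pi / 2)) / 2 < 0" by (rule divide_neg_pos, subst diff_less_0_iff_less, rule L, simp)
        show "0 < \<bar>1 / \<kappa>\<bar>" using k0 by simp
      qed
      ultimately show ?thesis by blast
    qed
    show "\<exists>C B. \<forall>v. Re v > 0 \<and> norm v \<ge> B \<longrightarrow>
          norm (F v - (\<Sum>j<N. ((-1) ^ j * c j) * Gamma (v - of_nat j))) \<le> C * norm (Gamma (v - of_nat N))" if N: "N > 0" for N
    proof -
      from inverse_factorial_expansion_bound[OF c N less_imp_neq[OF A_pos, THEN not_sym] q_pos] obtain C B where CB: "\<And>s. Re s > 0 \<Longrightarrow> norm s \<ge> B \<Longrightarrow>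
         norm (of_real (2 * pi / A_par p w) * of_real (h_par p * kappa p powr kappa p) powr s * Gamma_ratio p w s
        - (\<Sum>j<N. (-1) ^ j * c j * Gamma (of_real (kappa p) * s + of_real (vartheta w) - of_nat j)))
        \<le> C * norm (Gamma (of_real (kappa p) * s + of_real (vartheta w) - of_nat N))" by blast
      show ?thesis
      proof (rule exI[of _ C], rule exI[of _ "\<kappa> * B + \<bar>\<theta>\<bar>"], intro allI impI)
        fix v assume v: "0 < Re v \<and> \<kappa> * B + \<bar>\<theta>\<bar> \<le> norm v"
        define s where "s = (v - of_real \<theta>) / of_real \<kappa>"
        have vs: "of_real \<kappa> * s + of_real \<theta> = v" using k0 by (simp add: s_def)
        have "Re s = (Re v - \<theta>) / \<kappa>" by (simp add: s_def)
        hence s0: "Re s > 0" using v th k0 by simp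
        have "norm v \<le> \<kappa> * norm s + \<bar>\<theta>\<bar>"
          using norm_triangle_ineq[of "of_real \<kappa> * s" "of_real \<theta>"] k0 unfolding vs by (simp add: norm_mult)
        hence "\<kappa> * B \<le> \<kappa> * norm s" using v by linarith
        hence sB: "norm s \<ge> B" using k0 by simp
        have "of_real (h_par p * kappa p powr kappa p) powr s = exp (of_real (logq p) * s)"
        proof -
          have nz: "complex_of_real (h_par p * kappa p powr kappa p) \<noteq> 0" using q_pos by (metis less_irrefl of_real_eq_0_iff)
          have ln: "Ln (complex_of_real (h_par p * kappa p powr kappa p)) = of_real (logq p)" unfolding logq_def by (rule Ln_of_real[OF q_pos])
          have powr: "u powr s = exp (Ln u * s)" if "u \<noteq> 0" for u :: complex using that by (simp add: powr_def mult.commute)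
          show ?thesis unfolding powr[OF nz] ln ..
        qed
        hence Fv: "F v = of_real (2 * pi / A_par p w) * of_real (h_par p * kappa p powr kappa p) powr s * Gamma_ratio p w s"
          unfolding F_def s_def[symmetric] ratio_exp_def a_def by (simp only: minus_minus mult_ac)
        show "norm (F v - (\<Sum>j<N. ((-1) ^ j * c j) * Gamma (v - of_nat j))) \<le> C * norm (Gamma (v - of_nat N))"
          using CB[OF s0 sB] unfolding vs Fv .
      qed
    qed
  qed
  then obtain C X0 where CX: "\<And>Y. \<bar>Im Y\<bar> < pi / 2 \<Longrightarrow> exp (Re Y) \<ge> X0 \<Longrightarrow>
     norm (line_integral (\<kappa> * \<sigma> + \<theta>) (\<lambda>v. F v * exp (- Y * v)) - 2 * pi * \<i> * (\<Sum>j<M. ((-1) ^ j * c j) * exp (- of_nat j * Y) * exp (- exp Y)))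
       \<le> C * exp (- real M * Re Y) * exp (- Re (exp Y))" by blast
  define b where "b = A_par (real p) w / (2 * pi * \<kappa>)"
  have b0: "b > 0" using A_pos k0 by (simp add: b_def)
  show ?thesis
  proof (rule exI[of _ "b * C / (2 * pi)"], rule exI[of _ X0], intro allI impI)
    fix L assume L: "\<bar>Im L\<bar> < \<kappa> * (pi / 2) \<and> X0 \<le> exp (Re (log_X p L))"
    define Y where "Y = log_X p L"
    have Y1: "\<bar>Im Y\<bar> < pi / 2" using conjunct1[OF L] unfolding Y_def Im_log_X .
    have Y2: "X0 \<le> exp (Re Y)" using conjunct2[OF L] unfolding Y_def .
    note Y = Y1 Y2
    have LY: "of_real \<kappa> * Y - of_real (logq p) = L" using k0 by (simp add: Y_def log_X_def)
    have f1: "line_integral (\<kappa> * \<sigma> + \<theta>) (\<lambda>v. F v * exp (- Y * v)) = (of_real a * exp (- of_real \<theta> * Y)) * (of_real \<kappa> * line_integral \<sigma> (ratio_exp p w L))"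
      unfolding FY LY line_integral_cmult line_integral_scale[OF k0, of \<sigma> \<theta> "ratio_exp p w L"] ..
    have f2: "of_real b * exp (of_real \<theta> * Y) * ((of_real a * exp (- of_real \<theta> * Y)) * (of_real \<kappa> * I)) = I" for I
    proof -
      have "of_real b * exp (of_real \<theta> * Y) * ((of_real a * exp (- of_real \<theta> * Y)) * (of_real \<kappa> * I)) = of_real (b * a * \<kappa>) * (exp (of_real \<theta> * Y) * exp (- of_real \<theta> * Y)) * I"
        by (simp only: of_real_mult mult_ac)
      also have "b * a * \<kappa> = 1" using A_pos k0 by (simp add: a_def b_def)
      also have "exp (of_real \<theta> * Y) * exp (- of_real \<theta> * Y) = 1" by (simp flip: exp_add)
      finally show ?thesis by simp
    qed
    have I: "line_integral \<sigma> (ratio_exp p w L) = of_real b * exp (of_real \<theta> * Y) * line_integral (\<kappa> * \<sigma> + \<theta>) (\<lambda>v. F v * exp (- Y * v))"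
      unfolding f1 by (rule f2[symmetric])
    have factor: "1 / (2 * pi * \<i>) * (B * E * T) - B * (E * U) = (B * E / (2 * pi * \<i>)) * (T - 2 * pi * \<i> * U)" for B E T U :: complex
      by (simp add: field_simps)
    have S: "(\<Sum>j<M. (-1) ^ j * c j * exp (of_real (\<theta> - real j) * Y) * exp (- exp Y)) = exp (of_real \<theta> * Y) * (\<Sum>j<M. ((-1) ^ j * c j) * exp (- of_nat j * Y) * exp (- exp Y))"
      unfolding sum_distrib_left
    proof (rule sum.cong)
      fix j
      have "exp (of_real (\<theta> - real j) * Y) = exp (of_real \<theta> * Y) * exp (- of_nat j * Y)" by (simp add: algebra_simps flip: exp_add)
      thus "(-1) ^ j * c j * exp (of_real (\<theta> - real j) * Y) * exp (- exp Y) = exp (of_real \<theta> * Y) * ((-1) ^ j * c j * exp (- of_nat j * Y) * exp (- exp Y))"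
        by (simp only: mult_ac)
    qed simp
    have diff: "1 / (2 * pi * \<i>) * line_integral \<sigma> (ratio_exp p w L) - of_real b * (\<Sum>j<M. (-1) ^ j * c j * exp (of_real (\<theta> - real j) * Y) * exp (- exp Y)) =
       (of_real b * exp (of_real \<theta> * Y) / (2 * pi * \<i>)) * (line_integral (\<kappa> * \<sigma> + \<theta>) (\<lambda>v. F v * exp (- Y * v)) - 2 * pi * \<i> * (\<Sum>j<M. ((-1) ^ j * c j) * exp (- of_nat j * Y) * exp (- exp Y)))" (is "?D = _")
      unfolding I S by (rule factor)
    have "norm ?D = (b * exp (\<theta> * Re Y) / (2 * pi)) * norm (line_integral (\<kappa> * \<sigma> + \<theta>) (\<lambda>v. F v * exp (- Y * v)) - 2 * pi * \<i> * (\<Sum>j<M. ((-1) ^ j * c j) * exp (- of_nat j * Y) * exp (- exp Y)))"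
      unfolding diff norm_mult[of "of_real b * exp (of_real \<theta> * Y) / (2 * pi * \<i>)"] using b0 by (simp add: norm_mult norm_divide)
    also have "\<dots> \<le> (b * exp (\<theta> * Re Y) / (2 * pi)) * (C * exp (- real M * Re Y) * exp (- Re (exp Y)))"
      using b0 by (intro mult_left_mono CX Y) auto
    also have "\<dots> = b * C / (2 * pi) * (exp (\<theta> * Re Y) * exp (- real M * Re Y)) * exp (- Re (exp Y))"
      by (simp only: times_divide_eq_left times_divide_eq_right mult_ac)
    also have "exp (\<theta> * Re Y) * exp (- real M * Re Y) = exp ((\<theta> - real M) * Re Y)" by (simp add: algebra_simps flip: exp_add)
    finally show "norm (1 / (2 * pi * \<i>) * line_integral \<sigma> (ratio_exp p w L) -
           of_real (A_par (real p) w / (2 * pi * \<kappa>)) * (\<Sum>j<M. (-1) ^ j * c j * exp (of_real (\<theta> - real j) * log_X p L) * exp (- exp (log_X p L))))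
       \<le> b * C / (2 * pi) * exp ((\<theta> - real M) * Re (log_X p L)) * exp (- Re (exp (log_X p L)))"
      by (simp only: b_def Y_def)
  qed
qed

lemma summable_powr_exp_powr:
  assumes "u > 0" "q \<ge> 1"
  shows "summable (\<lambda>n. real (Suc n) powr x * exp (- u * real (Suc n) powr q))"
proof (rule summable_comparison_test_ev)
  have "(\<lambda>n. real (Suc n) powr (x + 2) * exp (- u * real (Suc n))) \<longlonglongrightarrow> 0" using assms(1) by real_asymp
  hence "eventually (\<lambda>n. real (Suc n) powr (x + 2) * exp (- u * real (Suc n)) < 1) sequentially" by (rule order_tendstoD) simp
  thus "eventually (\<lambda>n. norm (real (Suc n) powr x * exp (- u * real (Suc n) powr q)) \<le> real (Suc n) powr (- 2)) sequentially"
  proof eventually_elim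
    case (elim n)
    define y where "y = real (Suc n)"
    have y: "y \<ge> 1" by (simp add: y_def)
    have "y powr 1 \<le> y powr q" using y assms by (intro powr_mono) auto
    hence "exp (- u * y powr q) \<le> exp (- u * y)" using y assms by simp
    hence "y powr x * exp (- u * y powr q) \<le> y powr x * exp (- u * y)" by (intro mult_left_mono) auto
    also have "\<dots> = (y powr (x + 2) * exp (- u * y)) * y powr (- 2)" using y by (simp add: powr_add powr_minus)
    also have "\<dots> \<le> 1 * y powr (- 2)" using elim by (intro mult_right_mono) (auto simp: y_def)
    finally show ?case by (simp add: y_def)
  qed
  show "summable (\<lambda>n. real (Suc n) powr (- 2))" by (rule summable_powr_neg) simp
qed

lemma zeta_ratio_exp_sums:
  assumes \<sigma>: "\<sigma> > w / real p" and L: "\<bar>Im L\<bar> < \<kappa> * (pi / 2)"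
  shows "(\<lambda>n. of_real (real (Suc n) powr (w - 1)) * line_integral \<sigma> (ratio_exp p w (L + of_real (real p * ln (real (Suc n))))))
           sums line_integral \<sigma> (zeta_ratio_exp p w L)"
proof -
  define u where "u = (\<lambda>n s. 1 / of_nat (Suc n) powr (1 - of_real w + of_real (real p) * s) :: complex)"
  have p0: "p > 0" using p2 by simp
  have gt1: "1 - w + real p * \<sigma> > 1" using \<sigma> p0 by (simp add: field_simps)
  have \<sigma>': "\<sigma> > (w - 1) / real p" using \<sigma> p0 by (simp add: field_simps)
  have sums: "(\<lambda>n. line_integral \<sigma> (\<lambda>s. ratio_exp p w L s * u n s)) sums line_integral \<sigma> (\<lambda>s. ratio_exp p w L s * (\<Sum>n. u n s))"
  proof (rule line_integral_suminf[OF _ strip_bound_ratio_exp[OF p0 L]])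
    show "continuous_on UNIV (\<lambda>t. ratio_exp p w L (Complex \<sigma> t))"
      by (rule continuous_on_line_holomorphic[OF ratio_exp_holomorphic[OF p0]]) (use \<sigma>' in auto)
    show "(\<bar>Im L\<bar> - \<kappa> * (pi / 2)) / 2 < 0" by (rule divide_neg_pos, subst diff_less_0_iff_less, rule L, simp)
    show "continuous_on UNIV (\<lambda>t. u n (Complex \<sigma> t))" for n
      by (rule continuous_on_line_holomorphic[where A = UNIV]) (auto simp: u_def intro!: holomorphic_intros)
    show "summable (\<lambda>n. real (Suc n) powr (- (1 - w + real p * \<sigma>)))" using gt1 by (rule summable_powr_neg)
    fix n t
    have "norm (u n (Complex \<sigma> t)) = 1 / real (Suc n) powr (1 - w + real p * \<sigma>)"
      unfolding u_def norm_divide using norm_powr_real_powr[of "of_nat (Suc n)" "1 - of_real w + of_real (real p) * Complex \<sigma> t"] by simp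
    also have "\<dots> = real (Suc n) powr (- (1 - w + real p * \<sigma>))" by (simp only: powr_minus divide_inverse mult_1_left)
    finally show "norm (u n (Complex \<sigma> t)) \<le> real (Suc n) powr (- (1 - w + real p * \<sigma>))" by (rule eq_refl)
  qed
  have total: "line_integral \<sigma> (\<lambda>s. ratio_exp p w L s * (\<Sum>n. u n s)) = line_integral \<sigma> (zeta_ratio_exp p w L)"
  proof (rule line_integral_cong)
    fix t
    have "Re (1 - of_real w + of_real (real p) * Complex \<sigma> t) > 1" using gt1 by simp
    from zeta_sums[OF this] show "ratio_exp p w L (Complex \<sigma> t) * (\<Sum>n. u n (Complex \<sigma> t)) = zeta_ratio_exp p w L (Complex \<sigma> t)"
      by (simp add: sums_iff u_def zeta_ratio_exp_def mult_ac)
  qed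
  have summand: "line_integral \<sigma> (\<lambda>s. ratio_exp p w L s * u n s) = 
      of_real (real (Suc n) powr (w - 1)) * line_integral \<sigma> (ratio_exp p w (L + of_real (real p * ln (real (Suc n)))))" for n
  proof -
    define d where "d = ln (real (Suc n))"
    have pw: "of_nat (Suc n) powr z = exp (z * of_real d)" for z :: complex
      unfolding d_def by (simp add: powr_def Ln_of_nat del: of_nat_Suc)
    have "real (Suc n) powr (w - 1) = exp ((w - 1) * d)" unfolding d_def by (simp add: powr_def del: of_nat_Suc)
    hence e: "complex_of_real (real (Suc n) powr (w - 1)) = exp (of_real ((w - 1) * d))" by (simp only: exp_of_real)
    have us: "ratio_exp p w L s * u n s = of_real (real (Suc n) powr (w - 1)) * ratio_exp p w (L + of_real (real p * d)) s" for s
    proof -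
      have "u n s = exp (- ((1 - of_real w + of_real (real p) * s) * of_real d))"
        by (simp only: u_def pw exp_minus divide_inverse mult_1_left)
      hence "exp (- L * s) * u n s = exp (- L * s + - ((1 - of_real w + of_real (real p) * s) * of_real d))"
        by (simp only: exp_add)
      also have "- L * s + - ((1 - of_real w + of_real (real p) * s) * of_real d) = of_real ((w - 1) * d) + - (L + of_real (real p * d)) * s"
        by (simp add: algebra_simps)
      finally have "exp (- L * s) * u n s = of_real (real (Suc n) powr (w - 1)) * exp (- (L + of_real (real p * d)) * s)"
        by (simp only: exp_add e)
      thus ?thesis unfolding ratio_exp_def by (simp only: mult.assoc) (simp only: mult.left_commute)
    qed
    show ?thesis unfolding us d_def by (rule line_integral_cmult)
  qed
  show ?thesis using sums unfolding summand total .
qed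

text \<open>This identity is the reason for the exponents \<open>\<lambda>_j\<close>: replacing \<open>L\<close> by \<open>L + p ln n\<close> multiplies \<open>X\<close> by \<open>n^q\<close>, and the powers
of \<open>n\<close> from \<open>X^(\<theta> - j)\<close> and from the Dirichlet series combine to \<open>n^(- \<lambda>_j)\<close>.\<close>

lemma powr_lam_eq: "real (Suc n) powr (w - 1) * exp ((\<theta> - real j) * (q_par (real p) * ln (real (Suc n)))) = real (Suc n) powr (- lam (real p) w j)"
proof -
  have "(w - 1) + (\<theta> - real j) * q_par (real p) = - lam (real p) w j"
    using kappa_ge_1 by (simp add: vartheta_def q_par_def lam_def kappa_def field_simps)
  moreover have "exp ((\<theta> - real j) * (q_par (real p) * ln (real (Suc n)))) = real (Suc n) powr ((\<theta> - real j) * q_par (real p))"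
    by (simp add: powr_def mult_ac)
  ultimately show ?thesis by (simp only: powr_add[symmetric])
qed

text \<open>Summation over \<open>n\<close> of the expansion at \<open>L + p ln n\<close>. Since the estimate for a single \<open>n\<close> holds uniformly for
large \<open>X\<close>, and \<open>Re X n^q \<ge> Re X\<close>, the remainders add up to a convergent multiple of the first one, with ratio \<open>n^(- \<lambda>_M)\<close> and
\<open>\<lambda>_M > 1\<close>.\<close>

theorem line_integral_zeta_ratio_exp_asymptotic:
  assumes \<sigma>: "\<sigma> > w / real p" and M: "M > 0"
  shows "\<exists>C\<ge>0. \<exists>X0. \<forall>L. \<bar>Im L\<bar> < \<kappa> * (pi / 2) \<and> exp (Re (log_X p L)) \<ge> X0 \<longrightarrow>
     norm (1 / (2 * pi * \<i>) * line_integral \<sigma> (zeta_ratio_exp p w L) -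
           of_real (A_par (real p) w / (2 * pi * \<kappa>)) * exp_sum c M (real p) w (exp (log_X p L)))
       \<le> C * (exp ((\<theta> - real M) * Re (log_X p L)) * exp (- Re (exp (log_X p L))))"
proof -
  have p0: "p > 0" using p2 by simp
  have k0: "\<kappa> > 0" using kappa_ge_1 by simp
  have \<sigma>': "\<sigma> > (w - 1) / real p" using \<sigma> p0 by (simp add: field_simps)
  from line_integral_ratio_exp_asymptotic[OF \<sigma>', of M] obtain C0 X0 where CX0: "\<And>L. \<bar>Im L\<bar> < \<kappa> * (pi / 2) \<Longrightarrow> exp (Re (log_X p L)) \<ge> X0 \<Longrightarrow>
     norm (1 / (2 * pi * \<i>) * line_integral \<sigma> (ratio_exp p w L) -
           of_real (A_par (real p) w / (2 * pi * \<kappa>)) * (\<Sum>j<M. (-1) ^ j * c j * exp (of_real (\<theta> - real j) * log_X p L) * exp (- exp (log_X p L))))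
       \<le> C0 * exp ((\<theta> - real M) * Re (log_X p L)) * exp (- Re (exp (log_X p L)))" by blast
  define C where "C = max C0 0"
  define q where "q = q_par (real p)"
  have q1: "q \<ge> 1" using k0 by (simp add: q_def q_par_def kappa_def field_simps)
  define A where "A = A_par (real p) w / (2 * pi * \<kappa>)"
  have lamM: "lam (real p) w M > 1" using k0 w2 M p0 by (simp add: lam_def add_pos_pos)
  define K where "K = (\<Sum>n. real (Suc n) powr (- lam (real p) w M))"
  have smK: "summable (\<lambda>n. real (Suc n) powr (- lam (real p) w M))" by (rule summable_powr_neg[OF lamM])
  have K0: "K \<ge> 0" unfolding K_def by (intro suminf_nonneg smK) auto
  have main: "norm (1 / (2 * pi * \<i>) * line_integral \<sigma> (zeta_ratio_exp p w L) - of_real A * exp_sum c M (real p) w (exp (log_X p L)))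
       \<le> (C * K) * (exp ((\<theta> - real M) * Re (log_X p L)) * exp (- Re (exp (log_X p L))))"
    if L: "\<bar>Im L\<bar> < \<kappa> * (pi / 2)" and X0: "exp (Re (log_X p L)) \<ge> X0" for L
  proof -
    define Y where "Y = log_X p L"
    define X where "X = exp Y"
    define u where "u = Re X"
    have Y: "\<bar>Im Y\<bar> < pi / 2" using L unfolding Y_def Im_log_X .
    have u: "u > 0" using Y by (auto simp: u_def X_def Re_exp intro!: mult_pos_pos cos_gt_zero_pi)
    define \<nu> where "\<nu> = (\<lambda>n. real (Suc n))"
    define Ln' where "Ln' = (\<lambda>n. L + of_real (real p * ln (\<nu> n)))"
    have \<nu>: "\<nu> n \<ge> 1" for n by (simp add: \<nu>_def)
    have YL: "log_X p (Ln' n) = Y + of_real (q * ln (\<nu> n))" for n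
      using k0 by (simp add: log_X_def Ln'_def Y_def q_def q_par_def add_divide_distrib)
    have XL: "exp (log_X p (Ln' n)) = X * of_real (\<nu> n powr q)" for n
    proof -
      have "exp (complex_of_real (q * ln (\<nu> n))) = of_real (\<nu> n powr q)" using \<nu>[of n] by (subst exp_of_real) (simp add: powr_def)
      thus ?thesis unfolding YL exp_add X_def by (simp only:)
    qed
    have ReXL: "Re (exp (log_X p (Ln' n))) = u * \<nu> n powr q" for n unfolding XL by (simp add: u_def)
    have lnn: "q * ln (\<nu> n) \<ge> 0" for n using \<nu>[of n] q1 by (intro mult_nonneg_nonneg) auto
    define G where "G = (\<lambda>n. 1 / (2 * pi * \<i>) * line_integral \<sigma> (ratio_exp p w (Ln' n)))"
    define H where "H = (\<lambda>n. of_real A * (\<Sum>j<M. (-1) ^ j * c j * exp (of_real (\<theta> - real j) * log_X p (Ln' n)) * exp (- exp (log_X p (Ln' n)))))"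
    define t where "t = (\<lambda>n. \<nu> n powr (w - 1))"
    have GH: "norm (G n - H n) \<le> C * exp ((\<theta> - real M) * Re (log_X p (Ln' n))) * exp (- Re (exp (log_X p (Ln' n))))" for n
    proof -
      have "\<bar>Im (Ln' n)\<bar> < \<kappa> * (pi / 2)" using L by (simp add: Ln'_def)
      moreover have "exp (Re (log_X p (Ln' n))) \<ge> X0"
      proof -
        have "Re (log_X p L) \<le> Re (log_X p (Ln' n))" unfolding YL using lnn[of n] by (simp add: Y_def)
        thus ?thesis using X0 by (meson exp_le_cancel_iff order_trans)
      qed
      ultimately have "norm (G n - H n) \<le> C0 * exp ((\<theta> - real M) * Re (log_X p (Ln' n))) * exp (- Re (exp (log_X p (Ln' n))))"
        unfolding G_def H_def A_def by (rule CX0)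
      also have "\<dots> \<le> C * exp ((\<theta> - real M) * Re (log_X p (Ln' n))) * exp (- Re (exp (log_X p (Ln' n))))"
        by (intro mult_right_mono) (auto simp: C_def)
      finally show ?thesis .
    qed
    have sumsG: "(\<lambda>n. of_real (t n) * G n) sums (1 / (2 * pi * \<i>) * line_integral \<sigma> (zeta_ratio_exp p w L))"
    proof -
      have "(\<lambda>n. 1 / (2 * pi * \<i>) * (of_real (t n) * line_integral \<sigma> (ratio_exp p w (Ln' n)))) sums (1 / (2 * pi * \<i>) * line_integral \<sigma> (zeta_ratio_exp p w L))"
        using zeta_ratio_exp_sums[OF \<sigma> L] unfolding t_def Ln'_def \<nu>_def by (rule sums_mult)
      thus ?thesis unfolding G_def by (simp only: mult.left_commute)
    qed
    have LnX: "Ln X = Y" unfolding X_def using Y pi_gt_zero by (intro Ln_exp) (auto simp: abs_if split: if_splits)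
    have Xpow: "X powr z = exp (z * Y)" for z by (simp add: powr_def LnX) (simp add: X_def)
    have sumsS: "(\<lambda>n. of_real (\<nu> n powr (- lam (real p) w j)) * exp (- X * of_real (\<nu> n powr q))) sums S_series q X (lam (real p) w j)" for j
    proof -
      have "summable (\<lambda>n. norm (of_real (\<nu> n powr (- lam (real p) w j)) * exp (- X * of_real (\<nu> n powr q))))"
        using summable_powr_exp_powr[OF u q1, of "- lam (real p) w j"] by (simp add: norm_mult u_def \<nu>_def)
      from summable_sums[OF summable_norm_cancel[OF this]] show ?thesis by (simp add: S_series_def \<nu>_def)
    qed
    have tH: "of_real (t n) * H n = of_real A * (\<Sum>j<M. ((-1) ^ j * c j * X powr of_real (\<theta> - real j)) * (of_real (\<nu> n powr (- lam (real p) w j)) * exp (- X * of_real (\<nu> n powr q))))" for n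
    proof -
      have term_eq: "of_real (t n) * ((-1) ^ j * c j * exp (of_real (\<theta> - real j) * log_X p (Ln' n)) * exp (- exp (log_X p (Ln' n)))) =
         ((-1) ^ j * c j * X powr of_real (\<theta> - real j)) * (of_real (\<nu> n powr (- lam (real p) w j)) * exp (- X * of_real (\<nu> n powr q)))" for j
      proof -
        have "exp (of_real (\<theta> - real j) * log_X p (Ln' n)) = exp (of_real (\<theta> - real j) * Y) * of_real (exp ((\<theta> - real j) * (q * ln (\<nu> n))))"
          unfolding YL distrib_left exp_add by (simp only: exp_of_real[symmetric] of_real_mult)
        moreover have "\<nu> n powr (- lam (real p) w j) = t n * exp ((\<theta> - real j) * (q * ln (\<nu> n)))"
          unfolding t_def q_def \<nu>_def by (rule powr_lam_eq[symmetric])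
        ultimately show ?thesis unfolding XL Xpow by (simp only: of_real_mult mult_minus_left mult_ac)
      qed
      show ?thesis unfolding H_def by (simp only: sum_distrib_left term_eq[symmetric]) (simp only: mult.left_commute)
    qed
    have sumsH: "(\<lambda>n. of_real (t n) * H n) sums (of_real A * exp_sum c M (real p) w X)"
      unfolding tH exp_sum_def q_def[symmetric] by (intro sums_mult sums_sum sumsS)
    have "(\<lambda>n. of_real (t n) * G n - of_real (t n) * H n) sums (1 / (2 * pi * \<i>) * line_integral \<sigma> (zeta_ratio_exp p w L) - of_real A * exp_sum c M (real p) w X)"
      by (rule sums_diff[OF sumsG sumsH])
    hence "1 / (2 * pi * \<i>) * line_integral \<sigma> (zeta_ratio_exp p w L) - of_real A * exp_sum c M (real p) w X = (\<Sum>n. of_real (t n) * G n - of_real (t n) * H n)"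
      by (simp only: sums_iff)
    also have "norm \<dots> \<le> (\<Sum>n. (C * (exp ((\<theta> - real M) * Re Y) * exp (- u))) * \<nu> n powr (- lam (real p) w M))"
    proof (rule norm_suminf_le)
      show "summable (\<lambda>n. (C * (exp ((\<theta> - real M) * Re Y) * exp (- u))) * \<nu> n powr (- lam (real p) w M))"
        using smK unfolding \<nu>_def by (rule summable_mult)
      fix n
      have "norm (of_real (t n) * G n - of_real (t n) * H n) = t n * norm (G n - H n)"
        by (simp add: t_def norm_mult flip: right_diff_distrib)
      also have "\<dots> \<le> t n * (C * exp ((\<theta> - real M) * Re (log_X p (Ln' n))) * exp (- Re (exp (log_X p (Ln' n)))))"
        by (intro mult_left_mono GH) (simp add: t_def)
      also have "exp ((\<theta> - real M) * Re (log_X p (Ln' n))) = exp ((\<theta> - real M) * Re Y) * exp ((\<theta> - real M) * (q * ln (\<nu> n)))"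
        unfolding YL by (simp add: distrib_left exp_add)
      also have "t n * (C * (exp ((\<theta> - real M) * Re Y) * exp ((\<theta> - real M) * (q * ln (\<nu> n)))) * exp (- Re (exp (log_X p (Ln' n))))) =
          (C * exp ((\<theta> - real M) * Re Y)) * (t n * exp ((\<theta> - real M) * (q * ln (\<nu> n)))) * exp (- Re (exp (log_X p (Ln' n))))"
        by (simp only: mult_ac)
      also have "t n * exp ((\<theta> - real M) * (q * ln (\<nu> n))) = \<nu> n powr (- lam (real p) w M)"
        unfolding t_def q_def \<nu>_def by (rule powr_lam_eq)
      also have "(C * exp ((\<theta> - real M) * Re Y)) * \<nu> n powr (- lam (real p) w M) * exp (- Re (exp (log_X p (Ln' n)))) \<le>
          (C * exp ((\<theta> - real M) * Re Y)) * \<nu> n powr (- lam (real p) w M) * exp (- u)"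
      proof (intro mult_left_mono)
        have "1 \<le> \<nu> n powr q" using \<nu>[of n] q1 by (intro ge_one_powr_ge_zero) auto
        hence "u * 1 \<le> u * \<nu> n powr q" using u by (intro mult_left_mono) auto
        thus "exp (- Re (exp (log_X p (Ln' n)))) \<le> exp (- u)" unfolding ReXL by simp
      qed (auto simp: C_def)
      finally show "norm (of_real (t n) * G n - of_real (t n) * H n) \<le> (C * (exp ((\<theta> - real M) * Re Y) * exp (- u))) * \<nu> n powr (- lam (real p) w M)"
        by (simp only: mult_ac)
    qed
    also have "\<dots> = (C * (exp ((\<theta> - real M) * Re Y) * exp (- u))) * K"
      unfolding K_def \<nu>_def by (rule suminf_mult[OF smK])
    finally show ?thesis unfolding Y_def X_def u_def by (simp only: mult_ac)
  qed
  show ?thesis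
    by (rule exI[of _ "C * K"], intro conjI, use K0 in \<open>simp add: C_def\<close>, rule exI[of _ X0])
       (use main in \<open>auto simp only: A_def\<close>)
qed

end

section \<open>The variable X and the remainder estimates\<close>

text \<open>The modulus of \<open>X\<close> depends only on that of \<open>a\<close>, so it becomes large uniformly in the sector.\<close>

lemma eventually_small_in_sector:
  assumes p: "p \<ge> 2"
  shows "\<forall>\<^sub>F a in at 0 within right_half_sector. a \<in> right_half_sector \<and> X0 \<le> exp (Re (log_X p (log_chi p a)))"
proof -
  have k0: "kappa (real p) > 0" using p by (simp add: kappa_def)
  define B where "B = ln (max X0 1)"
  define d where "d = exp (real p * ln (2 * pi) + logq p - kappa (real p) * B)"
  have d: "d > 0" by (simp add: d_def)
  have "X0 \<le> exp (Re (log_X p (log_chi p a)))" if a: "a \<noteq> 0" "norm a < d" for a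
  proof -
    have "ln (norm a) < ln d" using a d by (subst ln_less_cancel_iff) auto
    hence "kappa (real p) * B \<le> real p * ln (2 * pi) - ln (norm a) + logq p" unfolding d_def by simp
    moreover have "Re (log_X p (log_chi p a)) = (real p * ln (2 * pi) - ln (norm a) + logq p) / kappa (real p)"
      using a by (simp add: log_X_def log_chi_def)
    ultimately have "B \<le> Re (log_X p (log_chi p a))" using k0 by (simp add: pos_le_divide_eq mult.commute)
    hence "exp B \<le> exp (Re (log_X p (log_chi p a)))" by simp
    moreover have "exp B = max X0 1" by (simp add: B_def)
    ultimately show ?thesis by linarith
  qed
  with d show ?thesis unfolding eventually_at by (auto intro!: exI[of _ d])
qed

context
  fixes m p l :: nat and w :: real and a :: complex
  assumes m: "m > 0" and l: "l > 0" "p = 2 * l" and w: "w = 2 * real m" and a: "a \<in> right_half_sector"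
begin

lemma X_var_eq: "X_var (real p) a = exp (log_X p (log_chi p a))"
proof -
  define k where "k = kappa (real p)"
  define h where "h = h_par (real p)"
  have k0: "k > 0" using l by (simp add: k_def kappa_def)
  have h0: "h > 0" using l by (simp add: h_def h_par_def)
  have logq: "logq p = ln h + k * ln k" 
    unfolding logq_def h_def[symmetric] k_def[symmetric] using k0 h0 by (simp add: ln_mult ln_powr)
  have eh: "complex_of_real h = exp (of_real (ln h))" and ek: "complex_of_real k = exp (of_real (ln k))"
    using h0 k0 by (simp_all only: exp_of_real exp_ln)
  have hc: "of_real h * chi (real p) a = exp (of_real (ln h) + log_chi p a)"
    unfolding chi_eq_exp[OF m l w a] exp_add eh[symmetric] ..
  have "\<bar>Im (of_real (ln h) + log_chi p a)\<bar> < pi / 2" using Arg_a[OF m l w a] by (simp add: log_chi_def)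
  hence "Ln (of_real h * chi (real p) a) = of_real (ln h) + log_chi p a"
    unfolding hc using pi_gt_zero by (intro Ln_exp) (auto simp: abs_less_iff)
  moreover have "of_real h * chi (real p) a \<noteq> 0" unfolding hc by simp
  ultimately have pw: "(of_real h * chi (real p) a) powr of_real (1 / k) = exp (of_real (1 / k) * (of_real (ln h) + log_chi p a))"
    by (simp only: powr_def if_False)
  have "X_var (real p) a = exp (of_real (ln k)) * exp (of_real (1 / k) * (of_real (ln h) + log_chi p a))"
    unfolding X_var_def h_def[symmetric] k_def[symmetric] pw ek[symmetric] ..
  also have "\<dots> = exp (of_real (ln k) + of_real (1 / k) * (of_real (ln h) + log_chi p a))" by (simp only: exp_add)
  also have "of_real (ln k) + of_real (1 / k) * (of_real (ln h) + log_chi p a) = log_X p (log_chi p a)"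
    using k0 unfolding log_X_def logq k_def[symmetric] by (simp add: field_simps)
  finally show ?thesis .
qed

lemma X_rot_eq:
  assumes "r < l div 2"
  shows "X_rot (- e) (real p) r a = exp (log_X p (log_chi p a - of_real e * pi * \<i> * of_real (freq p r)))"
proof -
  define k where "k = kappa (real p)"
  have k0: "k > 0" using l by (simp add: k_def kappa_def)
  have "psi (real p) r = freq p r / k"
    using assms unfolding psi_def freq_def l(2) N_par_even k_def by simp
  hence "X_rot (- e) (real p) r a = exp (log_X p (log_chi p a) + of_real (- e) * pi * \<i> * of_real (freq p r / k))"
    by (simp only: X_rot_def X_var_eq exp_add)
  also have "log_X p (log_chi p a) + of_real (- e) * pi * \<i> * of_real (freq p r / k) = log_X p (log_chi p a - of_real e * pi * \<i> * of_real (freq p r))"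
    using k0 unfolding log_X_def k_def[symmetric] by (simp add: field_simps)
  finally show ?thesis .
qed

lemma X_rot_last: "X_rot e (real p) (N_par (real p)) a = X_var (real p) a"
  by (simp add: X_rot_def psi_def)

lemma norm_X_powr_exp:
  "norm (X_var (real p) a powr of_real t * exp (- Z)) = exp (t * Re (log_X p (log_chi p a))) * exp (- Re Z)"
proof -
  have "norm (X_var (real p) a powr of_real t) = norm (X_var (real p) a) powr t"
    using norm_powr_real_powr'[of "of_real t" "X_var (real p) a"] by simp
  also have "norm (X_var (real p) a) = exp (Re (log_X p (log_chi p a)))" by (simp only: X_var_eq norm_exp_eq_Re)
  also have "exp (Re (log_X p (log_chi p a))) powr t = exp (t * Re (log_X p (log_chi p a)))" by (simp add: powr_def)
  finally show ?thesis by (simp only: norm_mult norm_exp_eq_Re uminus_complex.sel)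
qed

lemma Re_log_X_rotated: "Re (log_X p (log_chi p a - of_real e * pi * \<i> * of_real x)) = Re (log_X p (log_chi p a))"
  by (simp add: log_X_def)

end

theorem theorem1:
  fixes m M p K N pstar :: nat and w \<delta> \<sigma> :: real and c :: "nat \<Rightarrow> complex"
  assumes "m > 0" and "M > 0" and "p > 0" and "even p"
    and "w = 2 * real m"
    and "K = nat \<lfloor>w / real p\<rfloor>" and "N = N_par (real p)" and "pstar = 4 * N + 2"
    and "\<delta> > 0" and "\<sigma> > w / real p + \<delta>"
    and "inverse_factorial_coeffs (real p) w c"
  shows
    "(\<forall>a\<in>right_half_sector.
        S_series (real p) a w =
          of_real (1 / real p * Gamma ((1 - w) / real p)) * a powr of_real ((w - 1) / real p)
          + (\<Sum>k=0..K. (-1) ^ k / fact k * zeta (of_real (w - real p * real k)) * a ^ k)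
          + (-1) ^ m * of_real ((2 * pi) powr w) * I_L \<sigma> m (real p) w a) \<and>
     (\<forall>a\<in>right_half_sector.
        I_L \<sigma> m (real p) w a =
          (\<Sum>r<N. E_fun \<sigma> (real p) w r a)
          + (if p = pstar then 1 else 0) * E_hat \<sigma> (real p) w a) \<and>
     (\<exists>R :: nat \<Rightarrow> complex \<Rightarrow> complex.
        (\<forall>r<N. \<forall>a\<in>right_half_sector.
           E_fun \<sigma> (real p) w r a =
             of_real (A_par (real p) w / (2 * pi * kappa (real p))) *
               (exp_sum c M (real p) w (X_rot (-1) (real p) r a)
                + exp_sum c M (real p) w (X_rot 1 (real p) r a))
             + R r a) \<and>
        (\<forall>a\<in>right_half_sector.
           E_hat \<sigma> (real p) w a =
             of_real (A_par (real p) w / (2 * pi * kappa (real p))) *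
               exp_sum c M (real p) w (X_var (real p) a)
             + R N a) \<and>
        (\<forall>r\<le>N.
           (\<lambda>a. norm (R r a)) \<in> O[at 0 within right_half_sector](\<lambda>a.
              max (norm (X_var (real p) a powr of_real (vartheta w - real M)
                         * exp (- X_rot 1 (real p) r a)))
                  (norm (X_var (real p) a powr of_real (vartheta w - real M)
                         * exp (- X_rot (-1) (real p) r a))))))"
proof -
  from \<open>even p\<close> \<open>p > 0\<close> obtain l where l: "l > 0" "p = 2 * l" by (auto elim!: evenE)
  have p2: "p \<ge> 2" using l by simp
  have w1: "w \<ge> 1" using \<open>m > 0\<close> \<open>w = 2 * real m\<close> by simp
  have \<sigma>: "\<sigma> > w / real p" using \<open>\<delta> > 0\<close> \<open>\<sigma> > w / real p + \<delta>\<close> by linarith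
  have N: "N = l div 2" unfolding \<open>N = N_par (real p)\<close> l(2) by (rule N_par_even)
  have pstar: "p = pstar \<longleftrightarrow> odd l" unfolding \<open>pstar = 4 * N + 2\<close> N l(2) by presburger
  define A where "A = A_par (real p) w / (2 * pi * kappa (real p))"
  define X where "X = X_var (real p)"
  define t where "t = vartheta w - real M"
  define g where "g = (\<lambda>Z a. norm (X a powr of_real t * exp (- Z)))"
  from line_integral_zeta_ratio_exp_asymptotic[OF p2 w1 \<open>inverse_factorial_coeffs (real p) w c\<close> \<sigma> \<open>M > 0\<close>]
  obtain C X0 where C: "C \<ge> 0" and asym: "\<And>L. \<bar>Im L\<bar> < kappa (real p) * (pi / 2) \<Longrightarrow> X0 \<le> exp (Re (log_X p L)) \<Longrightarrow>
     norm (1 / (2 * pi * \<i>) * line_integral \<sigma> (zeta_ratio_exp p w L) - of_real A * exp_sum c M (real p) w (exp (log_X p L)))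
       \<le> C * (exp (t * Re (log_X p L)) * exp (- Re (exp (log_X p L))))"
    unfolding A_def t_def by blast
  note ctx = \<open>m > 0\<close> l \<open>w = 2 * real m\<close>
  have J_bound: "norm (J_pm \<sigma> e (real p) w r a - of_real A * exp_sum c M (real p) w (X_rot (- e) (real p) r a)) \<le> C * g (X_rot (- e) (real p) r a) a"
    if a: "a \<in> right_half_sector" "X0 \<le> exp (Re (log_X p (log_chi p a)))" and r: "r < N" and e: "\<bar>e\<bar> = 1" for a r e
    using asym[OF Im_log_chi_rotated[OF ctx a(1) e r[unfolded N]]] a(2)
    unfolding J_pm_eq[OF ctx a(1)] X_rot_eq[OF ctx a(1) r[unfolded N]] g_def X_def norm_X_powr_exp[OF ctx a(1)]
    by (simp only: Re_log_X_rotated[OF ctx a(1)])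
  have E_hat_bound: "norm (E_hat \<sigma> (real p) w a - of_real A * exp_sum c M (real p) w (X a)) \<le> C * g (X a) a"
    if a: "a \<in> right_half_sector" "X0 \<le> exp (Re (log_X p (log_chi p a)))" for a
    using asym[OF Im_log_chi[OF ctx a(1)] a(2)]
    unfolding E_hat_eq[OF ctx a(1)] g_def X_def norm_X_powr_exp[OF ctx a(1)] unfolding X_var_eq[OF ctx a(1)] .
  define R where "R = (\<lambda>r a. if r < N
      then E_fun \<sigma> (real p) w r a - of_real A * (exp_sum c M (real p) w (X_rot (-1) (real p) r a) + exp_sum c M (real p) w (X_rot 1 (real p) r a))
      else E_hat \<sigma> (real p) w a - of_real A * exp_sum c M (real p) w (X a))"
  have R_bigo: "(\<lambda>a. norm (R r a)) \<in> O[at 0 within right_half_sector](\<lambda>a. max (g (X_rot 1 (real p) r a) a) (g (X_rot (-1) (real p) r a) a))"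
    if r: "r \<le> N" for r
  proof (rule landau_o.bigI[of "2 * C + 1"])
    show "2 * C + 1 > 0" using C by simp
    show "\<forall>\<^sub>F a in at 0 within right_half_sector. norm (norm (R r a)) \<le> (2 * C + 1) * norm (max (g (X_rot 1 (real p) r a) a) (g (X_rot (-1) (real p) r a) a))"
      using eventually_small_in_sector[OF p2, of X0]
    proof eventually_elim
      case (elim a)
      hence a: "a \<in> right_half_sector" "X0 \<le> exp (Re (log_X p (log_chi p a)))" by auto
      define G where "G = max (g (X_rot 1 (real p) r a) a) (g (X_rot (-1) (real p) r a) a)"
      have G: "g (X_rot 1 (real p) r a) a \<le> G" "g (X_rot (-1) (real p) r a) a \<le> G" "0 \<le> G"
        by (auto simp: G_def g_def le_max_iff_disj)
      have CG: "C * g (X_rot 1 (real p) r a) a \<le> C * G" "C * g (X_rot (-1) (real p) r a) a \<le> C * G" "0 \<le> C * G"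
        using C G by (auto intro: mult_left_mono)
      have "norm (R r a) \<le> 2 * (C * G)"
      proof (cases "r < N")
        case True
        have "R r a = (J_pm \<sigma> 1 (real p) w r a - of_real A * exp_sum c M (real p) w (X_rot (-1) (real p) r a))
                    + (J_pm \<sigma> (-1) (real p) w r a - of_real A * exp_sum c M (real p) w (X_rot 1 (real p) r a))"
          using True by (simp add: R_def E_fun_def algebra_simps)
        also have "norm \<dots> \<le> C * g (X_rot (-1) (real p) r a) a + C * g (X_rot 1 (real p) r a) a"
          using J_bound[OF a True, of 1] J_bound[OF a True, of "-1"] by (intro norm_triangle_mono) simp_all
        finally show ?thesis using CG by linarith
      next
        case False
        hence rN: "r = N_par (real p)" using r \<open>N = N_par (real p)\<close> by simp
        have "norm (R r a) \<le> C * g (X a) a" using E_hat_bound[OF a] False by (simp add: R_def)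
        also have "X a = X_rot 1 (real p) r a" unfolding rN X_def X_rot_last[OF ctx a(1)] ..
        finally show ?thesis using CG by linarith
      qed
      hence "norm (R r a) \<le> (2 * C + 1) * G" using G(3) by (simp add: algebra_simps)
      thus ?case using G(3) by (simp add: G_def)
    qed
  qed
  show ?thesis
  proof (intro conjI ballI exI[of _ R] allI impI)
    fix a assume a: "a \<in> right_half_sector"
    show "S_series (real p) a w =
          of_real (1 / real p * Gamma ((1 - w) / real p)) * a powr of_real ((w - 1) / real p)
          + (\<Sum>k=0..K. (-1) ^ k / fact k * zeta (of_real (w - real p * real k)) * a ^ k)
          + (-1) ^ m * of_real ((2 * pi) powr w) * I_L \<sigma> m (real p) w a"
      by (rule S_series_eq[OF ctx a \<open>K = nat \<lfloor>w / real p\<rfloor>\<close> \<sigma>])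
    show "I_L \<sigma> m (real p) w a = (\<Sum>r<N. E_fun \<sigma> (real p) w r a) + (if p = pstar then 1 else 0) * E_hat \<sigma> (real p) w a"
      unfolding pstar N by (rule I_L_eq_sum_E[OF ctx a \<sigma>])
    show "E_hat \<sigma> (real p) w a = of_real (A_par (real p) w / (2 * pi * kappa (real p))) * exp_sum c M (real p) w (X_var (real p) a) + R N a"
      by (simp add: R_def A_def X_def)
  next
    fix r a assume "r < N"
    thus "E_fun \<sigma> (real p) w r a = of_real (A_par (real p) w / (2 * pi * kappa (real p))) *
               (exp_sum c M (real p) w (X_rot (-1) (real p) r a) + exp_sum c M (real p) w (X_rot 1 (real p) r a)) + R r a"
      by (simp add: R_def A_def)
  next
    fix r assume "r \<le> N"
    from R_bigo[OF this] show "(\<lambda>a. norm (R r a)) \<in> O[at 0 within right_half_sector](\<lambda>a.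
              max (norm (X_var (real p) a powr of_real (vartheta w - real M) * exp (- X_rot 1 (real p) r a)))
                  (norm (X_var (real p) a powr of_real (vartheta w - real M) * exp (- X_rot (-1) (real p) r a))))"
      unfolding g_def X_def t_def .
  qed
qed


end
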